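(* Let $q\in\mathbb{N}$ and let $\mathfrak{c}$ be an ample $q$-zigzagged constellation. Then $\mathfrak{c}$ has no induced subgraph isomorphic to any of the following. (i) An ample interrupted $(2q+6,l)$-constellation, for $l\in\mathbb{N}$. (ii) A subdivision of $T_{64q^2}$ or the line graph of a subdivision of $T_{64q^2}$. (iii) A subdivision of $W_{2^{64q^2}\times 2^{64q^2}}$ or the line graph of a subdivision of $W_{2^{64q^2}\times 2^{64q^2}}$.
   Context: $\mathbb{N}$ is the set of positive integers. Graphs are finite, with no loops and no parallel edges. A path in a graph $G$ is an induced subgraph of $G$ that is a path (a single vertex counts as a path); the interior $R^*$ of a path $R$ is $R$ minus its ends. $T_r$ is the full binary tree of radius $r$ (on $2^{r+1}-1$ vertices). A subdivision of $H$ is obtained by replacing each edge $e=uv$ by a path $P_e$ of length at least 1 from $u$ to $v$, the interiors being pairwise disjoint and with no edges between them. Wall: $W_{r\times r}$ denotes the $r$-by-$r$ hexagonal grid, also known as the $r$-by-$r$ wall. Concretely, for $r\ge 2$: take the vertex set $\{(i,j):1\le i\le r,\ 1\le j\le 2r\}$, with edges $(i,j)(i,j+1)$ for $1\le i\le r$, $1\le j\le 2r-1$, and $(i,j)(i+1,j)$ for $1\le i\le r-1$, $1\le j\le 2r$ with $i+j$ even, and delete the vertices of degree one. Constellation: a graph $\mathfrak{c}$ together with a stable set $S_{\mathfrak{c}}$ such that every component of $\mathfrak{c}\setminus S_{\mathfrak{c}}$ is a path, and each $x\in S_{\mathfrak{c}}$ has at least one neighbor in each component of $\mathfrak{c}\setminus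 S_{\mathfrak{c}}$. $\mathcal{L}_{\mathfrak{c}}$ is the set of components of $\mathfrak{c}\setminus S_{\mathfrak{c}}$. An $(s,l)$-constellation has $|S_{\mathfrak{c}}|=s$ and $|\mathcal{L}_{\mathfrak{c}}|=l$. A $\mathfrak{c}$-route is a path $R$ in $\mathfrak{c}$ with two distinct ends, both in $S_{\mathfrak{c}}$, and with $R^*\subseteq V(L)$ for some $L\in\mathcal{L}_{\mathfrak{c}}$. $\mathfrak{c}$ is ample if there is no $\mathfrak{c}$-route of length at most 2, i.e. no two vertices in $S_{\mathfrak{c}}$ have a common neighbor in $\mathfrak{c}\setminus S_{\mathfrak{c}}$. $\mathfrak{c}$ is interrupted if there is a linear order $\preccurlyeq$ on $S_{\mathfrak{c}}$ such that for all $x,y,z\in S_{\mathfrak{c}}$ with $x\prec y\prec z$ and every $\mathfrak{c}$-route $R$ from $x$ to $y$, the vertex $z$ has a neighbor in $R$. For $q\in\mathbb{N}$, $\mathfrak{c}$ is $q$-zigzagged if there is a linear order $\preccurlyeq$ on $S_{\mathfrak{c}}$ such that for all $x,y\in S_{\mathfrak{c}}$ with $x\prec y$ and every $\mathfrak{c}$-route $R$ from $x$ to $y$, there are fewer than $q$ vertices $z\in S_{\mathfrak{c}}$ where $x\prec z\prec y$ and $z$ has no neighbor in $R$. *)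

theory Defs
  imports Main
begin

section \<open>Finite simple graphs\<close>

datatype 'a graph = Graph (verts: "'a set") (edges: "'a set set")

definition simple_graph :: "'a graph \<Rightarrow> bool" where
  "simple_graph G \<longleftrightarrow> finite (verts G) \<and>
     edges G \<subseteq> {{u, v} |u v. u \<in> verts G \<and> v \<in> verts G \<and> u \<noteq> v}"

definition adjacent :: "'a graph \<Rightarrow> 'a \<Rightarrow> 'a \<Rightarrow> bool" where
  "adjacent G u v \<longleftrightarrow> {u, v} \<in> edges G"

definition degree :: "'a graph \<Rightarrow> 'a \<Rightarrow> nat" where
  "degree G v = card {u \<in> verts G. adjacent G v u}"

definition induce :: "'a graph \<Rightarrow> 'a set \<Rightarrow> 'a graph" where
  "induce G X = Graph (verts G \<inter> X) {e \<in> edges G. e \<subseteq> X}"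

definition delete_verts :: "'a graph \<Rightarrow> 'a set \<Rightarrow> 'a graph" where
  "delete_verts G X = induce G (verts G - X)"

definition graph_iso :: "'a graph \<Rightarrow> 'b graph \<Rightarrow> bool" where
  "graph_iso G H \<longleftrightarrow> (\<exists>f. bij_betw f (verts G) (verts H) \<and>
     (\<forall>u \<in> verts G. \<forall>v \<in> verts G. adjacent G u v \<longleftrightarrow> adjacent H (f u) (f v)))"

definition has_induced :: "'a graph \<Rightarrow> 'b graph \<Rightarrow> bool" where
  "has_induced G H \<longleftrightarrow> (\<exists>X \<subseteq> verts G. graph_iso (induce G X) H)"

definition stable_set :: "'a graph \<Rightarrow> 'a set \<Rightarrow> bool" where
  "stable_set G S \<longleftrightarrow> S \<subseteq> verts G \<and> (\<forall>u \<in> S. \<forall>v \<in> S. \<not> adjacent G u v)"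

definition reachable :: "'a graph \<Rightarrow> 'a rel" where
  "reachable G = {(u, v). adjacent G u v}\<^sup>* \<inter> (verts G \<times> verts G)"

definition components :: "'a graph \<Rightarrow> 'a graph set" where
  "components G = induce G ` (verts G // reachable G)"

definition line_graph :: "'a graph \<Rightarrow> 'a set graph" where
  "line_graph G = Graph (edges G)
     {{e, f} |e f. e \<in> edges G \<and> f \<in> edges G \<and> e \<noteq> f \<and> e \<inter> f \<noteq> {}}"


section \<open>Paths and subdivisions\<close>

text \<open>A path is represented by the list of its vertices in order; its length (number of edges)
  is one less than the length of that list.\<close>

definition path_edges :: "'a list \<Rightarrow> 'a set set" where
  "path_edges p = {{p ! i, p ! Suc i} |i. Suc i < length p}"

definition path_graph :: "'a list \<Rightarrow> 'a graph" where
  "path_graph p = Graph (set p) (path_edges p)"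

definition is_path :: "'a graph \<Rightarrow> bool" where
  "is_path G \<longleftrightarrow> (\<exists>p. p \<noteq> [] \<and> distinct p \<and> G = path_graph p)"

text \<open>Paths in a graph are induced subgraphs.\<close>

definition path_in :: "'a graph \<Rightarrow> 'a list \<Rightarrow> bool" where
  "path_in G p \<longleftrightarrow> p \<noteq> [] \<and> distinct p \<and> set p \<subseteq> verts G \<and> induce G (set p) = path_graph p"

definition path_length :: "'a list \<Rightarrow> nat" where
  "path_length p = length p - 1"

definition interior :: "'a list \<Rightarrow> 'a set" where
  "interior p = set (butlast (tl p))"

text \<open>\<open>K\<close> is, up to renaming its vertices, a subdivision of \<open>H\<close>: the map \<open>b\<close> places the original
  vertices, and \<open>P e\<close> is the path replacing the edge \<open>e\<close>. Since the edges of \<open>K\<close> are exactly those of the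
  paths, there are no edges between the interiors of different paths.\<close>

definition subdivision_of :: "'b graph \<Rightarrow> 'a graph \<Rightarrow> bool" where
  "subdivision_of K H \<longleftrightarrow> (\<exists>(b :: 'a \<Rightarrow> 'b) (P :: 'a set \<Rightarrow> 'b list).
     inj_on b (verts H) \<and>
     (\<forall>e \<in> edges H. distinct (P e) \<and> path_length (P e) \<ge> 1 \<and>
        {hd (P e), last (P e)} = b ` e \<and> interior (P e) \<inter> b ` verts H = {}) \<and>
     (\<forall>e \<in> edges H. \<forall>f \<in> edges H. e \<noteq> f \<longrightarrow> interior (P e) \<inter> interior (P f) = {}) \<and>
     verts K = b ` verts H \<union> (\<Union>e \<in> edges H. set (P e)) \<and>
     edges K = (\<Union>e \<in> edges H. path_edges (P e)))"


section \<open>Binary trees and walls\<close>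

text \<open>A vertex of the full binary tree of radius \<open>r\<close> is the (reversed) sequence of left/right
  choices leading to it from the root.\<close>

definition binary_tree :: "nat \<Rightarrow> bool list graph" where
  "binary_tree r = Graph {xs. length xs \<le> r} {{xs, x # xs} |x xs. length xs < r}"

definition brick_grid :: "nat \<Rightarrow> (nat \<times> nat) graph" where
  "brick_grid r = Graph ({1..r} \<times> {1..2 * r})
     ({{(i, j), (i, j + 1)} |i j. 1 \<le> i \<and> i \<le> r \<and> 1 \<le> j \<and> j \<le> 2 * r - 1} \<union>
      {{(i, j), (i + 1, j)} |i j. 1 \<le> i \<and> i \<le> r - 1 \<and> 1 \<le> j \<and> j \<le> 2 * r \<and> even (i + j)})"

definition wall :: "nat \<Rightarrow> (nat \<times> nat) graph" where
  "wall r = delete_verts (brick_grid r) {v \<in> verts (brick_grid r). degree (brick_grid r) v = 1}"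


section \<open>Constellations\<close>

text \<open>A constellation is given by its graph \<open>C\<close> and its stable set \<open>S\<close>.\<close>

abbreviation path_comps :: "'a graph \<Rightarrow> 'a set \<Rightarrow> 'a graph set" where
  "path_comps C S \<equiv> components (delete_verts C S)"

definition constellation :: "'a graph \<Rightarrow> 'a set \<Rightarrow> bool" where
  "constellation C S \<longleftrightarrow> simple_graph C \<and> stable_set C S \<and>
     (\<forall>L \<in> path_comps C S. is_path L) \<and>
     (\<forall>x \<in> S. \<forall>L \<in> path_comps C S. \<exists>v \<in> verts L. adjacent C x v)"

definition sl_constellation :: "nat \<Rightarrow> nat \<Rightarrow> 'a graph \<Rightarrow> 'a set \<Rightarrow> bool" where
  "sl_constellation s l C S \<longleftrightarrow>
     constellation C S \<and> card S = s \<and> card (path_comps C S) = l"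

definition route :: "'a graph \<Rightarrow> 'a set \<Rightarrow> 'a list \<Rightarrow> bool" where
  "route C S R \<longleftrightarrow> path_in C R \<and> hd R \<noteq> last R \<and> hd R \<in> S \<and> last R \<in> S \<and>
     (\<exists>L \<in> path_comps C S. interior R \<subseteq> verts L)"

definition route_from_to :: "'a graph \<Rightarrow> 'a set \<Rightarrow> 'a \<Rightarrow> 'a \<Rightarrow> 'a list \<Rightarrow> bool" where
  "route_from_to C S x y R \<longleftrightarrow> route C S R \<and> hd R = x \<and> last R = y"

definition ample :: "'a graph \<Rightarrow> 'a set \<Rightarrow> bool" where
  "ample C S \<longleftrightarrow> \<not> (\<exists>R. route C S R \<and> path_length R \<le> 2)"

definition has_neighbor_in :: "'a graph \<Rightarrow> 'a \<Rightarrow> 'a list \<Rightarrow> bool" where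
  "has_neighbor_in C z R \<longleftrightarrow> (\<exists>v \<in> set R. adjacent C z v)"

definition strictly_below :: "'a rel \<Rightarrow> 'a \<Rightarrow> 'a \<Rightarrow> bool" where
  "strictly_below r x y \<longleftrightarrow> (x, y) \<in> r \<and> x \<noteq> y"

definition interrupted :: "'a graph \<Rightarrow> 'a set \<Rightarrow> bool" where
  "interrupted C S \<longleftrightarrow> (\<exists>r. linear_order_on S r \<and>
     (\<forall>x \<in> S. \<forall>y \<in> S. \<forall>z \<in> S. strictly_below r x y \<and> strictly_below r y z \<longrightarrow>
        (\<forall>R. route_from_to C S x y R \<longrightarrow> has_neighbor_in C z R)))"

definition zigzagged :: "nat \<Rightarrow> 'a graph \<Rightarrow> 'a set \<Rightarrow> bool" where
  "zigzagged q C S \<longleftrightarrow> (\<exists>r. linear_order_on S r \<and>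
     (\<forall>x \<in> S. \<forall>y \<in> S. strictly_below r x y \<longrightarrow>
        (\<forall>R. route_from_to C S x y R \<longrightarrow>
           card {z \<in> S. strictly_below r x z \<and> strictly_below r z y \<and>
                        \<not> has_neighbor_in C z R} < q)))"

end

theory Submission imports Defs begin

text \<open>Rank the stable set \<open>S\<close> by the order that witnesses \<open>q\<close>-zigzaggedness. Everything rests on
  one consequence, \<open>crossing\<close>: a connected vertex set that passes in \<open>S\<close> from below \<open>q\<close> elements of
  \<open>S\<close> to above them, without using an element of \<open>S\<close> ranked in between, contains a neighbor of one of
  them, because a shortest connection inside it is a route.

  Interrupted constellations. Let \<open>T\<close> be the stable set of an induced ample interrupted constellation
  and \<open>Q\<close> one of its paths. A vertex of \<open>T\<close> with at least four smaller ones has four neighbors on \<open>Q\<close>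
  (\<open>four_visits\<close>), whereas vertices outside \<open>S\<close> have degree at most three. So all but at most four elements
  of \<open>T\<close>, at least \<open>2q + 2\<close> of them, lie in \<open>S\<close>, and so does the largest one, \<open>z\<close>. Read the
  elements of \<open>T\<close> as letters occurring at their neighbors on \<open>Q\<close>: any two occurrences of distinct
  letters other than \<open>z\<close> are separated by an occurrence of \<open>z\<close>. Then at most \<open>q\<close> of the letters in \<open>S\<close>
  rank below \<open>z\<close> (\<open>letters_below_separator\<close>), and by symmetry at most \<open>q\<close> rank above, which leaves
  room for only \<open>2q + 1\<close>.

  Trees and walls. The other excluded graphs have degree at most eight. Let \<open>X\<close> induce such a
  graph. The closed neighborhoods in \<open>X\<close> of the windows of \<open>q\<close> consecutive elements of \<open>S \<inter> X\<close> have
  at most \<open>9q\<close> elements each, and by \<open>crossing\<close> the windows whose neighborhoods meet a given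
  connected set form an interval (\<open>window_bags\<close>). So \<open>X\<close> has path width linear in \<open>q\<close>, up to connected
  sets that avoid \<open>S\<close>; those lie on a path and contain no asteroidal triple. For binary trees this is
  refuted by the usual induction on the depth (\<open>subtree_large_bag\<close>), for walls by the bramble of crosses
  of a row and a column (\<open>wall_bags_contradiction\<close>). To treat subdivisions and their line graphs
  alike, connected edge sets of the tree or wall are represented by connected vertex sets
  (\<open>edge_model\<close>).\<close>

section \<open>Connected vertex sets\<close>

lemma adjacent_sym: "adjacent G u v \<Longrightarrow> adjacent G v u"
  by (simp add: adjacent_def insert_commute)

lemma adjacent_verts:
  assumes "simple_graph G" "adjacent G u v"
  shows "u \<in> verts G" "v \<in> verts G" "u \<noteq> v"
proof -
  have "{u, v} \<in> {{u, v} |u v. u \<in> verts G \<and> v \<in> verts G \<and> u \<noteq> v}"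
    using assms unfolding simple_graph_def adjacent_def by blast
  then show "u \<in> verts G" "v \<in> verts G" "u \<noteq> v"
    by (auto simp: doubleton_eq_iff)
qed

text \<open>\<open>A\<close> is nonempty and induces a connected subgraph of \<open>G\<close>.\<close>

definition conn :: "'a graph \<Rightarrow> 'a set \<Rightarrow> bool" where
  "conn G A \<longleftrightarrow> A \<noteq> {} \<and> A \<subseteq> verts G \<and>
     (\<forall>u \<in> A. \<forall>v \<in> A. (u, v) \<in> {(a, b). a \<in> A \<and> b \<in> A \<and> adjacent G a b}\<^sup>*)"

lemma conn_singleton: "v \<in> verts G \<Longrightarrow> conn G {v}"
  by (simp add: conn_def)

lemma conn_Un:
  assumes A: "conn G A" and B: "conn G B"
    and touch: "A \<inter> B \<noteq> {} \<or> (\<exists>a \<in> A. \<exists>b \<in> B. adjacent G a b)"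
  shows "conn G (A \<union> B)"
proof -
  define r where "r = (\<lambda>X. {(a, b). a \<in> X \<and> b \<in> X \<and> adjacent G a b})"
  have inA: "(u, v) \<in> (r (A \<union> B))\<^sup>*" if "u \<in> A" "v \<in> A" for u v
  proof -
    have "(u, v) \<in> (r A)\<^sup>*" using A that by (simp add: conn_def r_def)
    moreover have "r A \<subseteq> r (A \<union> B)" by (auto simp: r_def)
    ultimately show ?thesis using rtrancl_mono by blast
  qed
  have inB: "(u, v) \<in> (r (A \<union> B))\<^sup>*" if "u \<in> B" "v \<in> B" for u v
  proof -
    have "(u, v) \<in> (r B)\<^sup>*" using B that by (simp add: conn_def r_def)
    moreover have "r B \<subseteq> r (A \<union> B)" by (auto simp: r_def)
    ultimately show ?thesis using rtrancl_mono by blast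
  qed
  obtain a b where ab: "a \<in> A" "b \<in> B" "(a, b) \<in> (r (A \<union> B))\<^sup>*" "(b, a) \<in> (r (A \<union> B))\<^sup>*"
  proof -
    from touch consider c where "c \<in> A" "c \<in> B" | a b where "a \<in> A" "b \<in> B" "adjacent G a b"
      by blast
    then show ?thesis
    proof cases
      case 1 then show ?thesis using that by blast
    next
      case 2
      then have "(a, b) \<in> r (A \<union> B)" "(b, a) \<in> r (A \<union> B)"
        by (auto simp: r_def adjacent_sym)
      with 2 show ?thesis using that by blast
    qed
  qed
  have "(u, v) \<in> (r (A \<union> B))\<^sup>*" if "u \<in> A \<union> B" "v \<in> A \<union> B" for u v
    using that
  proof (elim UnE)
    show "(u, v) \<in> (r (A \<union> B))\<^sup>*" if "u \<in> A" "v \<in> B"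
      using inA[OF that(1) ab(1)] ab(3) inB[OF ab(2) that(2)] by (meson rtrancl_trans)
    show "(u, v) \<in> (r (A \<union> B))\<^sup>*" if "u \<in> B" "v \<in> A"
      using inB[OF that(1) ab(2)] ab(4) inA[OF ab(1) that(2)] by (meson rtrancl_trans)
  qed (use inA inB in blast)+
  then show ?thesis using A B by (auto simp: conn_def r_def)
qed

lemma conn_insert:
  assumes "conn G A" "v \<in> verts G" "\<exists>a \<in> A. adjacent G v a"
  shows "conn G (insert v A)"
  using conn_Un[OF conn_singleton[OF assms(2)] assms(1)] assms(3) by auto

text \<open>Images of connected sets under maps whose point images are linked along adjacencies; both
  isomorphic copies and the passage from edge sets to the vertex sets modelling them are of this
  kind.\<close>

lemma conn_UN:
  assumes F: "conn H F"
    and pt: "\<And>x. x \<in> F \<Longrightarrow> conn G (\<Phi> x)"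
    and adj: "\<And>x y. x \<in> F \<Longrightarrow> y \<in> F \<Longrightarrow> adjacent H x y \<Longrightarrow> conn G (\<Phi> x \<union> \<Phi> y)"
  shows "conn G (\<Union>x \<in> F. \<Phi> x)"
proof -
  define Y where "Y = (\<Union>x \<in> F. \<Phi> x)"
  define r where "r = (\<lambda>X. {(a, b). a \<in> X \<and> b \<in> X \<and> adjacent G a b})"
  have lift: "(u, v) \<in> (r Y)\<^sup>*" if "conn G Z" "Z \<subseteq> Y" "u \<in> Z" "v \<in> Z" for Z u v
  proof -
    have "(u, v) \<in> (r Z)\<^sup>*" using that by (simp add: conn_def r_def)
    moreover have "r Z \<subseteq> r Y" using that by (auto simp: r_def)
    ultimately show ?thesis using rtrancl_mono by blast
  qed
  have "\<forall>u \<in> \<Phi> x. \<forall>v \<in> \<Phi> y. (u, v) \<in> (r Y)\<^sup>*" if x: "x \<in> F" and y: "y \<in> F" for x y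
  proof -
    have "(x, y) \<in> {(a, b). a \<in> F \<and> b \<in> F \<and> adjacent H a b}\<^sup>*"
      using F x y by (simp add: conn_def)
    then show ?thesis
    proof (induction rule: rtrancl_induct)
      case base
      show ?case using lift[OF pt[OF x]] x by (auto simp: Y_def)
    next
      case (step y z)
      then have yz: "y \<in> F" "z \<in> F" "adjacent H y z" by auto
      obtain m where m: "m \<in> \<Phi> y" using pt[OF yz(1)] by (auto simp: conn_def)
      have "(m, v) \<in> (r Y)\<^sup>*" if "v \<in> \<Phi> z" for v
        using lift[OF adj[OF yz]] m that yz by (auto simp: Y_def)
      then show ?case using step.IH m by (meson rtrancl_trans)
    qed
  qed
  then have all: "\<forall>u \<in> Y. \<forall>v \<in> Y. (u, v) \<in> (r Y)\<^sup>*" by (auto simp: Y_def)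
  have "Y \<subseteq> verts G" using pt by (fastforce simp: Y_def conn_def)
  moreover have "Y \<noteq> {}" using F pt by (fastforce simp: Y_def conn_def)
  ultimately show ?thesis using all by (simp add: conn_def Y_def r_def)
qed

lemma conn_image:
  assumes "conn H F" "g ` F \<subseteq> verts G"
    and "\<And>x y. x \<in> F \<Longrightarrow> y \<in> F \<Longrightarrow> adjacent H x y \<Longrightarrow> adjacent G (g x) (g y)"
  shows "conn G (g ` F)"
proof -
  have "conn G (\<Union>x \<in> F. {g x})"
  proof (rule conn_UN[OF assms(1)])
    show "conn G {g x}" if "x \<in> F" for x using assms(2) that by (auto intro: conn_singleton)
    show "conn G ({g x} \<union> {g y})" if "x \<in> F" "y \<in> F" "adjacent H x y" for x y
      using assms that by (intro conn_Un conn_singleton) auto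
  qed
  also have "(\<Union>x \<in> F. {g x}) = g ` F" by auto
  finally show ?thesis .
qed

lemma conn_list_segment:
  assumes "\<And>i. lo \<le> i \<Longrightarrow> i \<le> hi \<Longrightarrow> p i \<in> verts G"
    and "\<And>i. lo \<le> i \<Longrightarrow> Suc i \<le> hi \<Longrightarrow> adjacent G (p i) (p (Suc i))"
    and "lo \<le> hi"
  shows "conn G (p ` {lo..hi})"
  using assms(3,1,2)
proof (induction hi rule: dec_induct)
  case base
  then show ?case by (simp add: conn_singleton)
next
  case (step n)
  have "adjacent G (p n) (p (Suc n))" using step.prems(2)[of n] step.hyps by simp
  then have "\<exists>a \<in> p ` {lo..n}. adjacent G (p (Suc n)) a"
    using step.hyps adjacent_sym[of G "p n" "p (Suc n)"] by (intro bexI[of _ "p n"]) auto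
  moreover have "conn G (p ` {lo..n})"
    by (rule step.IH) (rule step.prems, simp_all)+
  moreover have "p (Suc n) \<in> verts G" using step.prems(1)[of "Suc n"] step.hyps by simp
  ultimately have "conn G (insert (p (Suc n)) (p ` {lo..n}))"
    by (intro conn_insert)
  moreover have "{lo..Suc n} = insert (Suc n) {lo..n}" using step.hyps by auto
  ultimately show ?case by simp
qed

section \<open>Induced paths\<close>

lemma path_in_iff:
  assumes "simple_graph G"
  shows "path_in G p \<longleftrightarrow> p \<noteq> [] \<and> distinct p \<and> set p \<subseteq> verts G \<and>
    (\<forall>i < length p. \<forall>j < length p. adjacent G (p ! i) (p ! j) \<longleftrightarrow> j = Suc i \<or> i = Suc j)"
    (is "?L \<longleftrightarrow> ?R")
proof
  assume L: ?L
  have eq: "{e \<in> edges G. e \<subseteq> set p} = path_edges p"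
    using L by (auto simp: path_in_def induce_def path_graph_def)
  have d: "distinct p" using L by (simp add: path_in_def)
  have "adjacent G (p ! i) (p ! j) \<longleftrightarrow> j = Suc i \<or> i = Suc j"
    if "i < length p" "j < length p" for i j
  proof -
    have "adjacent G (p ! i) (p ! j) \<longleftrightarrow> {p ! i, p ! j} \<in> path_edges p"
      using that eq by (auto simp: adjacent_def)
    also have "\<dots> \<longleftrightarrow> j = Suc i \<or> i = Suc j"
      using that d unfolding path_edges_def
      by (auto simp: doubleton_eq_iff nth_eq_iff_index_eq)
    finally show ?thesis .
  qed
  then show ?R using L by (auto simp: path_in_def)
next
  assume R: ?R
  have "{e \<in> edges G. e \<subseteq> set p} = path_edges p"
  proof (intro equalityI subsetI)
    fix e assume e: "e \<in> {e \<in> edges G. e \<subseteq> set p}"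
    then obtain u v where uv: "e = {u, v}" using assms by (auto simp: simple_graph_def)
    then obtain i j where ij: "i < length p" "j < length p" "u = p ! i" "v = p ! j"
      using e by (auto simp: in_set_conv_nth)
    then have "j = Suc i \<or> i = Suc j" using R e uv by (auto simp: adjacent_def)
    then show "e \<in> path_edges p" using ij uv by (auto simp: path_edges_def)
  next
    fix e assume "e \<in> path_edges p"
    then obtain i where i: "Suc i < length p" "e = {p ! i, p ! Suc i}"
      by (auto simp: path_edges_def)
    then have "adjacent G (p ! i) (p ! Suc i)" using R by auto
    then show "e \<in> {e \<in> edges G. e \<subseteq> set p}" using i by (auto simp: adjacent_def)
  qed
  then show ?L using R by (auto simp: path_in_def induce_def path_graph_def)
qed

lemma mem_interior_iff:
  "x \<in> interior p \<longleftrightarrow> (\<exists>i. 0 < i \<and> Suc i < length p \<and> x = p ! i)"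
proof
  assume "x \<in> interior p"
  then obtain i where "i < length (butlast (tl p))" "x = butlast (tl p) ! i"
    unfolding interior_def by (metis in_set_conv_nth)
  then have "Suc i < length p - 1" "x = p ! Suc i" by (auto simp: nth_butlast nth_tl)
  then show "\<exists>i. 0 < i \<and> Suc i < length p \<and> x = p ! i" by (intro exI[of _ "Suc i"]) auto
next
  assume "\<exists>i. 0 < i \<and> Suc i < length p \<and> x = p ! i"
  then obtain i where i: "0 < i" "Suc i < length p" "x = p ! i" by auto
  then have "i - 1 < length (butlast (tl p))" "x = butlast (tl p) ! (i - 1)"
    by (auto simp: nth_butlast nth_tl)
  then show "x \<in> interior p" unfolding interior_def by (metis nth_mem)
qed

lemma walk_exists:
  assumes "(u, v) \<in> {(a, b). a \<in> A \<and> b \<in> A \<and> adjacent G a b}\<^sup>*" "u \<in> A"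
  shows "\<exists>xs. xs \<noteq> [] \<and> hd xs = u \<and> last xs = v \<and> set xs \<subseteq> A \<and> successively (adjacent G) xs"
  using assms
proof (induction rule: rtrancl_induct)
  case base
  then show ?case by (intro exI[of _ "[u]"]) auto
next
  case (step y z)
  then obtain xs where "xs \<noteq> []" "hd xs = u" "last xs = y" "set xs \<subseteq> A"
    "successively (adjacent G) xs" by auto
  with step.hyps show ?case
    by (intro exI[of _ "xs @ [z]"]) (auto simp: successively_append_iff)
qed

text \<open>A shortest walk between two subsets of a connected set is an induced path.\<close>

lemma induced_path_between:
  assumes G: "simple_graph G" and A: "conn G A"
    and Lo: "Lo \<subseteq> A" "Lo \<noteq> {}" and Hi: "Hi \<subseteq> A" "Hi \<noteq> {}"
  shows "\<exists>R. path_in G R \<and> set R \<subseteq> A \<and> hd R \<in> Lo \<and> last R \<in> Hi \<and> interior R \<inter> (Lo \<union> Hi) = {}"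
proof -
  define walk where "walk = (\<lambda>xs. xs \<noteq> [] \<and> hd xs \<in> Lo \<and> last xs \<in> Hi \<and> set xs \<subseteq> A \<and>
    successively (adjacent G) xs)"
  obtain u v where "u \<in> Lo" "v \<in> Hi" using Lo Hi by auto
  moreover from this have "u \<in> A" "v \<in> A" using Lo Hi by auto
  moreover from this have "(u, v) \<in> {(a, b). a \<in> A \<and> b \<in> A \<and> adjacent G a b}\<^sup>*"
    using A unfolding conn_def by blast
  ultimately have "\<exists>xs. walk xs" using walk_exists[of u v A G] by (auto simp: walk_def)
  then obtain R where R: "walk R" and min: "\<And>ys. walk ys \<Longrightarrow> length R \<le> length ys"
    using ex_has_least_nat[of walk _ length] by blast
  have ne: "R \<noteq> []" and hdR: "hd R \<in> Lo" and lastR: "last R \<in> Hi" and sub: "set R \<subseteq> A"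
    and suc: "successively (adjacent G) R"
    using R by (auto simp: walk_def)
  have suc_take: "successively (adjacent G) (take k R)"
    and suc_drop: "successively (adjacent G) (drop k R)" for k
    using suc append_take_drop_id[of k R] successively_append_iff[of _ "take k R" "drop k R"]
    by metis+
  have dist: "distinct R"
  proof (rule ccontr)
    assume "\<not> distinct R"
    then obtain us y vs ws where d: "R = us @ [y] @ vs @ [y] @ ws"
      using not_distinct_decomp by blast
    have "walk (us @ [y] @ ws)"
      unfolding walk_def
    proof (intro conjI)
      show "hd (us @ [y] @ ws) \<in> Lo" using hdR by (cases us) (simp_all add: d)
      show "last (us @ [y] @ ws) \<in> Hi" using lastR by (cases ws) (simp_all add: d)
      show "set (us @ [y] @ ws) \<subseteq> A" using sub by (simp add: d)
      show "successively (adjacent G) (us @ [y] @ ws)"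
        using suc unfolding d 
        by (cases ws; cases vs) (simp_all add: successively_append_iff successively_Cons)
    qed simp
    from min[OF this] show False by (simp add: d)
  qed
  have no_chord: False if ij: "Suc i < j" "j < length R" "adjacent G (R ! i) (R ! j)" for i j
  proof -
    have "last (take (Suc i) R) = R ! i" "hd (drop j R) = R ! j"
      using ij by (auto simp: take_Suc_conv_app_nth hd_drop_conv_nth)
    then have "successively (adjacent G) (take (Suc i) R @ drop j R)"
      using suc_take suc_drop ij by (simp add: successively_append_iff)
    moreover have "set (take (Suc i) R @ drop j R) \<subseteq> A"
      using sub set_take_subset[of "Suc i" R] set_drop_subset[of j R] by auto
    moreover have "hd (take (Suc i) R @ drop j R) = hd R" "last (take (Suc i) R @ drop j R) = last R"
      using ij ne by (auto simp: hd_append)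
    ultimately have "walk (take (Suc i) R @ drop j R)"
      using ij ne hdR lastR by (simp add: walk_def)
    from min[OF this] ij show False by simp
  qed
  have step: "adjacent G (R ! i) (R ! Suc i)" if "Suc i < length R" for i
    using suc that by (auto simp: successively_conv_nth)
  have "adjacent G (R ! i) (R ! j) \<longleftrightarrow> j = Suc i \<or> i = Suc j"
    if "i < length R" "j < length R" for i j
  proof
    assume a: "adjacent G (R ! i) (R ! j)"
    then have "i \<noteq> j" using adjacent_verts(3)[OF G] by blast
    then show "j = Suc i \<or> i = Suc j"
      using no_chord[of i j] no_chord[of j i] a adjacent_sym[OF a] that
      by (metis Suc_lessI linorder_neqE_nat)
  next
    assume "j = Suc i \<or> i = Suc j"
    then show "adjacent G (R ! i) (R ! j)" using step that adjacent_sym by metis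
  qed
  moreover have "set R \<subseteq> verts G" using sub A by (auto simp: conn_def)
  ultimately have path: "path_in G R" using ne dist by (simp add: path_in_iff[OF G])
  have "x \<notin> Lo \<union> Hi" if int: "x \<in> interior R" for x
  proof
    assume x: "x \<in> Lo \<union> Hi"
    from int obtain i where i: "0 < i" "Suc i < length R" "x = R ! i"
      unfolding mem_interior_iff by blast
    from x show False
    proof
      assume "x \<in> Lo"
      then have "walk (drop i R)"
        using i suc_drop lastR sub set_drop_subset[of i R] by (auto simp: walk_def hd_drop_conv_nth)
      from min[OF this] i show False by simp
    next
      assume "x \<in> Hi"
      then have "walk (take (Suc i) R)"
        unfolding walk_def
      proof (intro conjI)
        show "last (take (Suc i) R) \<in> Hi"
          using \<open>x \<in> Hi\<close> i by (simp add: take_Suc_conv_app_nth)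
        show "set (take (Suc i) R) \<subseteq> A" using sub set_take_subset[of "Suc i" R] by simp
      qed (use ne hdR suc_take in simp_all)
      from min[OF this] i show False by simp
    qed
  qed
  then show ?thesis using path sub hdR lastR by blast
qed

section \<open>Components and routes of a constellation\<close>

lemma adjacent_delete_verts:
  assumes "simple_graph C"
  shows "adjacent (delete_verts C S) u v \<longleftrightarrow> adjacent C u v \<and> u \<notin> S \<and> v \<notin> S"
  using adjacent_verts[OF assms, of u v]
  by (auto simp: adjacent_def delete_verts_def induce_def)

lemma verts_delete_verts: "verts (delete_verts C S) = verts C - S"
  by (auto simp: delete_verts_def induce_def)

lemma conn_in_component:
  assumes C: "simple_graph C" and A: "conn C A" "A \<inter> S = {}"
  shows "\<exists>L \<in> path_comps C S. A \<subseteq> verts L"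
proof -
  let ?G = "delete_verts C S"
  obtain v where v: "v \<in> A" using A by (auto simp: conn_def)
  have AG: "A \<subseteq> verts ?G" using A by (auto simp: verts_delete_verts conn_def)
  have sub: "{(a, b). a \<in> A \<and> b \<in> A \<and> adjacent C a b} \<subseteq> {(a, b). adjacent ?G a b}"
    using A by (auto simp: adjacent_delete_verts[OF C])
  have "A \<subseteq> reachable ?G `` {v}"
  proof
    fix u assume u: "u \<in> A"
    have "(v, u) \<in> {(a, b). a \<in> A \<and> b \<in> A \<and> adjacent C a b}\<^sup>*"
      using A u v unfolding conn_def by blast
    then have "(v, u) \<in> {(a, b). adjacent ?G a b}\<^sup>*" using rtrancl_mono[OF sub] by blast
    then show "u \<in> reachable ?G `` {v}" using u v AG by (auto simp: reachable_def)
  qed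
  then have "A \<subseteq> verts (induce ?G (reachable ?G `` {v}))"
    using AG by (auto simp: induce_def)
  moreover have "induce ?G (reachable ?G `` {v}) \<in> path_comps C S"
    using v AG by (auto simp: components_def quotient_def)
  ultimately show ?thesis by blast
qed

lemma component_is_induced_path:
  assumes C: "constellation C S" and L: "L \<in> path_comps C S"
  shows "\<exists>p. path_in C p \<and> set p \<inter> S = {} \<and> verts L = set p"
proof -
  let ?G = "delete_verts C S"
  have simp: "simple_graph C" using C by (simp add: constellation_def)
  obtain p where p: "p \<noteq> []" "distinct p" "L = path_graph p"
    using C L by (auto simp: constellation_def is_path_def)
  obtain c where c: "L = induce ?G c" using L by (auto simp: components_def)
  have vL: "verts L = set p" using p by (simp add: path_graph_def)
  then have set: "set p = verts ?G \<inter> c" using c by (simp add: induce_def)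
  then have sub: "set p \<subseteq> verts C - S" by (simp add: verts_delete_verts)
  have "edges L = {e \<in> edges C. e \<subseteq> set p}"
  proof -
    have "edges L = {e \<in> edges ?G. e \<subseteq> c}" using c by (simp add: induce_def)
    also have "\<dots> = {e \<in> edges C. e \<subseteq> set p}"
      unfolding set by (auto simp: delete_verts_def induce_def)
    finally show ?thesis .
  qed
  then have "path_in C p"
    using p sub by (auto simp: path_in_def induce_def path_graph_def)
  then show ?thesis using vL sub by auto
qed

lemma ample_unique_neighbor:
  assumes C: "constellation C S" "ample C S"
    and v: "v \<in> verts C" and s: "s \<in> S" "s' \<in> S" "adjacent C v s" "adjacent C v s'"
  shows "s = s'"
proof (rule ccontr)
  assume ne: "s \<noteq> s'"
  have G: "simple_graph C" using C by (simp add: constellation_def)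
  have stab: "\<And>u v. u \<in> S \<Longrightarrow> v \<in> S \<Longrightarrow> \<not> adjacent C u v"
    and SV: "S \<subseteq> verts C" using C by (auto simp: constellation_def stable_set_def)
  have vS: "v \<notin> S" using stab s by blast
  have irr: "\<not> adjacent C x x" for x using adjacent_verts(3)[OF G] by blast
  have adj: "adjacent C ([s, v, s'] ! i) ([s, v, s'] ! j) \<longleftrightarrow> j = Suc i \<or> i = Suc j"
    if "i < 3" "j < 3" for i j
  proof -
    have "i = 0 \<or> i = 1 \<or> i = 2" "j = 0 \<or> j = 1 \<or> j = 2" using that by auto
    then show ?thesis
      using s stab irr adjacent_sym[of C v s] adjacent_sym[of C v s'] by auto
  qed
  have "path_in C [s, v, s']"
    unfolding path_in_iff[OF G] using adj ne s vS v SV by auto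
  moreover obtain L where "L \<in> path_comps C S" "{v} \<subseteq> verts L"
    using conn_in_component[OF G conn_singleton[OF v], of S] vS by auto
  ultimately have "route C S [s, v, s']"
    using ne s by (auto simp: route_def interior_def)
  moreover have "path_length [s, v, s'] \<le> 2" by (simp add: path_length_def)
  ultimately show False using C by (auto simp: ample_def)
qed

text \<open>If \<open>S\<close> meets a connected set in the disjoint sets \<open>Lo\<close> and \<open>Hi\<close>, then a shortest path inside it
  from \<open>Lo\<close> to \<open>Hi\<close> is a route: its interior avoids \<open>S\<close> and so lies in one component.\<close>

lemma route_in_connected_set:
  assumes C: "constellation C S" and A: "conn C A"
    and LH: "A \<inter> S = Lo \<union> Hi" "Lo \<noteq> {}" "Hi \<noteq> {}" "Lo \<inter> Hi = {}"
  shows "\<exists>R x y. route_from_to C S x y R \<and> set R \<subseteq> A \<and> x \<in> Lo \<and> y \<in> Hi"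
proof -
  have G: "simple_graph C" using C by (simp add: constellation_def)
  have stab: "\<And>u v. u \<in> S \<Longrightarrow> v \<in> S \<Longrightarrow> \<not> adjacent C u v"
    using C by (auto simp: constellation_def stable_set_def)
  obtain R where R: "path_in C R" "set R \<subseteq> A" "hd R \<in> Lo" "last R \<in> Hi"
    "interior R \<inter> (Lo \<union> Hi) = {}"
    using induced_path_between[OF G A, of Lo Hi] LH by blast
  have Rne: "R \<noteq> []"
    and adj: "\<And>i j. i < length R \<Longrightarrow> j < length R \<Longrightarrow>
      adjacent C (R ! i) (R ! j) \<longleftrightarrow> j = Suc i \<or> i = Suc j"
    using R(1) by (auto simp: path_in_iff[OF G])
  have ends: "hd R \<in> S" "last R \<in> S" "hd R \<noteq> last R" using R LH by auto
  have intA: "interior R \<subseteq> A" using R(2) nth_mem[of _ R] by (fastforce simp: mem_interior_iff)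
  have len: "2 < length R"
  proof (rule ccontr)
    assume "\<not> 2 < length R"
    moreover have "length R \<noteq> 0" using Rne by simp
    ultimately have "length R = 1 \<or> length R = 2" by linarith
    then show False
    proof
      assume "length R = 1"
      then show False using ends by (cases R) auto
    next
      assume "length R = 2"
      then have "adjacent C (hd R) (last R)"
        using adj[of 0 1] Rne by (simp add: hd_conv_nth last_conv_nth)
      then show False using stab ends by blast
    qed
  qed
  have int: "interior R = (!) R ` {1..length R - 2}"
  proof -
    have "interior R = (!) R ` {i. 0 < i \<and> Suc i < length R}"
      unfolding set_eq_iff mem_interior_iff image_iff by blast
    also have "{i. 0 < i \<and> Suc i < length R} = {1..length R - 2}" by auto
    finally show ?thesis .
  qed
  have "conn C ((!) R ` {1..length R - 2})"
  proof (rule conn_list_segment)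
    show "R ! i \<in> verts C" if "i \<le> length R - 2" for i
    proof -
      have "R ! i \<in> set R" using that len by simp
      then show ?thesis using R(1) by (auto simp: path_in_def)
    qed
    show "adjacent C (R ! i) (R ! Suc i)" if "Suc i \<le> length R - 2" for i
      using that len by (subst adj) auto
  qed (use len in simp)
  moreover have "interior R \<inter> S = {}" using R(5) intA LH by auto
  ultimately obtain L where "L \<in> path_comps C S" "interior R \<subseteq> verts L"
    using conn_in_component[OF G, of _ S] int by metis
  then have "route C S R" using R(1) ends by (auto simp: route_def)
  then show ?thesis using R by (auto simp: route_from_to_def)
qed

section \<open>The crossing property of zigzagged constellations\<close>

lemma linear_order_rank:
  assumes fin: "finite S" and lin: "linear_order_on S r"
  shows "\<exists>\<rho> :: 'a \<Rightarrow> int. inj_on \<rho> S \<and>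
    (\<forall>x \<in> S. \<forall>y \<in> S. strictly_below r x y \<longleftrightarrow> \<rho> x < \<rho> y)"
proof -
  define \<rho> where "\<rho> = (\<lambda>x. int (card {y \<in> S. strictly_below r y x}))"
  have tr: "strictly_below r x z" if "strictly_below r x y" "strictly_below r y z" for x y z
    using lin that unfolding linear_order_on_def partial_order_on_def preorder_on_def
    by (auto simp: strictly_below_def dest: transD antisymD)
  have tot: "strictly_below r x y \<or> strictly_below r y x" if "x \<in> S" "y \<in> S" "x \<noteq> y" for x y
    using lin that by (auto simp: strictly_below_def linear_order_on_def total_on_def)
  have irr: "\<not> strictly_below r x x" for x by (simp add: strictly_below_def)
  have up: "\<rho> x < \<rho> y" if "x \<in> S" "y \<in> S" "strictly_below r x y" for x y
  proof -
    have "{z \<in> S. strictly_below r z x} \<subset> {z \<in> S. strictly_below r z y}"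
      using that tr irr by blast
    then show ?thesis using fin by (simp add: \<rho>_def psubset_card_mono)
  qed
  have "strictly_below r x y \<longleftrightarrow> \<rho> x < \<rho> y" if "x \<in> S" "y \<in> S" for x y
    using up[OF that] up[OF that(2,1)] tot[OF that] irr by force
  moreover have "inj_on \<rho> S"
    using up tot by (intro inj_onI) (metis less_irrefl)
  ultimately show ?thesis by blast
qed

text \<open>For \<open>\<rho>\<close> an injective ranking of \<open>S\<close>: a connected set that passes in \<open>S\<close> from below a set \<open>W\<close>
  of at least \<open>q\<close> elements to above it, without using elements of \<open>S\<close> in between, contains a
  neighbor of \<open>W\<close>. Unlike \<^const>\<open>zigzagged\<close>, this notion is evidently invariant under reversing
  the ranking.\<close>

definition crossing :: "nat \<Rightarrow> 'a graph \<Rightarrow> 'a set \<Rightarrow> ('a \<Rightarrow> int) \<Rightarrow> bool" where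
  "crossing q C S \<rho> \<longleftrightarrow> (\<forall>A W. conn C A \<longrightarrow> W \<subseteq> S \<longrightarrow> q \<le> card W \<longrightarrow>
     (\<forall>s \<in> A \<inter> S. (\<forall>w \<in> W. \<rho> s < \<rho> w) \<or> (\<forall>w \<in> W. \<rho> w < \<rho> s)) \<longrightarrow>
     (\<exists>u \<in> A \<inter> S. \<forall>w \<in> W. \<rho> u < \<rho> w) \<longrightarrow> (\<exists>v \<in> A \<inter> S. \<forall>w \<in> W. \<rho> w < \<rho> v) \<longrightarrow>
     (\<exists>w \<in> W. \<exists>a \<in> A. adjacent C w a))"

lemma crossing_neighbor:
  assumes "crossing q C S \<rho>" "conn C A" "W \<subseteq> S" "q \<le> card W"
    and "\<And>s. s \<in> A \<Longrightarrow> s \<in> S \<Longrightarrow> (\<forall>w \<in> W. \<rho> s < \<rho> w) \<or> (\<forall>w \<in> W. \<rho> w < \<rho> s)"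
    and "u \<in> A" "u \<in> S" "\<forall>w \<in> W. \<rho> u < \<rho> w" "v \<in> A" "v \<in> S" "\<forall>w \<in> W. \<rho> w < \<rho> v"
  obtains w a where "w \<in> W" "a \<in> A" "adjacent C w a"
proof -
  have 1: "\<forall>s \<in> A \<inter> S. (\<forall>w \<in> W. \<rho> s < \<rho> w) \<or> (\<forall>w \<in> W. \<rho> w < \<rho> s)"
    using assms(5) by blast
  have 2: "\<exists>u \<in> A \<inter> S. \<forall>w \<in> W. \<rho> u < \<rho> w" by (intro bexI[of _ u]) (use assms in auto)
  have 3: "\<exists>v \<in> A \<inter> S. \<forall>w \<in> W. \<rho> w < \<rho> v" by (intro bexI[of _ v]) (use assms in auto)
  have "\<exists>w \<in> W. \<exists>a \<in> A. adjacent C w a"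
    using assms(1)[unfolded crossing_def] assms(2-4) 1 2 3 by simp
  then show ?thesis using that by blast
qed

lemma crossing_reverse:
  assumes "crossing q C S \<rho>"
  shows "crossing q C S (\<lambda>s. - \<rho> s)"
  unfolding crossing_def neg_less_iff_less
proof (intro allI impI, elim bexE)
  fix A W u v
  assume "conn C A" "W \<subseteq> S" "q \<le> card W"
    "\<forall>s \<in> A \<inter> S. (\<forall>w \<in> W. \<rho> w < \<rho> s) \<or> (\<forall>w \<in> W. \<rho> s < \<rho> w)"
    "u \<in> A \<inter> S" "\<forall>w \<in> W. \<rho> w < \<rho> u" "v \<in> A \<inter> S" "\<forall>w \<in> W. \<rho> v < \<rho> w"
  note A = this
  show "\<exists>w \<in> W. \<exists>a \<in> A. adjacent C w a"
  proof (rule crossing_neighbor[OF assms A(1-3)])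
    show "(\<forall>w \<in> W. \<rho> s < \<rho> w) \<or> (\<forall>w \<in> W. \<rho> w < \<rho> s)" if "s \<in> A" "s \<in> S" for s
      using A(4) that by blast
  qed (use A in auto)
qed

lemma zigzagged_crossing:
  assumes q: "q \<ge> 1" and C: "constellation C S" and zz: "zigzagged q C S"
  shows "\<exists>\<rho>. inj_on \<rho> S \<and> crossing q C S \<rho>"
proof -
  have fin: "finite S" using C
    by (auto simp: constellation_def simple_graph_def stable_set_def intro: finite_subset)
  obtain r where r: "linear_order_on S r"
    and zr: "\<And>x y R. x \<in> S \<Longrightarrow> y \<in> S \<Longrightarrow> strictly_below r x y \<Longrightarrow> route_from_to C S x y R \<Longrightarrow>
      card {z \<in> S. strictly_below r x z \<and> strictly_below r z y \<and> \<not> has_neighbor_in C z R} < q"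
    using zz unfolding zigzagged_def by blast
  obtain \<rho> :: "'a \<Rightarrow> int" where inj: "inj_on \<rho> S"
    and \<rho>: "\<And>x y. x \<in> S \<Longrightarrow> y \<in> S \<Longrightarrow> strictly_below r x y \<longleftrightarrow> \<rho> x < \<rho> y"
    using linear_order_rank[OF fin r] by blast
  have "\<exists>w \<in> W. \<exists>a \<in> A. adjacent C w a"
    if A: "conn C A" and W: "W \<subseteq> S" "q \<le> card W"
      and side: "\<forall>s \<in> A \<inter> S. (\<forall>w \<in> W. \<rho> s < \<rho> w) \<or> (\<forall>w \<in> W. \<rho> w < \<rho> s)"
      and u: "u \<in> A \<inter> S" "\<forall>w \<in> W. \<rho> u < \<rho> w" and v: "v \<in> A \<inter> S" "\<forall>w \<in> W. \<rho> w < \<rho> v"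
    for A W u v
  proof (rule ccontr)
    assume none: "\<not> ?thesis"
    define Lo where "Lo = {s \<in> A \<inter> S. \<forall>w \<in> W. \<rho> s < \<rho> w}"
    define Hi where "Hi = {s \<in> A \<inter> S. \<forall>w \<in> W. \<rho> w < \<rho> s}"
    have "W \<noteq> {}" using W q by auto
    then obtain w0 where w0: "w0 \<in> W" by blast
    have disj: "Lo \<inter> Hi = {}"
    proof (rule ccontr)
      assume "Lo \<inter> Hi \<noteq> {}"
      then obtain s where "s \<in> Lo" "s \<in> Hi" by blast
      then have "\<rho> s < \<rho> w0" "\<rho> w0 < \<rho> s" using w0 unfolding Lo_def Hi_def by blast+
      then show False by simp
    qed
    have AS: "A \<inter> S = Lo \<union> Hi" using side by (auto simp: Lo_def Hi_def)
    have ne: "Lo \<noteq> {}" "Hi \<noteq> {}" using u v by (auto simp: Lo_def Hi_def)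
    obtain R x y where R: "route_from_to C S x y R" "set R \<subseteq> A" "x \<in> Lo" "y \<in> Hi"
      using route_in_connected_set[OF C A AS ne disj] by blast
    then have xy: "x \<in> S" "y \<in> S" "\<forall>w \<in> W. \<rho> x < \<rho> w" "\<forall>w \<in> W. \<rho> w < \<rho> y"
      by (auto simp: Lo_def Hi_def)
    then have "\<rho> x < \<rho> w0" "\<rho> w0 < \<rho> y" using w0 by auto
    then have "\<rho> x < \<rho> y" by simp
    then have "strictly_below r x y" using \<rho> xy by simp
    then have "card {z \<in> S. strictly_below r x z \<and> strictly_below r z y \<and>
        \<not> has_neighbor_in C z R} < q"
      using zr xy R by blast
    moreover have "W \<subseteq> {z \<in> S. strictly_below r x z \<and> strictly_below r z y \<and>
        \<not> has_neighbor_in C z R}"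
      using W xy \<rho> none R(2) by (auto simp: has_neighbor_in_def)
    then have "card W \<le> card {z \<in> S. strictly_below r x z \<and> strictly_below r z y \<and>
        \<not> has_neighbor_in C z R}"
      using fin by (intro card_mono) auto
    ultimately show False using W by simp
  qed
  then have "crossing q C S \<rho>" unfolding crossing_def by blast
  then show ?thesis using inj by blast
qed

section \<open>Counting along a path meeting a set of letters\<close>

lemma top_subset:
  fixes \<rho> :: "'a \<Rightarrow> int"
  assumes "finite A" "inj_on \<rho> A" "k \<le> card A"
  shows "\<exists>W \<subseteq> A. card W = k \<and> (\<forall>w \<in> W. \<forall>s \<in> A - W. \<rho> s < \<rho> w)"
  using assms(3)
proof (induction k)
  case 0
  then show ?case by (intro exI[of _ "{}"]) auto
next
  case (Suc k)
  then obtain W where W: "W \<subseteq> A" "card W = k" "\<And>w s. w \<in> W \<Longrightarrow> s \<in> A - W \<Longrightarrow> \<rho> s < \<rho> w"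
    by auto
  have fW: "finite W" by (rule finite_subset[OF W(1) assms(1)])
  have "A \<noteq> W" using W(2) Suc.prems by auto
  then have "A - W \<noteq> {}" using W(1) by auto
  then have "Max (\<rho> ` (A - W)) \<in> \<rho> ` (A - W)" using assms(1) by (intro Max_in) simp_all
  then obtain m where m: "m \<in> A - W" "Max (\<rho> ` (A - W)) = \<rho> m" by (elim imageE)
  have "\<rho> s < \<rho> m" if "s \<in> A - insert m W" for s
  proof -
    have "\<rho> s \<le> \<rho> m" unfolding m(2)[symmetric] using that assms(1) by (intro Max_ge) auto
    moreover have "\<rho> s \<noteq> \<rho> m" using inj_onD[OF assms(2), of s m] m that by auto
    ultimately show ?thesis by simp
  qed
  then show ?case
    using W m fW by (intro exI[of _ "insert m W"]) auto
qed

text \<open>The elements of \<open>B\<close> are letters, which occur on the path \<open>Q\<close> at their neighbors. Let \<open>z\<close> be a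
  letter which occurs between any two occurrences of distinct
  further letters. A letter \<open>a\<close> that is separated from \<open>z\<close> by the set \<open>W\<close> of the \<open>q\<close> highest
  elements of \<open>B \<union> (S \<inter> Q)\<close> below \<open>z\<close> can only be linked to \<open>z\<close> along \<open>Q\<close> by passing through a
  vertex of \<open>W\<close> lying on \<open>Q\<close>, and these vertices are distinct for distinct letters. So the letters
  below \<open>z\<close>, inside and outside of \<open>W\<close>, do not outnumber \<open>W\<close>.\<close>

lemma letters_below_separator:
  fixes \<rho> :: "'a \<Rightarrow> int"
  assumes q: "q \<ge> 1" and C: "constellation C S" "ample C S"
    and inj: "inj_on \<rho> S" and cr: "crossing q C S \<rho>"
    and Q: "path_in C Q"
    and B: "B \<subseteq> S" "z \<in> B" "B \<inter> set Q = {}"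
    and occ: "\<And>b. b \<in> B \<Longrightarrow> \<exists>k < length Q. adjacent C b (Q ! k)"
    and sep: "\<And>b b' i j. b \<in> B - {z} \<Longrightarrow> b' \<in> B - {z} \<Longrightarrow> b \<noteq> b' \<Longrightarrow> i < j \<Longrightarrow> j < length Q \<Longrightarrow>
      adjacent C b (Q ! i) \<Longrightarrow> adjacent C b' (Q ! j) \<Longrightarrow>
      \<exists>k. i < k \<and> k < j \<and> adjacent C z (Q ! k)"
  shows "card {b \<in> B. \<rho> b < \<rho> z} \<le> q"
proof (rule ccontr)
  assume big: "\<not> card {b \<in> B. \<rho> b < \<rho> z} \<le> q"
  have G: "simple_graph C" using C by (simp add: constellation_def)
  have SV: "S \<subseteq> verts C" and stab: "\<And>u v. u \<in> S \<Longrightarrow> v \<in> S \<Longrightarrow> \<not> adjacent C u v"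
    using C by (auto simp: constellation_def stable_set_def)
  have fS: "finite S" using SV G by (auto simp: simple_graph_def intro: finite_subset)
  have uniq: "s = s'" if "v \<in> verts C" "s \<in> S" "s' \<in> S" "adjacent C s v" "adjacent C s' v" for v s s'
    using ample_unique_neighbor[OF C that(1-3)] adjacent_sym[OF that(4)] adjacent_sym[OF that(5)]
    by simp
  have QV: "set Q \<subseteq> verts C" and dQ: "distinct Q"
    and Qadj: "\<And>i j. i < length Q \<Longrightarrow> j < length Q \<Longrightarrow>
      adjacent C (Q ! i) (Q ! j) \<longleftrightarrow> j = Suc i \<or> i = Suc j"
    using Q by (auto simp: path_in_iff[OF G])
  define vis where "vis = (\<lambda>t k. k < length Q \<and> adjacent C t (Q ! k))"
  have vis1: "t = t'" if "vis t k" "vis t' k" "t \<in> S" "t' \<in> S" for t t' k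
  proof -
    have "Q ! k \<in> verts C" using that(1) QV nth_mem[of k Q] by (auto simp: vis_def)
    then show ?thesis using uniq that by (simp add: vis_def)
  qed
  have visS: "Q ! k \<notin> S" if "vis t k" "t \<in> S" for t k
    using stab that by (auto simp: vis_def)
  have zS: "z \<in> S" using B by auto
  have sep': "\<exists>k. min i j < k \<and> k < max i j \<and> vis z k"
    if bb: "b \<in> B - {z}" "b' \<in> B - {z}" "b \<noteq> b'" and v: "vis b i" "vis b' j" for b b' i j
  proof -
    have v': "i < length Q" "j < length Q" "adjacent C b (Q ! i)" "adjacent C b' (Q ! j)"
      using v by (auto simp: vis_def)
    have "i \<noteq> j" using vis1[of b i b'] v bb B(1) by blast
    then consider "i < j" | "j < i" by linarith
    then show ?thesis
    proof cases
      case 1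
      obtain k where "i < k" "k < j" "adjacent C z (Q ! k)"
        using sep[OF bb 1 v'(2,3,4)] by blast
      then show ?thesis using v' by (intro exI[of _ k]) (auto simp: vis_def)
    next
      case 2
      obtain k where "j < k" "k < i" "adjacent C z (Q ! k)"
        using sep[OF bb(2,1) bb(3)[symmetric] 2 v'(1,4,3)] by blast
      then show ?thesis using v' by (intro exI[of _ k]) (auto simp: vis_def)
    qed
  qed
  define S' where "S' = B \<union> (S \<inter> set Q)"
  define SL where "SL = {s \<in> S'. \<rho> s < \<rho> z}"
  have SLS: "SL \<subseteq> S" using B by (auto simp: SL_def S'_def)
  have fSL: "finite SL" using SLS fS finite_subset by blast
  have "card {b \<in> B. \<rho> b < \<rho> z} \<le> card SL"
    by (rule card_mono[OF fSL]) (auto simp: SL_def S'_def)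
  then obtain W where W: "W \<subseteq> SL" "card W = q" "\<And>w s. w \<in> W \<Longrightarrow> s \<in> SL - W \<Longrightarrow> \<rho> s < \<rho> w"
    using top_subset[OF fSL inj_on_subset[OF inj SLS], of q] big by auto
  have WS: "W \<subseteq> S" using W SLS by auto
  have fW: "finite W" using WS fS finite_subset by blast
  have Wz: "\<rho> w < \<rho> z" if "w \<in> W" for w using that W by (auto simp: SL_def)
  define F where "F = {b \<in> B. \<rho> b < \<rho> z} - W"
  have through: "\<exists>i k. vis a i \<and> k < length Q \<and> Q ! k \<in> W \<and>
      (\<forall>m. vis z m \<longrightarrow> \<not> (min i k < m \<and> m < max i k))" if a: "a \<in> F" for a
  proof -
    have aB: "a \<in> B" "a \<in> S" "a \<in> SL - W" "a \<noteq> z"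
      using a B by (auto simp: F_def SL_def S'_def)
    \<comment> \<open>Take occurrences of \<open>a\<close> and \<open>z\<close> at minimal distance: no letter occurs between them.\<close>
    define gap where "gap = (\<lambda>(i, j). max i j - min i j :: nat)"
    obtain i0 j0 where "vis a i0" "vis z j0" using occ aB(1) B(2) unfolding vis_def by blast
    then have "\<exists>ij. vis a (fst ij) \<and> vis z (snd ij)" by (intro exI[of _ "(i0, j0)"]) simp
    then obtain ij where "vis a (fst ij)" "vis z (snd ij)"
      and min: "\<And>y. vis a (fst y) \<and> vis z (snd y) \<Longrightarrow> gap ij \<le> gap y"
      using ex_has_least_nat[of "\<lambda>ij. vis a (fst ij) \<and> vis z (snd ij)" _ gap] by blast
    then obtain i j where ij: "vis a i" "vis z j" and ijp: "ij = (i, j)" by (cases ij) auto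
    have closest: False if "vis z k" "min i j < k" "k < max i j" for k
      using min[of "(i, k)"] ij that by (auto simp: gap_def ijp)
    have closest_a: False if "vis a k" "min i j < k" "k < max i j" for k
      using min[of "(k, j)"] ij that by (auto simp: gap_def ijp)
    have other: False if bk: "vis b k" "min i j < k" "k < max i j" "b \<in> B" for b k
    proof (cases "b = z \<or> b = a")
      case True
      then show False using bk closest closest_a by blast
    next
      case False
      then obtain m where m: "min i k < m" "m < max i k" "vis z m"
        using sep'[of a b i k] aB ij bk by blast
      have "min i j < m \<and> m < max i j" using m(1,2) bk(2,3) by auto
      then show False using closest m by blast
    qed
    have bd: "min i j < length Q" "max i j < length Q" "i \<noteq> j"
      using ij vis1[of a i z] aB zS by (auto simp: vis_def)
    define A where "A = insert a (insert z ((!) Q ` {min i j..max i j}))"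
    have "conn C ((!) Q ` {min i j..max i j})"
    proof (rule conn_list_segment)
      show "Q ! k \<in> verts C" if "k \<le> max i j" for k
      proof -
        have "Q ! k \<in> set Q" using that bd by (intro nth_mem) linarith
        then show ?thesis using QV by blast
      qed
      show "adjacent C (Q ! k) (Q ! Suc k)" if "Suc k \<le> max i j" for k
        using that bd by (subst Qadj) auto
    qed simp
    then have connA: "conn C A"
      unfolding A_def using ij aB zS SV
      by (intro conn_insert) (auto simp: vis_def intro: exI[of _ j])
    have "\<exists>k. min i j < k \<and> k < max i j \<and> Q ! k \<in> W"
    proof (rule ccontr)
      assume no: "\<not> ?thesis"
      have ends: "Q ! i \<notin> S" "Q ! j \<notin> S" using visS ij aB zS by blast+
      have strict: "min i j < k \<and> k < max i j"
        if "min i j \<le> k" "k \<le> max i j" "Q ! k \<in> S" for k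
      proof -
        have "k \<noteq> i" "k \<noteq> j" using ends that by auto
        then show ?thesis using that(1,2) by auto
      qed
      \<comment> \<open>By assumption the segment together with \<open>a\<close> and \<open>z\<close> contains no element of \<open>S\<close> ranked
        within \<open>W\<close>.\<close>
      have sides: "(\<forall>w \<in> W. \<rho> s < \<rho> w) \<or> (\<forall>w \<in> W. \<rho> w < \<rho> s)" if s: "s \<in> A" "s \<in> S" for s
      proof -
        have "s \<in> S' - W"
        proof -
          consider "s = a" | "s = z" | k where "s = Q ! k" "min i j \<le> k" "k \<le> max i j"
            using s by (auto simp: A_def)
          then show ?thesis
          proof cases
            case 1 then show ?thesis using aB by (auto simp: SL_def)
          next
            case 2 then show ?thesis using B Wz by (auto simp: S'_def)
          next
            case 3
            then have "Q ! k \<in> set Q" using bd by (intro nth_mem) linarith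
            then show ?thesis using no strict[OF 3(2,3)] 3 s by (auto simp: S'_def)
          qed
        qed
        then show ?thesis
        proof (cases "\<rho> s < \<rho> z")
          case True
          then show ?thesis using W \<open>s \<in> S' - W\<close> by (auto simp: SL_def)
        next
          case False
          then show ?thesis using Wz by fastforce
        qed
      qed
      obtain w x where w: "w \<in> W" and x: "x \<in> A" and wx: "adjacent C w x"
      proof (rule crossing_neighbor[OF cr connA WS])
        show "q \<le> card W" using W by simp
        show "a \<in> A" "z \<in> A" by (auto simp: A_def)
        show "\<forall>w \<in> W. \<rho> a < \<rho> w" using W(3) aB by blast
        show "\<forall>w \<in> W. \<rho> w < \<rho> z" using Wz by blast
      qed (use sides aB zS in auto)
      have wS: "w \<in> S" using w WS by auto
      have waz: "w \<noteq> a" "w \<noteq> z" using w aB Wz by auto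
      have "x \<notin> S" using stab wS wx by blast
      then obtain k where k: "x = Q ! k" "min i j \<le> k" "k \<le> max i j"
        using x aB zS by (auto simp: A_def)
      have visw: "vis w k" using wx k bd by (auto simp: vis_def)
      have kij: "k \<noteq> i" "k \<noteq> j" using vis1[of w k] visw ij wS aB zS waz by blast+
      then have kin: "min i j < k" "k < max i j" using k(2,3) by auto
      have "w \<notin> B" using other[OF visw kin] by blast
      then have "w \<in> set Q" using w W(1) by (auto simp: SL_def S'_def)
      then obtain m where m: "m < length Q" "w = Q ! m" by (auto simp: in_set_conv_nth)
      then have "k = Suc m \<or> m = Suc k" using wx k Qadj[of m k] bd by auto
      then have "min i j \<le> m" "m \<le> max i j" using kin by auto
      then show False using strict[of m] m wS no w by auto
    qed
    then obtain k where k: "min i j < k" "k < max i j" "Q ! k \<in> W" by blast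
    have "\<not> (min i k < m \<and> m < max i k)" if m: "vis z m" for m
    proof
      assume "min i k < m \<and> m < max i k"
      then have "min i j < m" "m < max i j" using k(1,2) by (auto simp: min_def max_def split: if_splits)
      then show False using closest[OF m] by blast
    qed
    then show ?thesis using ij(1) k bd by (intro exI[of _ i] exI[of _ k]) auto
  qed
  then obtain pos cut where pc: "\<And>a. a \<in> F \<Longrightarrow> vis a (pos a)"
    "\<And>a. a \<in> F \<Longrightarrow> cut a < length Q" "\<And>a. a \<in> F \<Longrightarrow> Q ! cut a \<in> W"
    "\<And>a m. a \<in> F \<Longrightarrow> vis z m \<Longrightarrow> \<not> (min (pos a) (cut a) < m \<and> m < max (pos a) (cut a))"
    by metis
  \<comment> \<open>Otherwise two distinct letters would both be linked to the same cut vertex, and hence to each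
    other, along parts of \<open>Q\<close> free of \<open>z\<close>.\<close>
  have "inj_on (\<lambda>a. Q ! cut a) F"
  proof (rule inj_onI, rule ccontr)
    fix a a' assume aa: "a \<in> F" "a' \<in> F" "Q ! cut a = Q ! cut a'" "a \<noteq> a'"
    then have eq: "cut a = cut a'" using dQ pc(2) by (simp add: nth_eq_iff_index_eq)
    have "a \<in> B - {z}" "a' \<in> B - {z}" using aa by (auto simp: F_def)
    then obtain m where m: "min (pos a) (pos a') < m" "m < max (pos a) (pos a')" "vis z m"
      using sep'[OF _ _ aa(4) pc(1) pc(1)] aa by blast
    have "m \<noteq> cut a" using visS[OF m(3) zS] pc(3)[OF aa(1)] WS by auto
    then show False
      using m(1,2) pc(4)[OF aa(1) m(3)] pc(4)[OF aa(2) m(3)] eq by (auto simp: min_def max_def split: if_splits)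
  qed
  then have "card F \<le> card (W \<inter> set Q)"
    using pc(2,3) fW by (intro card_inj_on_le[of "\<lambda>a. Q ! cut a"]) auto
  moreover have "card {b \<in> B. \<rho> b < \<rho> z} \<le> card (W \<inter> B) + card F"
  proof -
    have "{b \<in> B. \<rho> b < \<rho> z} \<subseteq> (W \<inter> B) \<union> F" by (auto simp: F_def)
    moreover have "finite F" using B fS finite_subset[of F S] by (auto simp: F_def)
    ultimately have "card {b \<in> B. \<rho> b < \<rho> z} \<le> card ((W \<inter> B) \<union> F)"
      using fW by (intro card_mono) auto
    then show ?thesis using card_Un_le[of "W \<inter> B" F] by linarith
  qed
  moreover have "card (W \<inter> B) + card (W \<inter> set Q) \<le> card W"
  proof -
    have "card (W \<inter> B) + card (W \<inter> set Q) = card ((W \<inter> B) \<union> (W \<inter> set Q))"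
      using B(3) fW by (intro card_Un_disjoint[symmetric]) auto
    also have "\<dots> \<le> card W" using fW by (intro card_mono) auto
    finally show ?thesis .
  qed
  ultimately show False using big W(2) by linarith
qed

section \<open>Interrupted constellations\<close>

lemma has_induced_embedding:
  assumes C: "simple_graph C" and K: "has_induced C K"
  obtains g where "inj_on g (verts K)" "g ` verts K \<subseteq> verts C"
    "\<And>u v. u \<in> verts K \<Longrightarrow> v \<in> verts K \<Longrightarrow> adjacent C (g u) (g v) \<longleftrightarrow> adjacent K u v"
proof -
  obtain X f where X: "X \<subseteq> verts C" and f: "bij_betw f (verts (induce C X)) (verts K)"
    and fadj: "\<And>u v. u \<in> verts (induce C X) \<Longrightarrow> v \<in> verts (induce C X) \<Longrightarrow>
      adjacent (induce C X) u v \<longleftrightarrow> adjacent K (f u) (f v)"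
    using K by (auto simp: has_induced_def graph_iso_def)
  have vX: "verts (induce C X) = X" using X by (auto simp: induce_def)
  define g where "g = inv_into X f"
  have bij: "bij_betw g (verts K) X" unfolding g_def using f vX bij_betw_inv_into by metis
  have gX: "g v \<in> X" and fg: "f (g v) = v" if "v \<in> verts K" for v
    using bij f vX that bij_betw_apply[OF bij] bij_betw_inv_into_right[of f X "verts K" v]
    by (auto simp: g_def)
  have "adjacent C (g u) (g v) \<longleftrightarrow> adjacent K u v" if "u \<in> verts K" "v \<in> verts K" for u v
  proof -
    have "adjacent C (g u) (g v) \<longleftrightarrow> adjacent (induce C X) (g u) (g v)"
      using gX that by (auto simp: adjacent_def induce_def)
    then show ?thesis using fadj[of "g u" "g v"] gX fg that vX by simp
  qed
  moreover have "inj_on g (verts K)" "g ` verts K \<subseteq> verts C"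
    using bij X by (auto simp: bij_betw_def)
  ultimately show ?thesis using that[of g] by simp
qed

lemma three_sorted:
  fixes pos :: "'a \<Rightarrow> nat"
  assumes "3 \<le> card X" "inj_on pos X"
  shows "\<exists>a \<in> X. \<exists>b \<in> X. \<exists>c \<in> X. pos a < pos b \<and> pos b < pos c"
proof -
  obtain Y where Y: "Y \<subseteq> X" "card Y = 3" using assms(1) obtain_subset_with_card_n by metis
  then obtain x y z where xyz: "x \<in> X" "y \<in> X" "z \<in> X" "x \<noteq> y" "y \<noteq> z" "x \<noteq> z"
    by (auto simp: card_3_iff)
  then have ne: "pos x \<noteq> pos y" "pos y \<noteq> pos z" "pos x \<noteq> pos z"
    using assms(2) by (auto dest: inj_onD)
  consider "pos x < pos y \<and> pos y < pos z" | "pos x < pos z \<and> pos z < pos y"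
    | "pos y < pos x \<and> pos x < pos z" | "pos y < pos z \<and> pos z < pos x"
    | "pos z < pos x \<and> pos x < pos y" | "pos z < pos y \<and> pos y < pos x"
    using ne by linarith
  then show ?thesis by cases (use xyz in blast)+
qed

text \<open>Along a path of an interrupted constellation, occurrences of distinct letters are separated by
  every letter larger than both.\<close>

lemma interrupted_separates:
  fixes \<tau> :: "'b \<Rightarrow> int"
  assumes D: "constellation D T" "ample D T"
    and routes: "\<And>x y z R. x \<in> T \<Longrightarrow> y \<in> T \<Longrightarrow> z \<in> T \<Longrightarrow> \<tau> x < \<tau> y \<Longrightarrow> \<tau> y < \<tau> z \<Longrightarrow>
      route_from_to D T x y R \<Longrightarrow> has_neighbor_in D z R"
    and inj: "inj_on \<tau> T"
    and Q: "path_in D Q" "set Q \<inter> T = {}"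
    and xyz: "x \<in> T" "y \<in> T" "z \<in> T" "x \<noteq> y" "\<tau> x < \<tau> z" "\<tau> y < \<tau> z"
    and ij: "i < j" "j < length Q" "adjacent D x (Q ! i)" "adjacent D y (Q ! j)"
  shows "\<exists>k. i < k \<and> k < j \<and> adjacent D z (Q ! k)"
proof -
  have G: "simple_graph D" using D by (simp add: constellation_def)
  have TV: "T \<subseteq> verts D" and stab: "\<And>u v. u \<in> T \<Longrightarrow> v \<in> T \<Longrightarrow> \<not> adjacent D u v"
    using D by (auto simp: constellation_def stable_set_def)
  have QV: "Q ! k \<in> verts D" "Q ! k \<notin> T" if "k < length Q" for k
    using Q nth_mem[OF that] by (auto simp: path_in_def)
  have Qadj: "adjacent D (Q ! k) (Q ! Suc k)" if "Suc k < length Q" for k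
    using Q that by (auto simp: path_in_iff[OF G])
  define A where "A = insert x (insert y ((!) Q ` {i..j}))"
  have "conn D ((!) Q ` {i..j})"
    by (rule conn_list_segment) (use ij Qadj QV in auto)
  moreover have "\<exists>a \<in> (!) Q ` {i..j}. adjacent D y a" using ij by (intro bexI[of _ "Q ! j"]) auto
  ultimately have "conn D (insert y ((!) Q ` {i..j}))"
    using xyz TV by (intro conn_insert) auto
  moreover have "\<exists>a \<in> insert y ((!) Q ` {i..j}). adjacent D x a"
    using ij by (intro bexI[of _ "Q ! i"]) auto
  moreover have "x \<in> verts D" using xyz TV by auto
  ultimately have conn: "conn D A" unfolding A_def by (intro conn_insert[of D _ x])
  have AT: "A \<inter> T = {x, y}" using xyz QV(2) ij by (auto simp: A_def)
  have "\<tau> x \<noteq> \<tau> y" using inj xyz by (auto dest: inj_onD)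
  then obtain x' y' where xy': "{x, y} = {x'} \<union> {y'}" "\<tau> x' < \<tau> y'"
  proof (cases "\<tau> x < \<tau> y")
    case True
    then show ?thesis using that[of x y] by (simp add: insert_commute)
  next
    case False
    then show ?thesis using that[of y x] \<open>\<tau> x \<noteq> \<tau> y\<close> by auto
  qed
  then have "x' \<in> T" "y' \<in> T" "x' \<noteq> y'" "\<tau> y' < \<tau> z" using xyz by (auto simp: doubleton_eq_iff)
  moreover obtain R where R: "route_from_to D T x' y' R" "set R \<subseteq> A"
    using route_in_connected_set[OF D(1) conn, of "{x'}" "{y'}"] AT xy'(1) \<open>x' \<noteq> y'\<close> by auto
  ultimately have "has_neighbor_in D z R" using routes xyz xy' by blast
  then obtain v where v: "v \<in> A" "adjacent D z v" using R by (auto simp: has_neighbor_in_def)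
  then obtain k where k: "v = Q ! k" "i \<le> k" "k \<le> j"
    using stab xyz by (auto simp: A_def)
  have "z \<noteq> x" "z \<noteq> y" using xyz by auto
  then have "k \<noteq> i" "k \<noteq> j"
    using ample_unique_neighbor[OF D QV(1), of k z] ij xyz v k adjacent_sym by fastforce+
  then show ?thesis using k v by (intro exI[of _ k]) auto
qed

lemma degree_outside_stable_set:
  assumes C: "constellation C S" "ample C S" and v: "v \<in> verts C" "v \<notin> S"
  shows "card {u. adjacent C v u} \<le> 3"
proof -
  have G: "simple_graph C" using C by (simp add: constellation_def)
  define N where "N = {u. adjacent C v u} - S"
  define M where "M = {u. adjacent C v u} \<inter> S"
  have star: "conn C (insert v N')" if "finite N'" "N' \<subseteq> N" for N'
    using that
  proof (induction N')
    case empty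
    then show ?case using v by (simp add: conn_singleton)
  next
    case (insert u N')
    then have "conn C (insert v N')" "adjacent C u v"
      by (auto simp: N_def intro: adjacent_sym)
    then have "conn C (insert u (insert v N'))"
      using adjacent_verts(1)[OF G, of u v] by (intro conn_insert[of C _ u]) auto
    then show ?case by (simp add: insert_commute)
  qed
  have "{u. adjacent C v u} \<subseteq> verts C" using adjacent_verts[OF G] by blast
  then have "finite N" using G by (auto simp: N_def simple_graph_def intro: finite_subset)
  then have "conn C (insert v N)" using star by blast
  moreover have "insert v N \<inter> S = {}" using v by (auto simp: N_def)
  ultimately obtain L where L: "L \<in> path_comps C S" "insert v N \<subseteq> verts L"
    using conn_in_component[OF G, of "insert v N" S] by auto
  then obtain p where p: "path_in C p" "insert v N \<subseteq> set p"
    using component_is_induced_path[OF C(1) L(1)] by auto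
  then obtain i where i: "i < length p" "v = p ! i" by (auto simp: in_set_conv_nth)
  have "N \<subseteq> {p ! (i - 1), p ! Suc i}"
  proof
    fix u assume u: "u \<in> N"
    then have "u \<in> set p" using p by auto
    then obtain j where j: "j < length p" "u = p ! j" by (auto simp: in_set_conv_nth)
    then have "j = Suc i \<or> i = Suc j"
      using p(1) i u by (auto simp: path_in_iff[OF G] N_def)
    then show "u \<in> {p ! (i - 1), p ! Suc i}" using j by auto
  qed
  then have "card N \<le> card {p ! (i - 1), p ! Suc i}" by (intro card_mono) auto
  also have "\<dots> \<le> 2" using card_insert_le_m1[of 2 "{p ! Suc i}"] by auto
  finally have N: "card N \<le> 2" .
  have M: "card M \<le> 1"
  proof (cases "M = {}")
    case False
    then obtain s where "s \<in> M" by blast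
    then have "M \<subseteq> {s}" using ample_unique_neighbor[OF C v(1), of _ s] by (auto simp: M_def)
    then show ?thesis using card_mono[of "{s}" M] by simp
  qed simp
  have "{u. adjacent C v u} = N \<union> M" by (auto simp: N_def M_def)
  then show ?thesis using N M card_Un_le[of N M] by simp
qed

text \<open>Among four letters smaller than \<open>t\<close>, the largest one, \<open>u\<close>, separates occurrences of the other
  three. So some occurrences read \<open>a u b u c\<close>, and \<open>t\<close> occurs in each of the four gaps. Here
  \<open>vis s k\<close> means that the letter \<open>s\<close> occurs at position \<open>k\<close>.\<close>

lemma four_visits:
  fixes \<tau> :: "'b \<Rightarrow> int" and vis :: "'b \<Rightarrow> nat \<Rightarrow> bool"
  assumes inj: "inj_on \<tau> T" and finV: "\<And>t. finite {k. vis t k}"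
    and t: "t \<in> T" "4 \<le> card {s \<in> T. \<tau> s < \<tau> t}"
    and occ: "\<And>s. s \<in> T \<Longrightarrow> \<exists>k. vis s k"
    and uniq: "\<And>s s' k. s \<in> T \<Longrightarrow> s' \<in> T \<Longrightarrow> vis s k \<Longrightarrow> vis s' k \<Longrightarrow> s = s'"
    and sep: "\<And>x y z i j. x \<in> T \<Longrightarrow> y \<in> T \<Longrightarrow> z \<in> T \<Longrightarrow> x \<noteq> y \<Longrightarrow> \<tau> x < \<tau> z \<Longrightarrow> \<tau> y < \<tau> z \<Longrightarrow>
      i < j \<Longrightarrow> vis x i \<Longrightarrow> vis y j \<Longrightarrow> \<exists>k. i < k \<and> k < j \<and> vis z k"
  shows "4 \<le> card {k. vis t k}"
proof -
  define X where "X = {s \<in> T. \<tau> s < \<tau> t}"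
  have X4: "4 \<le> card X" using t(2) by (simp add: X_def)
  have fX: "finite X" using X4 by (intro card_ge_0_finite) simp
  have "Max (\<tau> ` X) \<in> \<tau> ` X" using fX X4 by (intro Max_in) auto
  then obtain u where u: "u \<in> X" "Max (\<tau> ` X) = \<tau> u" by (elim imageE)
  have below: "\<tau> s < \<tau> u" if s: "s \<in> X - {u}" for s
  proof -
    have "\<tau> s \<le> \<tau> u" unfolding u(2)[symmetric] using s fX by (intro Max_ge) auto
    moreover have "\<tau> s \<noteq> \<tau> u" using inj_onD[OF inj, of s u] s u(1) by (auto simp: X_def)
    ultimately show ?thesis by simp
  qed
  obtain pos where pos: "\<And>s. s \<in> T \<Longrightarrow> vis s (pos s)" using occ by metis
  have "inj_on pos (X - {u})"
  proof (rule inj_onI)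
    fix s s' assume s: "s \<in> X - {u}" "s' \<in> X - {u}" "pos s = pos s'"
    then have "s \<in> T" "s' \<in> T" by (auto simp: X_def)
    then show "s = s'" using uniq[of s s' "pos s"] pos[of s] pos[of s'] s(3) by simp
  qed
  moreover have "3 \<le> card (X - {u})" using X4 u(1) fX by simp
  ultimately obtain a b c where abc: "a \<in> X - {u}" "b \<in> X - {u}" "c \<in> X - {u}"
    "pos a < pos b" "pos b < pos c"
    using three_sorted by metis
  have T: "a \<in> T" "b \<in> T" "c \<in> T" "u \<in> T" using abc u by (auto simp: X_def)
  have lt: "\<tau> a < \<tau> t" "\<tau> b < \<tau> t" "\<tau> c < \<tau> t" "\<tau> u < \<tau> t"
    using abc(1-3) u(1) by (auto simp: X_def)
  have ne: "a \<noteq> b" "b \<noteq> c" using abc(4,5) by auto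
  obtain m where m: "pos a < m" "m < pos b" "vis u m"
    using sep[OF T(1,2,4) ne(1) below[OF abc(1)] below[OF abc(2)] abc(4) pos[OF T(1)] pos[OF T(2)]]
    by blast
  obtain n where n: "pos b < n" "n < pos c" "vis u n"
    using sep[OF T(2,3,4) ne(2) below[OF abc(2)] below[OF abc(3)] abc(5) pos[OF T(2)] pos[OF T(3)]]
    by blast
  have neu: "a \<noteq> u" "b \<noteq> u" "u \<noteq> b" "u \<noteq> c" using abc(1-3) by auto
  obtain k1 where k1: "pos a < k1" "k1 < m" "vis t k1"
    using sep[OF T(1,4) t(1) neu(1) lt(1,4) m(1) pos[OF T(1)] m(3)] by blast
  obtain k2 where k2: "m < k2" "k2 < pos b" "vis t k2"
    using sep[OF T(4,2) t(1) neu(3) lt(4,2) m(2) m(3) pos[OF T(2)]] by blast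
  obtain k3 where k3: "pos b < k3" "k3 < n" "vis t k3"
    using sep[OF T(2,4) t(1) neu(2) lt(2,4) n(1) pos[OF T(2)] n(3)] by blast
  obtain k4 where k4: "n < k4" "k4 < pos c" "vis t k4"
    using sep[OF T(4,3) t(1) neu(4) lt(4,3) n(2) n(3) pos[OF T(3)]] by blast
  have "card {k1, k2, k3, k4} = 4" using k1(1,2) k2(1,2) k3(1,2) k4(1,2) m(1,2) n(1,2) by simp
  moreover have "{k1, k2, k3, k4} \<subseteq> {k. vis t k}" using k1 k2 k3 k4 by auto
  ultimately show ?thesis using card_mono[OF finV[of t]] by metis
qed

lemma no_induced_interrupted:
  fixes C :: "'a graph" and D :: "'b graph"
  assumes q: "q \<ge> 1" and C: "constellation C S" "ample C S" and zz: "zigzagged q C S"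
    and D: "sl_constellation (2 * q + 6) l D T" "l \<ge> 1" "ample D T" "interrupted D T"
  shows "\<not> has_induced C D"
proof
  assume "has_induced C D"
  have GC: "simple_graph C" using C by (simp add: constellation_def)
  obtain h where h: "inj_on h (verts D)" "h ` verts D \<subseteq> verts C"
    and hadj: "\<And>u v. u \<in> verts D \<Longrightarrow> v \<in> verts D \<Longrightarrow> adjacent C (h u) (h v) \<longleftrightarrow> adjacent D u v"
  proof (rule has_induced_embedding[OF GC \<open>has_induced C D\<close>])
    fix g assume "inj_on g (verts D)" "g ` verts D \<subseteq> verts C"
      "\<And>u v. u \<in> verts D \<Longrightarrow> v \<in> verts D \<Longrightarrow> adjacent C (g u) (g v) \<longleftrightarrow> adjacent D u v"
    then show thesis by (rule that)
  qed
  have cD: "constellation D T" and cardT: "card T = 2 * q + 6" and "card (path_comps D T) = l"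
    using D by (auto simp: sl_constellation_def)
  have GD: "simple_graph D" using cD by (simp add: constellation_def)
  have TV: "T \<subseteq> verts D" using cD by (auto simp: constellation_def stable_set_def)
  have fT: "finite T" using cardT card.infinite[of T] by fastforce
  have "path_comps D T \<noteq> {}" using D(2) \<open>card (path_comps D T) = l\<close> by auto
  then obtain L where L: "L \<in> path_comps D T" by blast
  then obtain Q where Q: "path_in D Q" "set Q \<inter> T = {}" "verts L = set Q"
    using component_is_induced_path[OF cD] by blast
  have QV: "Q ! k \<in> verts D" if "k < length Q" for k
    using Q that nth_mem[of k Q] by (auto simp: path_in_def)
  have occ: "\<exists>k < length Q. adjacent D t (Q ! k)" if t: "t \<in> T" for t
  proof -
    have "\<exists>v \<in> verts L. adjacent D t v" using cD t L unfolding constellation_def by simp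
    then obtain v where "v \<in> verts L" "adjacent D t v" by blast
    then show ?thesis using Q(3) by (auto simp: in_set_conv_nth)
  qed
  obtain r where r: "linear_order_on T r"
    and rr: "\<And>x y z R. x \<in> T \<Longrightarrow> y \<in> T \<Longrightarrow> z \<in> T \<Longrightarrow> strictly_below r x y \<Longrightarrow> strictly_below r y z \<Longrightarrow>
      route_from_to D T x y R \<Longrightarrow> has_neighbor_in D z R"
    using D(4) unfolding interrupted_def by blast
  obtain \<tau> :: "'b \<Rightarrow> int" where inj\<tau>: "inj_on \<tau> T"
    and \<tau>: "\<And>x y. x \<in> T \<Longrightarrow> y \<in> T \<Longrightarrow> strictly_below r x y \<longleftrightarrow> \<tau> x < \<tau> y"
    using linear_order_rank[OF fT r] by blast
  define vis where "vis = (\<lambda>t k. k < length Q \<and> adjacent D t (Q ! k))"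
  have uniq: "s = s'" if "s \<in> T" "s' \<in> T" "vis s k" "vis s' k" for s s' k
  proof (rule ample_unique_neighbor[OF cD D(3)])
    show "Q ! k \<in> verts D" using that QV by (simp add: vis_def)
    show "adjacent D (Q ! k) s" "adjacent D (Q ! k) s'"
      using that by (auto simp: vis_def intro: adjacent_sym)
  qed (use that in auto)
  have sepD: "\<exists>k. i < k \<and> k < j \<and> vis z k"
    if xyz: "x \<in> T" "y \<in> T" "z \<in> T" "x \<noteq> y" "\<tau> x < \<tau> z" "\<tau> y < \<tau> z"
      and ij: "i < j" "vis x i" "vis y j" for x y z i j
  proof -
    have ij': "j < length Q" "adjacent D x (Q ! i)" "adjacent D y (Q ! j)"
      using ij by (auto simp: vis_def)
    have "\<exists>k. i < k \<and> k < j \<and> adjacent D z (Q ! k)"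
      by (rule interrupted_separates[OF cD D(3) _ inj\<tau> Q(1,2) xyz ij(1) ij'])
        (use rr \<tau> in blast)
    then show ?thesis using ij' by (auto simp: vis_def)
  qed
  have high: "h t \<in> S" if t: "t \<in> T" "4 \<le> card {s \<in> T. \<tau> s < \<tau> t}" for t
  proof (rule ccontr)
    assume nS: "h t \<notin> S"
    have "4 \<le> card {k. vis t k}"
    proof (rule four_visits[OF inj\<tau> _ t])
      show "finite {k. vis t k}" for t by (rule finite_subset[of _ "{..<length Q}"]) (auto simp: vis_def)
      show "\<exists>k. vis s k" if "s \<in> T" for s using occ that by (auto simp: vis_def)
    qed (use uniq sepD in blast)+
    also have "\<dots> \<le> card {u. adjacent C (h t) u}"
    proof (rule card_inj_on_le[of "\<lambda>k. h (Q ! k)"])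
      show "inj_on (\<lambda>k. h (Q ! k)) {k. vis t k}"
      proof (rule inj_onI)
        fix k k' assume k: "k \<in> {k. vis t k}" "k' \<in> {k. vis t k}" "h (Q ! k) = h (Q ! k')"
        then have "Q ! k = Q ! k'" using inj_onD[OF h(1)] QV by (auto simp: vis_def)
        then show "k = k'" using k Q(1) by (simp add: vis_def path_in_def nth_eq_iff_index_eq)
      qed
      show "(\<lambda>k. h (Q ! k)) ` {k. vis t k} \<subseteq> {u. adjacent C (h t) u}"
        using hadj QV TV t by (auto simp: vis_def)
      have "{u. adjacent C (h t) u} \<subseteq> verts C" using adjacent_verts[OF GC] by blast
      then show "finite {u. adjacent C (h t) u}"
        using GC finite_subset by (auto simp: simple_graph_def)
    qed
    also have "\<dots> \<le> 3" using degree_outside_stable_set[OF C _ nS] h(2) TV t by blast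
    finally show False by simp
  qed
  have top: "\<exists>t \<in> A. card A - 1 \<le> card {s \<in> A. \<tau> s < \<tau> t} \<and> (\<forall>s \<in> A - {t}. \<tau> s < \<tau> t)"
    if A: "A \<subseteq> T" "A \<noteq> {}" for A
  proof -
    have fA: "finite A" using A fT finite_subset by blast
    have "Max (\<tau> ` A) \<in> \<tau> ` A" using fA A by (intro Max_in) auto
    then obtain t where t: "t \<in> A" "Max (\<tau> ` A) = \<tau> t" by (elim imageE)
    have "\<tau> s < \<tau> t" if s: "s \<in> A - {t}" for s
    proof -
      have "\<tau> s \<le> \<tau> t" unfolding t(2)[symmetric] using s fA by (intro Max_ge) auto
      moreover have "\<tau> s \<noteq> \<tau> t" using inj_onD[OF inj\<tau>, of s t] s t(1) A by auto
      ultimately show ?thesis by simp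
    qed
    moreover from this have "card (A - {t}) \<le> card {s \<in> A. \<tau> s < \<tau> t}"
      using fA by (intro card_mono) auto
    ultimately show ?thesis using t(1) fA by (intro bexI[of _ t]) auto
  qed
  define A where "A = {t \<in> T. h t \<notin> S}"
  have A4: "card A \<le> 4"
  proof (rule ccontr)
    assume big: "\<not> card A \<le> 4"
    then have "A \<noteq> {}" by auto
    then obtain t where t: "t \<in> A" "card A - 1 \<le> card {s \<in> A. \<tau> s < \<tau> t}"
      using top[of A] by (auto simp: A_def)
    have "card {s \<in> A. \<tau> s < \<tau> t} \<le> card {s \<in> T. \<tau> s < \<tau> t}"
      using fT by (intro card_mono) (auto simp: A_def)
    then have "4 \<le> card {s \<in> T. \<tau> s < \<tau> t}" using t(2) big by linarith
    then show False using high[of t] t(1) by (auto simp: A_def)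
  qed
  have "T \<noteq> {}" using cardT by auto
  then obtain z where z: "z \<in> T" "card T - 1 \<le> card {s \<in> T. \<tau> s < \<tau> z}"
    and zmax: "\<And>s. s \<in> T - {z} \<Longrightarrow> \<tau> s < \<tau> z"
    using top[of T] by blast
  have zS: "h z \<in> S" using high[OF z(1)] z(2) cardT by simp
  define B where "B = h ` {t \<in> T. h t \<in> S}"
  have injT: "inj_on h T" using h(1) TV inj_on_subset by blast
  have cardB: "2 * q + 2 \<le> card B"
  proof -
    have "card B = card {t \<in> T. h t \<in> S}"
      unfolding B_def by (rule card_image) (rule inj_on_subset[OF injT], auto)
    moreover have "T = A \<union> {t \<in> T. h t \<in> S}" by (auto simp: A_def)
    then have "card T \<le> card A + card {t \<in> T. h t \<in> S}" by (metis card_Un_le)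
    ultimately show ?thesis using A4 cardT by linarith
  qed
  obtain \<rho> where inj: "inj_on \<rho> S" and cr: "crossing q C S \<rho>"
    using zigzagged_crossing[OF q C(1) zz] by blast
  let ?Q = "map h Q"
  have "set Q \<subseteq> verts D" using Q(1) by (simp add: path_in_def)
  then have "set ?Q \<subseteq> verts C" using h(2) by (simp only: set_map) blast
  then have pathQ: "path_in C ?Q"
    using Q(1) hadj QV inj_on_subset[OF h(1), of "set Q"]
    by (auto simp: path_in_iff[OF GC] path_in_iff[OF GD] distinct_map)
  have BQ: "B \<inter> set ?Q = {}"
  proof -
    have "h t \<noteq> h v" if "t \<in> T" "v \<in> set Q" for t v
    proof
      assume "h t = h v"
      moreover have "v \<in> verts D" using that Q(1) by (auto simp: path_in_def)
      ultimately have "t = v" using inj_onD[OF h(1)] that TV by blast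
      then show False using that Q(2) by blast
    qed
    then show ?thesis by (auto simp: B_def)
  qed
  have BS: "B \<subseteq> S" "h z \<in> B" using z zS by (auto simp: B_def)
  have visC: "adjacent C (h t) (?Q ! k) \<longleftrightarrow> vis t k" if "t \<in> T" "k < length Q" for t k
    using hadj[of t "Q ! k"] that QV TV by (auto simp: vis_def)
  have occC: "\<exists>k < length ?Q. adjacent C b (?Q ! k)" if b: "b \<in> B" for b
  proof -
    obtain t where t: "t \<in> T" "b = h t" using b by (auto simp: B_def)
    then obtain k where "k < length Q" "vis t k" using occ by (auto simp: vis_def)
    then show ?thesis using visC t by auto
  qed
  have sepC: "\<exists>k. i < k \<and> k < j \<and> adjacent C (h z) (?Q ! k)"
    if b: "b \<in> B - {h z}" "b' \<in> B - {h z}" "b \<noteq> b'" and ij: "i < j" "j < length ?Q"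
      "adjacent C b (?Q ! i)" "adjacent C b' (?Q ! j)" for b b' i j
  proof -
    obtain t t' where t: "t \<in> T" "t' \<in> T" "b = h t" "b' = h t'" using b by (auto simp: B_def)
    then have "t \<in> T - {z}" "t' \<in> T - {z}" "t \<noteq> t'" using b by auto
    moreover have "vis t i" "vis t' j" using visC ij t by auto
    ultimately obtain k where "i < k" "k < j" "vis z k"
      using sepD[OF t(1,2) z(1)] zmax ij(1) by blast
    then show ?thesis using visC[OF z(1), of k] ij(2) by (intro exI[of _ k]) auto
  qed
  have "card {b \<in> B. \<rho> b < \<rho> (h z)} \<le> q"
    by (rule letters_below_separator[OF q C inj cr pathQ BS(1,2) BQ]) (fact occC, fact sepC)
  moreover have "card {b \<in> B. - \<rho> b < - \<rho> (h z)} \<le> q"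
  proof (rule letters_below_separator[OF q C _ crossing_reverse[OF cr] pathQ BS(1,2) BQ])
    show "inj_on (\<lambda>s. - \<rho> s) S" using inj by (auto simp: inj_on_def)
  qed (fact occC, fact sepC)
  moreover have "B = insert (h z) ({b \<in> B. \<rho> b < \<rho> (h z)} \<union> {b \<in> B. - \<rho> b < - \<rho> (h z)})"
  proof -
    have "b = h z" if "b \<in> B" "\<rho> b = \<rho> (h z)" for b
      using inj_onD[OF inj that(2)] that(1) BS by blast
    then show ?thesis using BS(2) by force
  qed
  then have "card B = card (insert (h z) ({b \<in> B. \<rho> b < \<rho> (h z)} \<union> {b \<in> B. - \<rho> b < - \<rho> (h z)}))"
    by (rule arg_cong)
  moreover have "card (insert x Y) \<le> Suc (card Y)" for x :: 'a and Y
    by (cases "finite Y") (simp_all add: card_insert_if)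
  then have "card (insert (h z) ({b \<in> B. \<rho> b < \<rho> (h z)} \<union> {b \<in> B. - \<rho> b < - \<rho> (h z)})) \<le>
      Suc (card ({b \<in> B. \<rho> b < \<rho> (h z)} \<union> {b \<in> B. - \<rho> b < - \<rho> (h z)}))" .
  ultimately show False
    using cardB card_Un_le[of "{b \<in> B. \<rho> b < \<rho> (h z)}" "{b \<in> B. - \<rho> b < - \<rho> (h z)}"] by linarith
qed

section \<open>Bags of bounded size\<close>

text \<open>A sequence of bags such that every connected subset of \<open>X\<close> meets exactly the bags of an
  interval. This is weaker than a path decomposition: a connected set may miss all bags, and
  adjacent vertices need not share a bag.\<close>

definition linear_bags :: "'a graph \<Rightarrow> 'a set \<Rightarrow> (nat \<Rightarrow> 'a set) \<Rightarrow> bool" where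
  "linear_bags G X bag \<longleftrightarrow> (\<forall>A i k j. conn G A \<longrightarrow> A \<subseteq> X \<longrightarrow> i \<le> k \<longrightarrow> k \<le> j \<longrightarrow>
     bag i \<inter> A \<noteq> {} \<longrightarrow> bag j \<inter> A \<noteq> {} \<longrightarrow> bag k \<inter> A \<noteq> {})"

lemma linear_bagsD:
  assumes "linear_bags G X bag" "conn G A" "A \<subseteq> X" "i \<le> k" "k \<le> j"
    "bag i \<inter> A \<noteq> {}" "bag j \<inter> A \<noteq> {}"
  shows "bag k \<inter> A \<noteq> {}"
  using assms unfolding linear_bags_def by simp

text \<open>Three connected sets any two of which are joined by a connected set avoiding the third
  cannot be laid out linearly: some bag chosen for one of them also meets the connection of the
  other two.\<close>

lemma asteroidal_triple_bags:
  assumes bags: "linear_bags G X bag"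
    and Z: "conn G Z1" "conn G Z2" "conn G Z3" "Z1 \<subseteq> X" "Z2 \<subseteq> X" "Z3 \<subseteq> X"
    and A: "A1 \<subseteq> Z2 \<inter> Z3" "A2 \<subseteq> Z1 \<inter> Z3" "A3 \<subseteq> Z1 \<inter> Z2"
    and t: "bag t1 \<inter> A1 \<noteq> {}" "bag t2 \<inter> A2 \<noteq> {}" "bag t3 \<inter> A3 \<noteq> {}"
  shows "bag t1 \<inter> Z1 \<noteq> {} \<or> bag t2 \<inter> Z2 \<noteq> {} \<or> bag t3 \<inter> Z3 \<noteq> {}"
proof -
  have m: "bag t2 \<inter> Z1 \<noteq> {}" "bag t3 \<inter> Z1 \<noteq> {}" "bag t1 \<inter> Z2 \<noteq> {}" "bag t3 \<inter> Z2 \<noteq> {}"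
    "bag t1 \<inter> Z3 \<noteq> {}" "bag t2 \<inter> Z3 \<noteq> {}"
    using A t by blast+
  consider "t2 \<le> t1 \<and> t1 \<le> t3" | "t3 \<le> t1 \<and> t1 \<le> t2" | "t1 \<le> t2 \<and> t2 \<le> t3"
    | "t3 \<le> t2 \<and> t2 \<le> t1" | "t1 \<le> t3 \<and> t3 \<le> t2" | "t2 \<le> t3 \<and> t3 \<le> t1"
    by linarith
  then show ?thesis
  proof cases
    case 1 then show ?thesis using linear_bagsD[OF bags Z(1,4), of t2 t1 t3] m by simp
  next
    case 2 then show ?thesis using linear_bagsD[OF bags Z(1,4), of t3 t1 t2] m by simp
  next
    case 3 then show ?thesis using linear_bagsD[OF bags Z(2,5), of t1 t2 t3] m by simp
  next
    case 4 then show ?thesis using linear_bagsD[OF bags Z(2,5), of t3 t2 t1] m by simp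
  next
    case 5 then show ?thesis using linear_bagsD[OF bags Z(3,6), of t1 t3 t2] m by simp
  next
    case 6 then show ?thesis using linear_bagsD[OF bags Z(3,6), of t2 t3 t1] m by simp
  qed
qed

lemma linear_bags_induced_path:
  assumes G: "simple_graph G" and p: "path_in G p"
  shows "linear_bags G (set p) (\<lambda>i. if i < length p then {p ! i} else {})"
  unfolding linear_bags_def
proof (intro allI impI)
  fix A i k j
  assume A: "conn G A" "A \<subseteq> set p" "i \<le> k" "k \<le> j"
    and "(if i < length p then {p ! i} else {}) \<inter> A \<noteq> {}"
    and "(if j < length p then {p ! j} else {}) \<inter> A \<noteq> {}"
  then have ij: "i < length p" "j < length p" "p ! i \<in> A" "p ! j \<in> A"
    by (auto split: if_splits)
  have dp: "distinct p" and adj: "\<And>i j. i < length p \<Longrightarrow> j < length p \<Longrightarrow>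
      adjacent G (p ! i) (p ! j) \<longleftrightarrow> j = Suc i \<or> i = Suc j"
    using p by (auto simp: path_in_iff[OF G])
  have "p ! k \<in> A"
  proof (rule ccontr)
    assume k: "p ! k \<notin> A"
    have "(p ! i, p ! j) \<in> {(a, b). a \<in> A \<and> b \<in> A \<and> adjacent G a b}\<^sup>*"
      using A(1) ij unfolding conn_def by blast
    then have "\<exists>m < k. p ! j = p ! m"
    proof (induction rule: rtrancl_induct)
      case base
      have "i \<noteq> k" using k ij by auto
      then show ?case using A(3) by (intro exI[of _ i]) simp
    next
      case (step y z)
      then obtain m where m: "m < k" "y = p ! m" by blast
      have z: "z \<in> A" "adjacent G y z" using step by auto
      then obtain n where n: "n < length p" "z = p ! n"
        using A(2) by (auto simp: in_set_conv_nth subset_iff)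
      have "n = Suc m \<or> m = Suc n" using adj[of m n] m n z A ij by auto
      moreover have "n \<noteq> k" using k z n by auto
      ultimately show ?case using m n by (intro exI[of _ n]) auto
    qed
    then obtain m where "m < k" "p ! j = p ! m" by blast
    then show False using dp ij A(4) nth_eq_iff_index_eq[OF dp, of j m] by simp
  qed
  then show "(if k < length p then {p ! k} else {}) \<inter> A \<noteq> {}" using A ij by simp
qed

text \<open>In a connected set avoiding \<open>S\<close> there is no asteroidal triple, as such a set lies on a
  path.\<close>

lemma asteroidal_triple_meets_stable_set:
  assumes C: "constellation C S"
    and Y: "conn C Y"
    and Z: "conn C Z1" "conn C Z2" "conn C Z3" "Z1 \<subseteq> Y" "Z2 \<subseteq> Y" "Z3 \<subseteq> Y"
    and A: "A1 \<subseteq> Z2 \<inter> Z3" "A2 \<subseteq> Z1 \<inter> Z3" "A3 \<subseteq> Z1 \<inter> Z2" "A1 \<noteq> {}" "A2 \<noteq> {}" "A3 \<noteq> {}"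
    and disj: "A1 \<inter> Z1 = {}" "A2 \<inter> Z2 = {}" "A3 \<inter> Z3 = {}"
  shows "Y \<inter> S \<noteq> {}"
proof
  assume "Y \<inter> S = {}"
  have G: "simple_graph C" using C by (simp add: constellation_def)
  obtain L where "L \<in> path_comps C S" "Y \<subseteq> verts L"
    using conn_in_component[OF G Y \<open>Y \<inter> S = {}\<close>] by blast
  then obtain p where p: "path_in C p" "Y \<subseteq> set p"
    using component_is_induced_path[OF C] by blast
  define bag where "bag = (\<lambda>i. if i < length p then {p ! i} else {})"
  have bags: "linear_bags C (set p) bag"
    unfolding bag_def by (rule linear_bags_induced_path[OF G p(1)])
  have at: "\<exists>t a. bag t = {a} \<and> a \<in> A" if A: "A \<noteq> {}" "A \<subseteq> Y" for A
  proof -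
    obtain a where a: "a \<in> A" using A(1) by blast
    then have "a \<in> set p" using A(2) p(2) by blast
    then obtain t where "t < length p" "a = p ! t" by (metis in_set_conv_nth)
    then show ?thesis using a by (intro exI[of _ t]) (simp add: bag_def)
  qed
  have AY: "A1 \<subseteq> Y" "A2 \<subseteq> Y" "A3 \<subseteq> Y" using A Z by auto
  obtain t1 a1 where t1: "bag t1 = {a1}" "a1 \<in> A1" using at[OF A(4) AY(1)] by blast
  obtain t2 a2 where t2: "bag t2 = {a2}" "a2 \<in> A2" using at[OF A(5) AY(2)] by blast
  obtain t3 a3 where t3: "bag t3 = {a3}" "a3 \<in> A3" using at[OF A(6) AY(3)] by blast
  have "bag t1 \<inter> Z1 \<noteq> {} \<or> bag t2 \<inter> Z2 \<noteq> {} \<or> bag t3 \<inter> Z3 \<noteq> {}"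
    by (rule asteroidal_triple_bags[OF bags Z(1-3) _ _ _ A(1-3)])
      (use Z(4-6) p(2) t1 t2 t3 in auto)
  then show False using t1 t2 t3 disj by auto
qed

lemma ranked_enumeration:
  fixes \<rho> :: "'a \<Rightarrow> int"
  assumes "finite A" "inj_on \<rho> A"
  shows "\<exists>s. bij_betw s {..<card A} A \<and> (\<forall>i j. i < j \<longrightarrow> j < card A \<longrightarrow> \<rho> (s i) < \<rho> (s j))"
proof -
  define xs where "xs = sorted_list_of_set (\<rho> ` A)"
  define s where "s = (\<lambda>i. inv_into A \<rho> (xs ! i))"
  have xs: "distinct xs" "set xs = \<rho> ` A" "sorted_wrt (<) xs"
    using assms(1) by (auto simp: xs_def)
  have len: "length xs = card A"
    using xs(1,2) assms(2) by (metis card_image distinct_card)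
  have \<rho>s: "\<rho> (s i) = xs ! i" if "i < card A" for i
  proof -
    have "xs ! i \<in> \<rho> ` A" using that len xs(2) nth_mem by metis
    then show ?thesis by (simp add: s_def f_inv_into_f)
  qed
  have "bij_betw ((!) xs) {..<card A} (\<rho> ` A)"
    using bij_betw_nth[OF xs(1)] len xs(2) by simp
  moreover have "bij_betw (inv_into A \<rho>) (\<rho> ` A) A"
    using assms(2) by (intro bij_betw_inv_into inj_on_imp_bij_betw)
  ultimately have "bij_betw s {..<card A} A"
    using bij_betw_trans by (fastforce simp: s_def comp_def)
  moreover have "\<rho> (s i) < \<rho> (s j)" if "i < j" "j < card A" for i j
    using \<rho>s that sorted_wrt_nth_less[OF xs(3)] len by simp
  ultimately show ?thesis by blast
qed

text \<open>The bags are the closed neighborhoods within \<open>X\<close> of the windows of \<open>q\<close> consecutive elements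
  of \<open>S \<inter> X\<close>. A connected set that meets two bags but misses one in between becomes, with one element
  of each of the two outer windows added, a connected set contradicting the crossing property.\<close>

lemma window_bags:
  fixes \<rho> :: "'a \<Rightarrow> int"
  assumes q: "q \<ge> 1" and C: "constellation C S"
    and inj: "inj_on \<rho> S" and cr: "crossing q C S \<rho>"
    and X: "X \<subseteq> verts C"
    and deg: "\<And>s. s \<in> S \<inter> X \<Longrightarrow> card {x \<in> X. adjacent C s x} \<le> d"
  shows "\<exists>bag N. linear_bags C X bag \<and> (\<forall>i. finite (bag i) \<and> card (bag i) \<le> (d + 1) * q) \<and>
    (\<forall>A. A \<subseteq> X \<longrightarrow> A \<inter> S \<noteq> {} \<longrightarrow> (\<exists>i. bag i \<inter> A \<noteq> {})) \<and> (\<forall>i > N. bag i = {})"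
proof -
  have G: "simple_graph C" using C by (simp add: constellation_def)
  have SV: "S \<subseteq> verts C" using C by (auto simp: constellation_def stable_set_def)
  have fC: "finite (verts C)" using G by (simp add: simple_graph_def)
  have fX: "finite X" using X fC finite_subset by blast
  define n where "n = card (S \<inter> X)"
  have "finite (S \<inter> X)" using fX by blast
  moreover have "inj_on \<rho> (S \<inter> X)" using inj inj_on_subset by blast
  ultimately obtain s where bij: "bij_betw s {..<n} (S \<inter> X)"
    and mono: "\<And>i j. i < j \<Longrightarrow> j < n \<Longrightarrow> \<rho> (s i) < \<rho> (s j)"
    using ranked_enumeration[of "S \<inter> X" \<rho>] unfolding n_def by blast
  have sX: "s i \<in> S \<inter> X" if "i < n" for i using bij that bij_betw_apply by fastforce
  define win where "win = (\<lambda>i. s ` {k. i \<le> k \<and> k < i + q \<and> k < n})"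
  \<comment> \<open>If \<open>S \<inter> X\<close> has fewer than \<open>q\<close> elements, then \<open>n - q = 0\<close> and the only window is all of it.\<close>
  define bag where "bag = (\<lambda>i. if i \<le> n - q
    then win i \<union> {x \<in> X. \<exists>w \<in> win i. adjacent C w x} else {})"
  have winSX: "win i \<subseteq> S \<inter> X" for i using sX by (auto simp: win_def)
  have fwin: "finite (win i)" for i
    using winSX fX finite_subset[of "win i" "S \<inter> X"] by blast
  have cardwin: "card (win i) \<le> q" for i
  proof -
    have "card (win i) \<le> card {k. i \<le> k \<and> k < i + q \<and> k < n}"
      unfolding win_def by (rule card_image_le) simp
    also have "\<dots> \<le> card {i..<i + q}" by (rule card_mono) auto
    finally show ?thesis by simp
  qed
  have full: "card (win i) = q" if "i \<le> n - q" "q \<le> n" for i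
  proof -
    have "{k. i \<le> k \<and> k < i + q \<and> k < n} = {i..<i + q}" using that by auto
    moreover have "inj_on s {i..<i + q}"
      by (rule inj_on_subset[of s "{..<n}"]) (use bij that in \<open>auto simp: bij_betw_def\<close>)
    ultimately show ?thesis by (simp add: win_def card_image)
  qed
  have fbag: "finite (bag i)" for i using fwin fX by (simp add: bag_def)
  have cardbag: "card (bag i) \<le> (d + 1) * q" for i
  proof (cases "i \<le> n - q")
    case True
    have "{x \<in> X. \<exists>w \<in> win i. adjacent C w x} = (\<Union>w \<in> win i. {x \<in> X. adjacent C w x})" by auto
    then have "card {x \<in> X. \<exists>w \<in> win i. adjacent C w x} \<le>
        (\<Sum>w \<in> win i. card {x \<in> X. adjacent C w x})"
      using card_UN_le[OF fwin] by metis
    also have "\<dots> \<le> card (win i) * d"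
      using deg winSX[of i] sum_bounded_above[of "win i" "\<lambda>w. card {x \<in> X. adjacent C w x}" d]
      by (simp add: subset_iff)
    finally have "card (bag i) \<le> card (win i) + card (win i) * d"
      using True card_Un_le[of "win i" "{x \<in> X. \<exists>w \<in> win i. adjacent C w x}"]
      by (simp add: bag_def)
    also have "\<dots> = (d + 1) * card (win i)" by simp
    also have "\<dots> \<le> (d + 1) * q" using cardwin by (intro mult_le_mono2)
    finally show ?thesis .
  qed (simp add: bag_def)
  have touch: "\<exists>w \<in> win i. w \<in> A \<or> (\<exists>a \<in> A. adjacent C w a)" if "bag i \<inter> A \<noteq> {}" for A i
    using that by (auto simp: bag_def split: if_splits)
  have hit: "bag i \<inter> A \<noteq> {}"
    if "i \<le> n - q" "w \<in> win i" "A \<subseteq> X" "w \<in> A \<or> (\<exists>a \<in> A. adjacent C w a)" for A i w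
    using that by (auto simp: bag_def)
  have "linear_bags C X bag"
    unfolding linear_bags_def
  proof (intro allI impI)
    fix A i k j
    assume A: "conn C A" "A \<subseteq> X" and ikj: "i \<le> k" "k \<le> j"
      and ij: "bag i \<inter> A \<noteq> {}" "bag j \<inter> A \<noteq> {}"
    have le: "i \<le> n - q" "j \<le> n - q" using ij by (auto simp: bag_def split: if_splits)
    show "bag k \<inter> A \<noteq> {}"
    proof (cases "i = k \<or> k = j")
      case True then show ?thesis using ij by auto
    next
      case False
      then have strict: "i < k" "k < j" "k \<le> n - q" "q < n" using ikj le by auto
      obtain u where u: "u \<in> win i" "u \<in> A \<or> (\<exists>a \<in> A. adjacent C u a)"
        using touch[OF ij(1)] by blast
      obtain v where v: "v \<in> win j" "v \<in> A \<or> (\<exists>a \<in> A. adjacent C v a)"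
        using touch[OF ij(2)] by blast
      obtain iu where iu: "u = s iu" "i \<le> iu" "iu < i + q" "iu < n" using u by (auto simp: win_def)
      obtain iv where iv: "v = s iv" "j \<le> iv" "iv < j + q" "iv < n" using v by (auto simp: win_def)
      show ?thesis
      proof (rule ccontr)
        assume none: "\<not> ?thesis"
        have nohit: "\<not> (w \<in> A \<or> (\<exists>a \<in> A. adjacent C w a))" if "w \<in> win k" for w
          using hit[OF strict(3) that A(2)] none by blast
        have "u \<notin> win k" "v \<notin> win k" using nohit u v by blast+
        then have lt: "iu < k" "k + q \<le> iv" using iu iv strict by (auto simp: win_def)
        have add: "conn C (insert x A')" if "conn C A'" "x \<in> S" "x \<in> A' \<or> (\<exists>a \<in> A'. adjacent C x a)"
          for x A'
          using that SV conn_insert[of C A' x] by (auto simp: insert_absorb)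
        have uv: "u \<in> S \<inter> X" "v \<in> S \<inter> X" using u v winSX by blast+
        have "conn C (insert u A)" using add[OF A(1)] uv u by blast
        then have conn: "conn C (insert v (insert u A))" using add uv v by blast
        have winW: "\<rho> (s a) < \<rho> w" if "w \<in> win k" "a < k" for w a
          using that mono by (auto simp: win_def)
        have Wwin: "\<rho> w < \<rho> (s a)" if "w \<in> win k" "k + q \<le> a" "a < n" for w a
          using that mono by (auto simp: win_def)
        obtain w a where w: "w \<in> win k" and a: "a \<in> insert v (insert u A)" "adjacent C w a"
        proof (rule crossing_neighbor[OF cr conn])
          show "win k \<subseteq> S" using winSX by blast
          show "q \<le> card (win k)" using full strict by simp
          show "u \<in> insert v (insert u A)" "v \<in> insert v (insert u A)" by auto
          show "u \<in> S" "v \<in> S" using uv by auto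
          show "\<forall>w \<in> win k. \<rho> u < \<rho> w" using winW lt iu by blast
          show "\<forall>w \<in> win k. \<rho> w < \<rho> v" using Wwin lt iv by blast
          fix x assume x: "x \<in> insert v (insert u A)" "x \<in> S"
          then have "x \<in> S \<inter> X" using uv A by auto
          then obtain ix where ix: "ix < n" "x = s ix"
            using bij unfolding bij_betw_def by blast
          have "x \<notin> win k" using x(1) nohit \<open>u \<notin> win k\<close> \<open>v \<notin> win k\<close> by blast
          then have "ix < k \<or> k + q \<le> ix" using ix by (auto simp: win_def)
          then show "(\<forall>w \<in> win k. \<rho> x < \<rho> w) \<or> (\<forall>w \<in> win k. \<rho> w < \<rho> x)"
            using winW Wwin ix by blast
        qed
        have "w \<in> S" using w winSX by blast
        then have "a \<noteq> u" "a \<noteq> v"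
          using C uv a(2) by (auto simp: constellation_def stable_set_def)
        then show False using nohit[OF w] a by blast
      qed
    qed
  qed
  moreover have "\<exists>i. bag i \<inter> A \<noteq> {}" if A: "A \<subseteq> X" "A \<inter> S \<noteq> {}" for A
  proof -
    obtain x where x: "x \<in> A" "x \<in> S \<inter> X" using A by blast
    then obtain m where m: "m < n" "x = s m" using bij unfolding bij_betw_def by blast
    have "x \<in> win (min m (n - q))"
      unfolding win_def m(2) using m(1) q by (intro imageI) auto
    then have "bag (min m (n - q)) \<inter> A \<noteq> {}" using hit[of "min m (n - q)" x A] x(1) A(1) by simp
    then show ?thesis by blast
  qed
  moreover have "bag i = {}" if "i > n - q" for i using that by (simp add: bag_def)
  ultimately show ?thesis
    using fbag cardbag 
    by (rule_tac exI[of _ bag], rule_tac exI[of _ "n - q"]) simp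
qed

section \<open>Edge models\<close>

text \<open>An edge model of \<open>H\<close> in \<open>C\<close> represents the edges of \<open>H\<close> by connected subsets of \<open>X\<close>:
  edges with a common end are represented by sets with connected union, and edges without a common
  end by disjoint sets. Both a subdivision of \<open>H\<close> and its line graph carry such a model.\<close>

definition edge_model :: "'a graph \<Rightarrow> 'a set \<Rightarrow> 'v graph \<Rightarrow> ('v set \<Rightarrow> 'a set) \<Rightarrow> bool" where
  "edge_model C X H \<Phi> \<longleftrightarrow> (\<forall>e \<in> edges H. conn C (\<Phi> e) \<and> \<Phi> e \<subseteq> X) \<and>
     (\<forall>e \<in> edges H. \<forall>f \<in> edges H. if e \<inter> f = {} then \<Phi> e \<inter> \<Phi> f = {} else conn C (\<Phi> e \<union> \<Phi> f))"

text \<open>The vertex set that represents an edge set.\<close>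

abbreviation support :: "('v set \<Rightarrow> 'a set) \<Rightarrow> 'v set set \<Rightarrow> 'a set" where
  "support \<Phi> F \<equiv> (\<Union>e \<in> F. \<Phi> e)"

lemma adjacent_line_graph:
  "adjacent (line_graph H) e f \<longleftrightarrow> e \<in> edges H \<and> f \<in> edges H \<and> e \<noteq> f \<and> e \<inter> f \<noteq> {}"
  unfolding adjacent_def line_graph_def by (auto simp: doubleton_eq_iff Int_commute)

lemma support_conn:
  assumes "edge_model C X H \<Phi>" "conn (line_graph H) F"
  shows "conn C (support \<Phi> F)" "support \<Phi> F \<subseteq> X"
proof -
  have F: "F \<subseteq> edges H" using assms(2) by (simp add: conn_def line_graph_def)
  then show "support \<Phi> F \<subseteq> X" using assms(1) by (auto simp: edge_model_def)
  show "conn C (support \<Phi> F)"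
  proof (rule conn_UN[OF assms(2)])
    show "conn C (\<Phi> e)" if "e \<in> F" for e using assms(1) F that by (auto simp: edge_model_def)
    show "conn C (\<Phi> e \<union> \<Phi> f)" if "e \<in> F" "f \<in> F" "adjacent (line_graph H) e f" for e f
      using assms(1) that unfolding edge_model_def adjacent_line_graph by (metis (lifting))
  qed
qed

lemma support_disjoint:
  assumes "edge_model C X H \<Phi>" "E \<subseteq> edges H" "F \<subseteq> edges H"
    and "\<And>e f. e \<in> E \<Longrightarrow> f \<in> F \<Longrightarrow> e \<inter> f = {}"
  shows "support \<Phi> E \<inter> support \<Phi> F = {}"
proof -
  have "\<Phi> e \<inter> \<Phi> f = {}" if "e \<in> E" "f \<in> F" for e f
    using assms(1) assms(2,3) assms(4)[OF that] that unfolding edge_model_def by (metis subsetD)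
  then show ?thesis by auto
qed

text \<open>Three edge sets within \<open>F\<close>, any two of which are joined by a connected edge set vertex-disjoint
  from the third.\<close>

definition asteroidal :: "'v graph \<Rightarrow> 'v set set \<Rightarrow> 'v set set \<Rightarrow> 'v set set \<Rightarrow> 'v set set \<Rightarrow>
    'v set set \<Rightarrow> 'v set set \<Rightarrow> 'v set set \<Rightarrow> bool" where
  "asteroidal H F E1 E2 E3 Z1 Z2 Z3 \<longleftrightarrow> conn (line_graph H) F \<and>
     (conn (line_graph H) Z1 \<and> conn (line_graph H) Z2 \<and> conn (line_graph H) Z3) \<and>
     (Z1 \<subseteq> F \<and> Z2 \<subseteq> F \<and> Z3 \<subseteq> F) \<and> (E1 \<noteq> {} \<and> E2 \<noteq> {} \<and> E3 \<noteq> {}) \<and>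
     (E1 \<subseteq> Z2 \<inter> Z3 \<and> E2 \<subseteq> Z1 \<inter> Z3 \<and> E3 \<subseteq> Z1 \<inter> Z2) \<and>
     ((\<forall>e \<in> E1. \<forall>f \<in> Z1. e \<inter> f = {}) \<and> (\<forall>e \<in> E2. \<forall>f \<in> Z2. e \<inter> f = {}) \<and>
      (\<forall>e \<in> E3. \<forall>f \<in> Z3. e \<inter> f = {}))"

lemma asteroidal_support:
  assumes M: "edge_model C X H \<Phi>" and T: "asteroidal H F E1 E2 E3 Z1 Z2 Z3"
  shows "support \<Phi> E1 \<inter> support \<Phi> Z1 = {}" "support \<Phi> E2 \<inter> support \<Phi> Z2 = {}"
    "support \<Phi> E3 \<inter> support \<Phi> Z3 = {}"
    "support \<Phi> E1 \<subseteq> support \<Phi> Z2 \<inter> support \<Phi> Z3" "support \<Phi> E2 \<subseteq> support \<Phi> Z1 \<inter> support \<Phi> Z3"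
    "support \<Phi> E3 \<subseteq> support \<Phi> Z1 \<inter> support \<Phi> Z2"
    "support \<Phi> E1 \<noteq> {}" "support \<Phi> E2 \<noteq> {}" "support \<Phi> E3 \<noteq> {}"
    "support \<Phi> Z1 \<subseteq> support \<Phi> F" "support \<Phi> Z2 \<subseteq> support \<Phi> F" "support \<Phi> Z3 \<subseteq> support \<Phi> F"
proof -
  have Z: "Z1 \<subseteq> F" "Z2 \<subseteq> F" "Z3 \<subseteq> F" and E: "E1 \<subseteq> Z2 \<inter> Z3" "E2 \<subseteq> Z1 \<inter> Z3" "E3 \<subseteq> Z1 \<inter> Z2"
    and ne: "E1 \<noteq> {}" "E2 \<noteq> {}" "E3 \<noteq> {}" and F: "F \<subseteq> edges H"
    and dis: "\<And>e f. e \<in> E1 \<Longrightarrow> f \<in> Z1 \<Longrightarrow> e \<inter> f = {}" "\<And>e f. e \<in> E2 \<Longrightarrow> f \<in> Z2 \<Longrightarrow> e \<inter> f = {}"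
      "\<And>e f. e \<in> E3 \<Longrightarrow> f \<in> Z3 \<Longrightarrow> e \<inter> f = {}"
    using T by (auto simp: asteroidal_def conn_def line_graph_def)
  have EF: "E1 \<subseteq> F" "E2 \<subseteq> F" "E3 \<subseteq> F" using E Z by blast+
  have H: "E \<subseteq> edges H" if "E \<subseteq> F" for E using that F by (rule subset_trans)
  show "support \<Phi> E1 \<inter> support \<Phi> Z1 = {}"
    by (rule support_disjoint[OF M H[OF EF(1)] H[OF Z(1)] dis(1)])
  show "support \<Phi> E2 \<inter> support \<Phi> Z2 = {}"
    by (rule support_disjoint[OF M H[OF EF(2)] H[OF Z(2)] dis(2)])
  show "support \<Phi> E3 \<inter> support \<Phi> Z3 = {}"
    by (rule support_disjoint[OF M H[OF EF(3)] H[OF Z(3)] dis(3)])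
  show "support \<Phi> E1 \<subseteq> support \<Phi> Z2 \<inter> support \<Phi> Z3" "support \<Phi> E2 \<subseteq> support \<Phi> Z1 \<inter> support \<Phi> Z3"
    "support \<Phi> E3 \<subseteq> support \<Phi> Z1 \<inter> support \<Phi> Z2"
    using E by blast+
  have "support \<Phi> E \<noteq> {}" if E: "E \<noteq> {}" "E \<subseteq> F" for E
  proof -
    obtain e where e: "e \<in> E" using E(1) by blast
    then have "e \<in> edges H" using H[OF E(2)] by blast
    then have "\<Phi> e \<noteq> {}" using M by (simp add: edge_model_def conn_def)
    then show ?thesis using e by blast
  qed
  then show "support \<Phi> E1 \<noteq> {}" "support \<Phi> E2 \<noteq> {}" "support \<Phi> E3 \<noteq> {}"
    using ne EF by simp_all
  show "support \<Phi> Z1 \<subseteq> support \<Phi> F" "support \<Phi> Z2 \<subseteq> support \<Phi> F" "support \<Phi> Z3 \<subseteq> support \<Phi> F"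
    using Z by blast+
qed

lemma asteroidal_meets_stable_set:
  assumes C: "constellation C S" and M: "edge_model C X H \<Phi>"
    and T: "asteroidal H F E1 E2 E3 Z1 Z2 Z3"
  shows "support \<Phi> F \<inter> S \<noteq> {}"
proof (rule asteroidal_triple_meets_stable_set[OF C])
  show "conn C (support \<Phi> F)" "conn C (support \<Phi> Z1)" "conn C (support \<Phi> Z2)"
    "conn C (support \<Phi> Z3)"
    using T by (auto simp: asteroidal_def intro: support_conn[OF M])
qed (fact asteroidal_support[OF M T])+

section \<open>Binary trees\<close>

text \<open>The edges of the full subtree of depth \<open>d\<close> rooted at \<open>xs\<close>.\<close>

fun subtree :: "nat \<Rightarrow> bool list \<Rightarrow> bool list set set" where
  "subtree 0 xs = {}"
| "subtree (Suc d) xs = (\<Union>x. insert {xs, x # xs} (subtree d (x # xs)))"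

lemma binary_tree_edge: "length xs < r \<Longrightarrow> {xs, x # xs} \<in> edges (binary_tree r)"
  unfolding binary_tree_def by auto

lemma subtree_verts: "e \<in> subtree d xs \<Longrightarrow> v \<in> e \<Longrightarrow> \<exists>ys. v = ys @ xs"
proof (induction d arbitrary: xs)
  case (Suc d)
  then obtain x where "e = {xs, x # xs} \<or> e \<in> subtree d (x # xs)" by auto
  then show ?case
  proof
    assume "e = {xs, x # xs}"
    then show ?thesis using Suc.prems(2) by (auto intro: exI[of _ "[]"] exI[of _ "[x]"])
  next
    assume "e \<in> subtree d (x # xs)"
    then obtain ys where "v = ys @ x # xs" using Suc by blast
    then show ?thesis by (intro exI[of _ "ys @ [x]"]) simp
  qed
qed simp

lemma conn_edge: "e \<in> edges H \<Longrightarrow> conn (line_graph H) {e}"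
  by (rule conn_singleton) (simp add: line_graph_def)

lemma conn_edges_insert:
  assumes "conn (line_graph H) F" "e \<in> edges H" "f \<in> F" "v \<in> e" "v \<in> f"
  shows "conn (line_graph H) (insert e F)"
proof (cases "e \<in> F")
  case True
  then show ?thesis using assms by (simp add: insert_absorb)
next
  case False
  have "f \<in> edges H" using assms by (auto simp: conn_def line_graph_def)
  then have "adjacent (line_graph H) e f" using assms False by (auto simp: adjacent_line_graph)
  then show ?thesis using assms by (intro conn_insert) (auto simp: line_graph_def)
qed

lemma conn_edges_Un:
  assumes "conn (line_graph H) E" "conn (line_graph H) F" "e \<in> E" "f \<in> F" "v \<in> e" "v \<in> f"
  shows "conn (line_graph H) (E \<union> F)"
proof (rule conn_Un[OF assms(1,2)])
  have "e \<in> edges H" "f \<in> edges H" using assms by (auto simp: conn_def line_graph_def)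
  then show "E \<inter> F \<noteq> {} \<or> (\<exists>a \<in> E. \<exists>b \<in> F. adjacent (line_graph H) a b)"
    using assms by (cases "e = f") (auto simp: adjacent_line_graph)
qed

lemma conn_branch_if:
  assumes "length xs < r" "d \<ge> 1 \<Longrightarrow> conn (line_graph (binary_tree r)) (subtree d (x # xs))"
  shows "conn (line_graph (binary_tree r)) (insert {xs, x # xs} (subtree d (x # xs)))"
proof (cases d)
  case 0
  then show ?thesis using conn_edge[OF binary_tree_edge[OF assms(1)], of x] by simp
next
  case (Suc d')
  then have "conn (line_graph (binary_tree r)) (subtree d (x # xs))" using assms by simp
  then show ?thesis
    by (rule conn_edges_insert[of _ _ _ "{x # xs, True # x # xs}" "x # xs"])
      (use binary_tree_edge[OF assms(1)] Suc in auto)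
qed

lemma subtree_conn:
  "length xs + d \<le> r \<Longrightarrow> d \<ge> 1 \<Longrightarrow> conn (line_graph (binary_tree r)) (subtree d xs)"
proof (induction d arbitrary: xs)
  case (Suc d)
  have br: "conn (line_graph (binary_tree r)) (insert {xs, x # xs} (subtree d (x # xs)))" for x
    using Suc.prems by (intro conn_branch_if Suc.IH) auto
  have "conn (line_graph (binary_tree r)) (insert {xs, True # xs} (subtree d (True # xs)) \<union>
      insert {xs, False # xs} (subtree d (False # xs)))"
    by (rule conn_edges_Un[OF br br, of "{xs, True # xs}" _ "{xs, False # xs}" _ xs]) auto
  then show ?case by (simp add: UNIV_bool Un_commute)
qed simp

lemma conn_branch:
  assumes "length xs + Suc d \<le> r"
  shows "conn (line_graph (binary_tree r)) (insert {xs, x # xs} (subtree d (x # xs)))"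
  using assms by (intro conn_branch_if subtree_conn) auto

text \<open>Three of the four subtrees rooted two levels below \<open>xs\<close> form an asteroidal triple.\<close>

lemma subtree_asteroidal:
  assumes r: "length xs + Suc (Suc d) \<le> r" and d: "d \<ge> 1"
  shows "\<exists>Z1 Z2 Z3. asteroidal (binary_tree r) (subtree (Suc (Suc d)) xs)
    (subtree d (True # True # xs)) (subtree d (False # True # xs)) (subtree d (True # False # xs))
    Z1 Z2 Z3"
proof -
  let ?H = "binary_tree r"
  define br where "br = (\<lambda>y x. insert {x # xs, y # x # xs} (subtree d (y # x # xs)))"
  define down where "down = (\<lambda>y x. insert {xs, x # xs} (br y x))"
  have br: "conn (line_graph ?H) (br y x)" for y x
    unfolding br_def using r by (intro conn_branch) simp
  have e: "{xs, x # xs} \<in> edges ?H" for x using r by (intro binary_tree_edge) simp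
  have down: "conn (line_graph ?H) (down y x)" for y x
    unfolding down_def
    by (rule conn_edges_insert[OF br e, of "{x # xs, y # x # xs}" _ _ "x # xs"]) (auto simp: br_def)
  have ne: "ys @ y # x # xs \<noteq> xs" "ys @ y # x # xs \<noteq> z # xs" for ys y x z
  proof -
    have "length (ys @ y # x # xs) \<noteq> length xs" "length (ys @ y # x # xs) \<noteq> length (z # xs)" by auto
    then show "ys @ y # x # xs \<noteq> xs" "ys @ y # x # xs \<noteq> z # xs" by metis+
  qed
  have eq: "y = y' \<and> x = x'" if "ys @ y # x # xs = ys' @ y' # x' # xs" for ys ys' y y' x x'
  proof -
    have "(ys @ [y, x]) @ xs = (ys' @ [y', x']) @ xs" using that by simp
    then have "ys @ [y, x] = ys' @ [y', x']" by (simp only: append_same_eq)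
    then show ?thesis by simp
  qed
  have out: "v \<noteq> xs \<and> v \<noteq> z # xs \<and> (\<forall>ys' y' x'. v = ys' @ y' # x' # xs \<longrightarrow> y' = y \<and> x' = x)"
    if ev: "e \<in> subtree d (y # x # xs)" "v \<in> e" for e v z y x
  proof -
    obtain ys where ys: "v = ys @ y # x # xs" using subtree_verts[OF ev] by blast
    show ?thesis
      unfolding ys using ne[of ys y x] eq[of ys y x] by (metis (no_types))
  qed
  have far: "e \<inter> f = {}" if e: "e \<in> subtree d (y # x # xs)" and f: "f \<in> down y' x'"
    and ne: "(y, x) \<noteq> (y', x')" for e f y x y' x'
  proof (rule ccontr)
    assume "e \<inter> f \<noteq> {}"
    then obtain v where v: "v \<in> e" "v \<in> f" by blast
    from f consider "f = {xs, x' # xs}" | "f = {x' # xs, y' # x' # xs}"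
      | "f \<in> subtree d (y' # x' # xs)"
      by (auto simp: down_def br_def)
    then have "v = xs \<or> v = x' # xs \<or> (\<exists>ys. v = ys @ y' # x' # xs)"
    proof cases
      case 2
      then show ?thesis using v by (auto intro: exI[of _ "[]"])
    qed (use v subtree_verts in auto)
    then show False using out[OF e v(1), of x'] ne by blast
  qed
  define Z1 where "Z1 = down False True \<union> down True False"
  define Z2 where "Z2 = down True True \<union> down True False"
  define Z3 where "Z3 = br True True \<union> br False True"
  have "br y x \<subseteq> down y x" for y x by (auto simp: down_def)
  then have far3: "\<forall>e \<in> subtree d (True # False # xs). \<forall>f \<in> Z3. e \<inter> f = {}"
    using far unfolding Z3_def by blast
  have far1: "\<forall>e \<in> subtree d (True # True # xs). \<forall>f \<in> Z1. e \<inter> f = {}"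
    unfolding Z1_def by (intro ballI; elim UnE; erule (1) far; simp)
  have far2: "\<forall>e \<in> subtree d (False # True # xs). \<forall>f \<in> Z2. e \<inter> f = {}"
    unfolding Z2_def by (intro ballI; elim UnE; erule (1) far; simp)
  have Z1: "conn (line_graph ?H) Z1" unfolding Z1_def
    by (rule conn_edges_Un[OF down down, of "{xs, True # xs}" _ _ "{xs, False # xs}" _ _ xs])
      (auto simp: down_def)
  have Z2: "conn (line_graph ?H) Z2" unfolding Z2_def
    by (rule conn_edges_Un[OF down down, of "{xs, True # xs}" _ _ "{xs, False # xs}" _ _ xs])
      (auto simp: down_def)
  have Z3: "conn (line_graph ?H) Z3" unfolding Z3_def
    by (rule conn_edges_Un[OF br br, of "{True # xs, True # True # xs}" _ _
          "{True # xs, False # True # xs}" _ _ "True # xs"]) (auto simp: br_def)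
  have "down y x \<subseteq> subtree (Suc (Suc d)) xs" for y x by (auto simp: down_def br_def)
  moreover have "br y x \<subseteq> subtree (Suc (Suc d)) xs" for y x by (auto simp: br_def)
  ultimately have sub: "Z1 \<subseteq> subtree (Suc (Suc d)) xs" "Z2 \<subseteq> subtree (Suc (Suc d)) xs"
    "Z3 \<subseteq> subtree (Suc (Suc d)) xs"
    unfolding Z1_def Z2_def Z3_def by (intro Un_least; simp)+
  have ne: "subtree d ys \<noteq> {}" for ys using d by (cases d) auto
  have "asteroidal ?H (subtree (Suc (Suc d)) xs) (subtree d (True # True # xs))
      (subtree d (False # True # xs)) (subtree d (True # False # xs)) Z1 Z2 Z3"
    unfolding asteroidal_def
  proof (intro conjI)
    show "conn (line_graph ?H) (subtree (Suc (Suc d)) xs)" using r by (intro subtree_conn) auto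
  qed (fact Z1 Z2 Z3 sub ne far1 far2 far3 | force simp: Z1_def Z2_def Z3_def down_def br_def)+
  then show ?thesis by blast
qed

text \<open>Up to constants, this is the lower bound \<open>k\<close> for the path width of a binary tree of depth \<open>2k\<close>:
  of the large bags that the induction provides for three subtrees two levels below, one also meets
  the connection of the other two subtrees and so contains a further element. The three levels at
  the bottom ensure that the support of every subtree considered meets \<open>S\<close>, hence some bag.\<close>

lemma subtree_large_bag:
  assumes C: "constellation C S" and M: "edge_model C X (binary_tree r) \<Phi>"
    and bags: "linear_bags C X bag" and fin: "\<And>i. finite (bag i)"
    and meet: "\<And>A. A \<subseteq> X \<Longrightarrow> A \<inter> S \<noteq> {} \<Longrightarrow> \<exists>i. bag i \<inter> A \<noteq> {}"
  shows "length xs + (3 + 2 * k) \<le> r \<Longrightarrow>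
    \<exists>i. k + 1 \<le> card (bag i \<inter> support \<Phi> (subtree (3 + 2 * k) xs))"
proof (induction k arbitrary: xs)
  case 0
  then obtain Z1 Z2 Z3 where "asteroidal (binary_tree r) (subtree (Suc (Suc 1)) xs)
    (subtree 1 (True # True # xs)) (subtree 1 (False # True # xs)) (subtree 1 (True # False # xs))
    Z1 Z2 Z3"
    using subtree_asteroidal[of xs 1 r] by auto
  then have "support \<Phi> (subtree (Suc (Suc 1)) xs) \<inter> S \<noteq> {}"
    by (rule asteroidal_meets_stable_set[OF C M])
  moreover have three: "Suc (Suc 1) = 3 + 2 * (0 :: nat)" by simp
  ultimately have S: "support \<Phi> (subtree (3 + 2 * 0) xs) \<inter> S \<noteq> {}" unfolding three by blast
  have "conn (line_graph (binary_tree r)) (subtree (3 + 2 * 0) xs)"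
    using 0 by (intro subtree_conn) auto
  then have "support \<Phi> (subtree (3 + 2 * 0) xs) \<subseteq> X" by (rule support_conn(2)[OF M])
  then obtain i where "bag i \<inter> support \<Phi> (subtree (3 + 2 * 0) xs) \<noteq> {}" using meet S by blast
  then have "0 < card (bag i \<inter> support \<Phi> (subtree (3 + 2 * 0) xs))"
    using fin[of i] by (simp only: card_gt_0_iff finite_Int simp_thms)
  then show ?case by (intro exI[of _ i]) linarith
next
  case (Suc k)
  define d where "d = 3 + 2 * k"
  have d: "3 + 2 * Suc k = Suc (Suc d)" by (simp add: d_def)
  let ?F = "subtree (Suc (Suc d)) xs"
  have len: "length xs + Suc (Suc d) \<le> r" using Suc.prems d by simp
  obtain Z1 Z2 Z3 where T: "asteroidal (binary_tree r) ?F (subtree d (True # True # xs))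
    (subtree d (False # True # xs)) (subtree d (True # False # xs)) Z1 Z2 Z3"
    using subtree_asteroidal[OF len] by (auto simp: d_def)
  note sup = asteroidal_support[OF M T]
  have IH: "\<exists>i. k + 1 \<le> card (bag i \<inter> support \<Phi> (subtree d (y # x # xs)))" for y x
    using Suc.IH[of "y # x # xs"] len by (simp add: d_def)
  obtain t1 where t1: "k + 1 \<le> card (bag t1 \<inter> support \<Phi> (subtree d (True # True # xs)))"
    using IH by blast
  obtain t2 where t2: "k + 1 \<le> card (bag t2 \<inter> support \<Phi> (subtree d (False # True # xs)))"
    using IH by blast
  obtain t3 where t3: "k + 1 \<le> card (bag t3 \<inter> support \<Phi> (subtree d (True # False # xs)))"
    using IH by blast
  have Z: "conn (line_graph (binary_tree r)) Z1" "conn (line_graph (binary_tree r)) Z2"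
    "conn (line_graph (binary_tree r)) Z3"
    using T by (auto simp: asteroidal_def)
  have ne: "B \<noteq> {}" if "k + 1 \<le> card B" for B :: "'a set" using that by auto
  have "bag t1 \<inter> support \<Phi> Z1 \<noteq> {} \<or> bag t2 \<inter> support \<Phi> Z2 \<noteq> {} \<or> bag t3 \<inter> support \<Phi> Z3 \<noteq> {}"
    using asteroidal_triple_bags[OF bags support_conn(1)[OF M Z(1)] support_conn(1)[OF M Z(2)]
      support_conn(1)[OF M Z(3)] support_conn(2)[OF M Z(1)] support_conn(2)[OF M Z(2)]
      support_conn(2)[OF M Z(3)] sup(4-6) ne[OF t1] ne[OF t2] ne[OF t3]] .
  moreover have "k + 2 \<le> card (bag t \<inter> support \<Phi> ?F)"
    if E: "k + 1 \<le> card (bag t \<inter> E)" "E \<inter> Z = {}" "E \<subseteq> support \<Phi> ?F" "Z \<subseteq> support \<Phi> ?F"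
      and Zt: "bag t \<inter> Z \<noteq> {}" for t E Z
  proof -
    obtain z where z: "z \<in> bag t" "z \<in> Z" using Zt by blast
    then have "z \<notin> bag t \<inter> E" using E(2) by blast
    then have "card (insert z (bag t \<inter> E)) = Suc (card (bag t \<inter> E))" using fin[of t] by simp
    moreover have "insert z (bag t \<inter> E) \<subseteq> bag t \<inter> support \<Phi> ?F" using z E(3,4) by blast
    then have "card (insert z (bag t \<inter> E)) \<le> card (bag t \<inter> support \<Phi> ?F)"
      using fin[of t] by (intro card_mono finite_Int disjI1)
    ultimately show ?thesis using E(1) by linarith
  qed
  note more = this
  have E: "support \<Phi> (subtree d (True # True # xs)) \<subseteq> support \<Phi> ?F"
    "support \<Phi> (subtree d (False # True # xs)) \<subseteq> support \<Phi> ?F"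
    "support \<Phi> (subtree d (True # False # xs)) \<subseteq> support \<Phi> ?F"
    using sup(4-6,10-12) by (meson Int_subset_iff subset_trans)+
  ultimately have "\<exists>t. k + 2 \<le> card (bag t \<inter> support \<Phi> ?F)"
    using more[OF t1 sup(1) E(1) sup(10)] more[OF t2 sup(2) E(2) sup(11)]
      more[OF t3 sup(3) E(3) sup(12)] by blast
  then show ?case unfolding d by simp
qed

section \<open>Walls\<close>

text \<open>The horizontal edge to the right of position \<open>j\<close> in row \<open>i\<close>. Between rows \<open>i\<close> and \<open>i + 1\<close>, exactly one
  of the positions \<open>2 m\<close> and \<open>2 m + 1\<close> carries a vertical edge, namely the one with the parity of \<open>i\<close>:
  this position is \<open>vcol m i\<close>, and the edge is \<open>vedge m i\<close>.\<close>

abbreviation hedge :: "nat \<Rightarrow> nat \<Rightarrow> (nat \<times> nat) set" where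
  "hedge i j \<equiv> {(i, j), (i, j + 1)}"

abbreviation vcol :: "nat \<Rightarrow> nat \<Rightarrow> nat" where
  "vcol m i \<equiv> (if even i then 2 * m else 2 * m + 1)"

abbreviation vedge :: "nat \<Rightarrow> nat \<Rightarrow> (nat \<times> nat) set" where
  "vedge m i \<equiv> {(i, vcol m i), (i + 1, vcol m i)}"

text \<open>\<open>row i a c\<close> runs along row \<open>i\<close> from position \<open>a\<close> to position \<open>c + 1\<close>. \<open>column m t\<close> is
  the zigzag path through the positions \<open>2 m\<close> and \<open>2 m + 1\<close> of the rows up to \<open>t\<close>.\<close>

definition row :: "nat \<Rightarrow> nat \<Rightarrow> nat \<Rightarrow> (nat \<times> nat) set set" where
  "row i a c = hedge i ` {a..c}"

definition column :: "nat \<Rightarrow> nat \<Rightarrow> (nat \<times> nat) set set" where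
  "column m t = (\<lambda>i. hedge i (2 * m)) ` {1..t} \<union> vedge m ` {1..<t}"

lemma brick_grid_edges:
  "hedge i j \<in> edges (brick_grid n)" if "1 \<le> i" "i \<le> n" "1 \<le> j" "j \<le> 2 * n - 1"
  using that by (auto simp: brick_grid_def)

text \<open>Away from the first and the last position of a row, no vertex has degree one, so that building
  the wall from the grid deletes nothing there.\<close>

lemma wall_vertexI:
  assumes "1 \<le> i" "i \<le> n" "2 \<le> j" "j \<le> 2 * n - 1"
  shows "(i, j) \<in> verts (wall n)"
proof -
  let ?G = "brick_grid n"
  have v: "verts ?G = {1..n} \<times> {1..2 * n}" by (simp add: brick_grid_def)
  have "hedge i (j - 1) \<in> edges ?G" "hedge i j \<in> edges ?G"
    using assms by (intro brick_grid_edges; simp)+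
  then have "{(i, j - 1), (i, j + 1)} \<subseteq> {u \<in> verts ?G. adjacent ?G (i, j) u}"
    using assms by (auto simp: adjacent_def v insert_commute)
  then have "card {(i, j - 1), (i, j + 1)} \<le> degree ?G (i, j)"
    unfolding degree_def by (intro card_mono) (simp_all add: v)
  then have "degree ?G (i, j) \<noteq> 1" by simp
  then show ?thesis using assms by (auto simp: wall_def delete_verts_def induce_def v)
qed

lemma wall_edgeI:
  assumes "e \<in> edges (brick_grid n)" "e \<subseteq> verts (wall n)"
  shows "e \<in> edges (wall n)"
  using assms by (auto simp: wall_def delete_verts_def induce_def)

lemma hedge_wall:
  assumes "1 \<le> i" "i \<le> n" "2 \<le> j" "j \<le> 2 * n - 2"
  shows "hedge i j \<in> edges (wall n)"
  using assms by (intro wall_edgeI brick_grid_edges) (auto intro!: wall_vertexI)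

lemma vedge_wall:
  assumes "1 \<le> i" "i < n" "1 \<le> m" "m < n"
  shows "vedge m i \<in> edges (wall n)"
proof (rule wall_edgeI)
  have "even (i + vcol m i)" "1 \<le> vcol m i" "vcol m i \<le> 2 * n" "i \<le> n - 1" using assms by auto
  then show "vedge m i \<in> edges (brick_grid n)"
    unfolding brick_grid_def graph.sel using assms(1) by blast
  show "vedge m i \<subseteq> verts (wall n)" using assms by (auto intro!: wall_vertexI)
qed

lemma row_conn:
  assumes "1 \<le> i" "i \<le> n" "2 \<le> a" "a \<le> c" "c \<le> 2 * n - 2"
  shows "conn (line_graph (wall n)) (row i a c)"
  using assms(4,5)
proof (induction c rule: dec_induct)
  case base
  then show ?case using conn_edge[OF hedge_wall[of i n a]] assms by (simp add: row_def)
next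
  case (step c)
  have "conn (line_graph (wall n)) (row i a c)" using step by simp
  moreover have "hedge i (Suc c) \<in> edges (wall n)"
    using step.hyps step.prems assms by (intro hedge_wall) auto
  moreover have "hedge i c \<in> row i a c" using step.hyps by (auto simp: row_def)
  ultimately have "conn (line_graph (wall n)) (insert (hedge i (Suc c)) (row i a c))"
    by (rule conn_edges_insert[of _ _ _ _ "(i, Suc c)"]) auto
  moreover have "row i a (Suc c) = insert (hedge i (Suc c)) (row i a c)"
    using step.hyps by (auto simp: row_def atLeastAtMostSuc_conv)
  ultimately show ?case by simp
qed

lemma column_conn:
  assumes "1 \<le> m" "m < n" "1 \<le> t" "t \<le> n"
  shows "conn (line_graph (wall n)) (column m t)"
  using assms(3,4)
proof (induction t rule: dec_induct)
  case base
  then show ?case using conn_edge[OF hedge_wall[of 1 n "2 * m"]] assms by (simp add: column_def)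
next
  case (step t)
  have h: "hedge t (2 * m) \<in> column m t" using step.hyps by (auto simp: column_def)
  have v: "vedge m t \<in> edges (wall n)" using step.hyps step.prems assms by (intro vedge_wall) auto
  have h': "hedge (Suc t) (2 * m) \<in> edges (wall n)"
    using step.hyps step.prems assms by (intro hedge_wall) auto
  have "conn (line_graph (wall n)) (column m t)" using step by simp
  then have "conn (line_graph (wall n)) (insert (vedge m t) (column m t))"
    by (rule conn_edges_insert[OF _ v h, of "(t, vcol m t)"]) auto
  then have "conn (line_graph (wall n)) (insert (hedge (Suc t) (2 * m)) (insert (vedge m t) (column m t)))"
    by (rule conn_edges_insert[OF _ h', of _ "vedge m t" "(Suc t, vcol m t)"]) auto
  moreover have "column m (Suc t) = insert (hedge (Suc t) (2 * m)) (insert (vedge m t) (column m t))"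
  proof -
    have "{1..Suc t} = insert (Suc t) {1..t}" "{1..<Suc t} = insert t {1..<t}"
      using step.hyps by auto
    then show ?thesis by (simp add: column_def Un_commute insert_commute)
  qed
  ultimately show ?case by simp
qed

lemma row_verts: "e \<in> row i a c \<Longrightarrow> v \<in> e \<Longrightarrow> fst v = i \<and> a \<le> snd v \<and> snd v \<le> c + 1"
  by (auto simp: row_def)

lemma column_verts: "e \<in> column m t \<Longrightarrow> v \<in> e \<Longrightarrow> snd v = 2 * m \<or> snd v = 2 * m + 1"
  by (auto simp: column_def split: if_splits)

lemma conn_subset_edges: "conn (line_graph H) F \<Longrightarrow> F \<subseteq> edges H"
  by (simp add: conn_def line_graph_def)

lemma segment_column_conn:
  assumes "1 \<le> i" "i \<le> n" "2 \<le> a" "a \<le> 2 * m" "2 * m \<le> c" "c \<le> 2 * n - 2"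
  shows "conn (line_graph (wall n)) (row i a c \<union> column m n)"
proof -
  have mn: "1 \<le> m" "m < n" using assms by auto
  have "hedge i (2 * m) \<in> row i a c" "hedge i (2 * m) \<in> column m n"
    using assms by (auto simp: row_def column_def)
  then show ?thesis
    using row_conn[of i n a c] column_conn[OF mn, of n] assms
    by (intro conn_edges_Un[of _ _ _ "hedge i (2 * m)" "hedge i (2 * m)" "(i, 2 * m)"]) auto
qed

text \<open>The union of a row, up to its first and last position, and a column.\<close>

abbreviation cross :: "nat \<Rightarrow> nat \<Rightarrow> nat \<Rightarrow> (nat \<times> nat) set set" where
  "cross n i m \<equiv> row i 2 (2 * n - 2) \<union> column m n"

text \<open>The two end edges of the row and an edge of the column in another row form an asteroidal triple
  in the cross.\<close>

lemma cross_asteroidal: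
  assumes i: "1 \<le> i" "i \<le> n" and m: "2 \<le> m" "m + 2 \<le> n"
  shows "\<exists>E1 E2 E3 Z1 Z2 Z3. asteroidal (wall n) (cross n i m) E1 E2 E3 Z1 Z2 Z3"
proof -
  define i' where "i' = (if i = 1 then 2 else 1 :: nat)"
  have i': "1 \<le> i'" "i' \<le> n" "i' \<noteq> i" using m by (auto simp: i'_def)
  define Z1 where "Z1 = row i 4 (2 * n - 2) \<union> column m n"
  define Z2 where "Z2 = row i 2 (2 * n - 4) \<union> column m n"
  define Z3 where "Z3 = row i 2 (2 * n - 2)"
  have "asteroidal (wall n) (cross n i m) {hedge i 2} {hedge i (2 * n - 2)} {hedge i' (2 * m)} Z1 Z2 Z3"
    unfolding asteroidal_def
  proof (intro conjI)
    show "conn (line_graph (wall n)) (cross n i m)" "conn (line_graph (wall n)) Z1"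
      "conn (line_graph (wall n)) Z2"
      unfolding Z1_def Z2_def using i m by (intro segment_column_conn; simp)+
    show "conn (line_graph (wall n)) Z3"
      unfolding Z3_def using i m by (intro row_conn) auto
    show "Z1 \<subseteq> cross n i m" "Z2 \<subseteq> cross n i m" "Z3 \<subseteq> cross n i m"
      unfolding Z1_def Z2_def Z3_def row_def by auto
    show "{hedge i 2} \<subseteq> Z2 \<inter> Z3" "{hedge i (2 * n - 2)} \<subseteq> Z1 \<inter> Z3"
      using m by (auto simp: Z1_def Z2_def Z3_def row_def)
    show "{hedge i' (2 * m)} \<subseteq> Z1 \<inter> Z2" using i' by (auto simp: Z1_def Z2_def column_def)
    have "4 \<le> snd v" if "f \<in> Z1" "v \<in> f" for f v
      using that row_verts[of f i 4 "2 * n - 2" v] column_verts[of f m n v] m by (auto simp: Z1_def)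
    then show "\<forall>e \<in> {hedge i 2}. \<forall>f \<in> Z1. e \<inter> f = {}" by fastforce
    have "snd v \<le> 2 * n - 3" if "f \<in> Z2" "v \<in> f" for f v
      using that row_verts[of f i 2 "2 * n - 4" v] column_verts[of f m n v] m by (auto simp: Z2_def)
    then show "\<forall>e \<in> {hedge i (2 * n - 2)}. \<forall>f \<in> Z2. e \<inter> f = {}" using m by fastforce
    have "fst v = i" if "f \<in> Z3" "v \<in> f" for f v
      using that row_verts[of f i 2 "2 * n - 2" v] by (auto simp: Z3_def)
    then show "\<forall>e \<in> {hedge i' (2 * m)}. \<forall>f \<in> Z3. e \<inter> f = {}" using i' by fastforce
  qed auto
  then show ?thesis by blast
qed

lemma disjoint_family_missing:
  assumes B: "finite B" and I: "finite I" "card B < card I"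
    and disj: "\<And>i j. i \<in> I \<Longrightarrow> j \<in> I \<Longrightarrow> i \<noteq> j \<Longrightarrow> D i \<inter> D j = {}"
  shows "\<exists>i \<in> I. B \<inter> D i = {}"
proof (rule ccontr)
  assume "\<not> ?thesis"
  then have "\<forall>i \<in> I. \<exists>x. x \<in> B \<inter> D i" by blast
  then obtain x where x: "\<forall>i \<in> I. x i \<in> B \<inter> D i" by (rule bchoice[THEN exE])
  have "inj_on x I"
  proof (rule inj_onI, rule ccontr)
    fix i j assume ij: "i \<in> I" "j \<in> I" "x i = x j" "i \<noteq> j"
    have "x i \<in> D i" "x j \<in> D j" using x ij by auto
    then show False using disj[OF ij(1,2,4)] ij(3) by auto
  qed
  moreover have "x ` I \<subseteq> B" using x by auto
  ultimately have "card I \<le> card B" using B card_inj_on_le by blast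
  then show False using I by simp
qed

text \<open>Choose a cross whose last bag \<open>t\<close> comes first. Every other cross meets a bag from \<open>t\<close> on, and
  its union with the chosen cross is connected, so it meets bag \<open>t\<close> or \<open>t + 1\<close>. But two small bags
  miss some row and some column entirely.\<close>

lemma wall_bags_contradiction:
  assumes C: "constellation C S" and M: "edge_model C X (wall n) \<Phi>"
    and bags: "linear_bags C X bag" and fin: "\<And>i. finite (bag i)"
    and small: "\<And>i. card (bag i) \<le> c" and last: "\<And>i. i > N \<Longrightarrow> bag i = {}"
    and meet: "\<And>A. A \<subseteq> X \<Longrightarrow> A \<inter> S \<noteq> {} \<Longrightarrow> \<exists>i. bag i \<inter> A \<noteq> {}"
    and n: "2 * c + 4 \<le> n"
  shows False
proof -
  define valid where "valid = (\<lambda>(i, m). 1 \<le> i \<and> i \<le> n \<and> 2 \<le> m \<and> m + 2 \<le> n)"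
  define Y where "Y = (\<lambda>(i, m). support \<Phi> (cross n i m))"
  have cross: "conn (line_graph (wall n)) (cross n i m)" if "valid (i, m)" for i m
    using that by (intro segment_column_conn) (auto simp: valid_def)
  have YC: "conn C (Y p)" and YX: "Y p \<subseteq> X" and YS: "Y p \<inter> S \<noteq> {}" if p: "valid p" for p
  proof -
    obtain i m where im: "p = (i, m)" by (cases p)
    show "conn C (Y p)" "Y p \<subseteq> X"
      using support_conn[OF M cross[of i m]] p im by (auto simp: Y_def)
    obtain E1 E2 E3 Z1 Z2 Z3 where "asteroidal (wall n) (cross n i m) E1 E2 E3 Z1 Z2 Z3"
      using cross_asteroidal[of i n m] p im by (auto simp: valid_def)
    from asteroidal_meets_stable_set[OF C M this] show "Y p \<inter> S \<noteq> {}" by (simp add: Y_def im)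
  qed
  have YY: "Y p \<inter> Y p' \<noteq> {}" if p: "valid p" "valid p'" for p p'
  proof -
    obtain i m i' m' where im: "p = (i, m)" "p' = (i', m')" by (cases p; cases p')
    let ?e = "hedge i (2 * m')"
    have e: "?e \<in> row i 2 (2 * n - 2)" "?e \<in> column m' n"
      using p im by (auto simp: valid_def row_def column_def)
    then have "?e \<in> edges (wall n)" using conn_subset_edges[OF cross[of i' m']] p im by auto
    then have "\<Phi> ?e \<noteq> {}" using M by (simp add: edge_model_def conn_def)
    moreover have "\<Phi> ?e \<subseteq> Y p \<inter> Y p'" using e im by (auto simp: Y_def)
    ultimately show ?thesis by blast
  qed
  have v0: "valid (1, 2)" using n by (auto simp: valid_def)
  define ends where "ends = (\<lambda>t. \<exists>p. valid p \<and> (\<forall>t' > t. bag t' \<inter> Y p = {}))"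
  have "ends N" unfolding ends_def using v0 last by (intro exI[of _ "(1, 2)"]) simp
  define t where "t = (LEAST t. ends t)"
  have "ends t" unfolding t_def using \<open>ends N\<close> by (rule LeastI)
  then obtain p0 where p0: "valid p0" and p0t: "\<And>t'. t' > t \<Longrightarrow> bag t' \<inter> Y p0 = {}"
    unfolding ends_def by blast
  obtain s where s: "bag s \<inter> Y p0 \<noteq> {}" using meet[OF YX[OF p0] YS[OF p0]] by blast
  have st: "s \<le> t" using p0t[of s] s by (cases "s \<le> t") auto
  have hit: "(bag t \<union> bag (Suc t)) \<inter> Y p \<noteq> {}" if p: "valid p" for p
  proof -
    have "\<exists>t' \<ge> t. bag t' \<inter> Y p \<noteq> {}"
    proof (cases t)
      case 0
      then show ?thesis using meet[OF YX[OF p] YS[OF p]] by auto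
    next
      case (Suc u)
      then have "\<not> ends u" using not_less_Least[of u ends] by (simp add: t_def)
      then obtain t' where "t' > u" "bag t' \<inter> Y p \<noteq> {}" unfolding ends_def using p by blast
      then show ?thesis using Suc by (intro exI[of _ t']) auto
    qed
    then obtain t' where t': "t \<le> t'" "bag t' \<inter> Y p \<noteq> {}" by blast
    show ?thesis
    proof (cases "t' = t")
      case True
      then show ?thesis using t' by blast
    next
      case False
      have conn: "conn C (Y p0 \<union> Y p)" using YC YY p p0 by (intro conn_Un) auto
      have sub: "Y p0 \<union> Y p \<subseteq> X" using YX p p0 by blast
      have le: "s \<le> Suc t" "Suc t \<le> t'" using st t' False by auto
      have "bag (Suc t) \<inter> (Y p0 \<union> Y p) \<noteq> {}"
        by (rule linear_bagsD[OF bags conn sub le]) (use s t' in blast)+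
      then show ?thesis using p0t[of "Suc t"] by blast
    qed
  qed
  define B where "B = bag t \<union> bag (Suc t)"
  have B: "finite B" "card B \<le> 2 * c"
    using fin small[of t] small[of "Suc t"] card_Un_le[of "bag t" "bag (Suc t)"] by (auto simp: B_def)
  have "\<exists>i \<in> {1..n}. B \<inter> support \<Phi> (row i 2 (2 * n - 2)) = {}"
  proof (rule disjoint_family_missing[OF B(1)])
    show "card B < card {1..n}" using B n by simp
    fix i j assume ij: "i \<in> {1..n}" "j \<in> {1..n}" "i \<noteq> j"
    have sub: "row k 2 (2 * n - 2) \<subseteq> edges (wall n)" if "k \<in> {1..n}" for k
      using that n by (intro conn_subset_edges row_conn) auto
    show "support \<Phi> (row i 2 (2 * n - 2)) \<inter> support \<Phi> (row j 2 (2 * n - 2)) = {}"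
      by (rule support_disjoint[OF M sub[OF ij(1)] sub[OF ij(2)]])
        (use row_verts ij(3) in blast)
  qed simp
  then obtain i where i: "i \<in> {1..n}" "B \<inter> support \<Phi> (row i 2 (2 * n - 2)) = {}" by blast
  have "\<exists>m \<in> {2..n - 2}. B \<inter> support \<Phi> (column m n) = {}"
  proof (rule disjoint_family_missing[OF B(1)])
    show "card B < card {2..n - 2}" using B n by simp
    fix m m' assume m: "m \<in> {2..n - 2}" "m' \<in> {2..n - 2}" "m \<noteq> m'"
    have sub: "column k n \<subseteq> edges (wall n)" if "k \<in> {2..n - 2}" for k
      using that n by (intro conn_subset_edges column_conn) auto
    have "e \<inter> f = {}" if ef: "e \<in> column m n" "f \<in> column m' n" for e f
    proof (rule ccontr)
      assume "e \<inter> f \<noteq> {}"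
      then obtain v where v: "v \<in> e" "v \<in> f" by blast
      show False using column_verts[OF ef(1) v(1)] column_verts[OF ef(2) v(2)] m(3) by presburger
    qed
    then show "support \<Phi> (column m n) \<inter> support \<Phi> (column m' n) = {}"
      by (rule support_disjoint[OF M sub[OF m(1)] sub[OF m(2)]])
  qed simp
  then obtain m where m: "m \<in> {2..n - 2}" "B \<inter> support \<Phi> (column m n) = {}" by blast
  have "valid (i, m)" using i m n by (auto simp: valid_def)
  then have "B \<inter> Y (i, m) \<noteq> {}" using hit unfolding B_def by blast
  then show False using i m by (auto simp: Y_def)
qed

section \<open>Subdivisions and their line graphs\<close>

lemma set_conv_nth_image: "p \<noteq> [] \<Longrightarrow> set p = (!) p ` {0..length p - 1}"
proof -
  assume "p \<noteq> []"
  then have "{0..length p - 1} = {..<length p}" by (cases p) auto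
  then show ?thesis by (auto simp: set_conv_nth)
qed

lemma set_path_ends_interior:
  assumes "2 \<le> length p"
  shows "set p = {hd p, last p} \<union> interior p"
proof
  show "set p \<subseteq> {hd p, last p} \<union> interior p"
  proof
    fix x assume "x \<in> set p"
    then obtain i where i: "i < length p" "x = p ! i" by (auto simp: in_set_conv_nth)
    then consider "i = 0" | "i = length p - 1" | "0 < i \<and> Suc i < length p" by linarith
    then show "x \<in> {hd p, last p} \<union> interior p"
    proof cases
      case 1 then show ?thesis using i assms by (subst hd_conv_nth) auto
    next
      case 2 then show ?thesis using i assms by (subst last_conv_nth) auto
    next
      case 3 then show ?thesis using i by (auto simp: mem_interior_iff)
    qed
  qed
  have "p \<noteq> []" using assms by auto
  then show "{hd p, last p} \<union> interior p \<subseteq> set p" by (auto simp: mem_interior_iff)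
qed

lemma path_edges_at_vertex:
  assumes d: "distinct p" and i: "i < length p"
  shows "{E \<in> path_edges p. p ! i \<in> E} =
    {{p ! k, p ! Suc k} |k. Suc k < length p \<and> (k = i \<or> Suc k = i)}"
  using i nth_eq_iff_index_eq[OF d] by (auto simp: path_edges_def)

lemma path_edges_at_vertex_le:
  assumes d: "distinct p"
  shows "finite {E \<in> path_edges p. v \<in> E}" "card {E \<in> path_edges p. v \<in> E} \<le> 2"
    "v = hd p \<or> v = last p \<Longrightarrow> card {E \<in> path_edges p. v \<in> E} \<le> 1"
proof -
  let ?E = "{E \<in> path_edges p. v \<in> E}"
  have "finite ?E \<and> card ?E \<le> 2 \<and> (v = hd p \<or> v = last p \<longrightarrow> card ?E \<le> 1)"
  proof (cases "v \<in> set p")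
    case False
    then have "?E = {}" by (auto simp: path_edges_def dest: nth_mem)
    then show ?thesis by (simp only:) simp
  next
    case True
    then obtain i where i: "i < length p" "v = p ! i" by (auto simp: in_set_conv_nth)
    have E: "?E = {{p ! k, p ! Suc k} |k. Suc k < length p \<and> (k = i \<or> Suc k = i)}"
      using path_edges_at_vertex[OF d i(1)] i(2) by simp
    have sub: "?E \<subseteq> set [{p ! i, p ! Suc i}, {p ! (i - 1), p ! i}]" unfolding E by auto
    then have fin: "finite ?E" using finite_subset by blast
    have two: "card ?E \<le> 2"
      using card_mono[OF _ sub] card_length[of "[{p ! i, p ! Suc i}, {p ! (i - 1), p ! i}]"] by simp
    have "card ?E \<le> 1" if v: "v = hd p \<or> v = last p"
    proof -
      have "p \<noteq> []" using i by auto
      then have "i = 0 \<or> Suc i = length p"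
        using v i nth_eq_iff_index_eq[OF d, of i 0] nth_eq_iff_index_eq[OF d, of i "length p - 1"]
        by (auto simp: hd_conv_nth last_conv_nth)
      then have "?E \<subseteq> {{p ! i, p ! Suc i}} \<or> ?E \<subseteq> {{p ! (i - 1), p ! i}}" unfolding E by auto
      then show ?thesis using card_mono[of "{_}" ?E] by fastforce
    qed
    then show ?thesis using fin two by blast
  qed
  then show "finite ?E" "card ?E \<le> 2" "v = hd p \<or> v = last p \<Longrightarrow> card ?E \<le> 1" by blast+
qed

text \<open>The data of a subdivision, with the paths split into their ends and their interiors.\<close>

lemma subdivision_ofE:
  assumes "subdivision_of K H" and H: "\<And>e. e \<in> edges H \<Longrightarrow> e \<subseteq> verts H \<and> e \<noteq> {}"
  obtains b P where "inj_on b (verts H)"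
    "\<And>e. e \<in> edges H \<Longrightarrow> distinct (P e) \<and> 2 \<le> length (P e) \<and> {hd (P e), last (P e)} = b ` e"
    "\<And>e. e \<in> edges H \<Longrightarrow> set (P e) = b ` e \<union> interior (P e)"
    "\<And>e. e \<in> edges H \<Longrightarrow> interior (P e) \<inter> b ` verts H = {}"
    "\<And>e f. e \<in> edges H \<Longrightarrow> f \<in> edges H \<Longrightarrow> e \<noteq> f \<Longrightarrow> interior (P e) \<inter> interior (P f) = {}"
    "verts K = b ` verts H \<union> (\<Union>e \<in> edges H. set (P e))"
    "edges K = (\<Union>e \<in> edges H. path_edges (P e))"
proof -
  obtain b P where inj: "inj_on b (verts H)"
    and P: "\<forall>e \<in> edges H. distinct (P e) \<and> path_length (P e) \<ge> 1 \<and>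
        {hd (P e), last (P e)} = b ` e \<and> interior (P e) \<inter> b ` verts H = {}"
    and I: "\<forall>e \<in> edges H. \<forall>f \<in> edges H. e \<noteq> f \<longrightarrow> interior (P e) \<inter> interior (P f) = {}"
    and K: "verts K = b ` verts H \<union> (\<Union>e \<in> edges H. set (P e))"
      "edges K = (\<Union>e \<in> edges H. path_edges (P e))"
    using assms(1) unfolding subdivision_of_def by (elim exE conjE)
  have len: "2 \<le> length (P e)" if "e \<in> edges H" for e
    using P that by (fastforce simp: path_length_def)
  show ?thesis
  proof (rule that[OF inj _ _ _ _ K])
    fix e assume e: "e \<in> edges H"
    show "distinct (P e) \<and> 2 \<le> length (P e) \<and> {hd (P e), last (P e)} = b ` e"
      using P len e by simp
    show "set (P e) = b ` e \<union> interior (P e)"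
      using set_path_ends_interior[OF len[OF e]] P e by simp
    show "interior (P e) \<inter> b ` verts H = {}" using P e by simp
    show "interior (P e) \<inter> interior (P f) = {}" if "f \<in> edges H" "e \<noteq> f" for f
      using I e that by simp
  qed
qed

text \<open>An edge \<open>e\<close> is represented by the vertices, respectively the edges, of the path replacing it.\<close>

lemma subdivision_edge_models:
  assumes sub: "subdivision_of K H" and H: "\<And>e. e \<in> edges H \<Longrightarrow> e \<subseteq> verts H \<and> e \<noteq> {}"
  shows "(\<exists>\<Phi>. edge_model K (verts K) H \<Phi>) \<and>
    (\<exists>\<Phi>. edge_model (line_graph K) (verts (line_graph K)) H \<Phi>)"
proof (rule subdivision_ofE[OF sub H])
  fix b P assume inj: "inj_on b (verts H)"
    and P: "\<And>e. e \<in> edges H \<Longrightarrow>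
      distinct (P e) \<and> 2 \<le> length (P e) \<and> {hd (P e), last (P e)} = b ` e"
    and set: "\<And>e. e \<in> edges H \<Longrightarrow> set (P e) = b ` e \<union> interior (P e)"
    and int: "\<And>e. e \<in> edges H \<Longrightarrow> interior (P e) \<inter> b ` verts H = {}"
    and int2: "\<And>e f. e \<in> edges H \<Longrightarrow> f \<in> edges H \<Longrightarrow> e \<noteq> f \<Longrightarrow> interior (P e) \<inter> interior (P f) = {}"
    and K: "verts K = b ` verts H \<union> (\<Union>e \<in> edges H. set (P e))"
      "edges K = (\<Union>e \<in> edges H. path_edges (P e))"
  have bH: "b ` e \<subseteq> b ` verts H" if "e \<in> edges H" for e using H[OF that] by blast
  have disj: "set (P e) \<inter> set (P f) = {}" if e: "e \<in> edges H" "f \<in> edges H" "e \<inter> f = {}" for e f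
  proof -
    have "e \<noteq> f" using H[OF e(1)] e(3) by blast
    moreover have "b ` e \<inter> b ` f = {}"
      using inj_on_image_Int[OF inj, of e f] H[OF e(1)] H[OF e(2)] e(3) by simp
    moreover have "interior (P e) \<inter> b ` f = {}" "interior (P f) \<inter> b ` e = {}"
      using Int_mono[OF subset_refl bH[OF e(2)], of "interior (P e)"] int[OF e(1)]
        Int_mono[OF subset_refl bH[OF e(1)], of "interior (P f)"] int[OF e(2)]
      by simp_all
    moreover from \<open>e \<noteq> f\<close> have "interior (P e) \<inter> interior (P f) = {}" by (rule int2[OF e(1,2)])
    ultimately show ?thesis unfolding set[OF e(1)] set[OF e(2)] by blast
  qed
  have meet: "\<exists>v. v \<in> set (P e) \<and> v \<in> set (P f)"
    if e: "e \<in> edges H" "f \<in> edges H" "e \<inter> f \<noteq> {}" for e f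
    using set[OF e(1)] set[OF e(2)] e(3) by blast
  have edge: "{P e ! i, P e ! Suc i} \<in> edges K" if "e \<in> edges H" "Suc i < length (P e)" for e i
    using that K(2) by (auto simp: path_edges_def)
  have connK: "conn K (set (P e))" if e: "e \<in> edges H" for e
  proof -
    have ne: "P e \<noteq> []" and len: "2 \<le> length (P e)" using P[OF e] by auto
    have "conn K ((!) (P e) ` {0..length (P e) - 1})"
    proof (rule conn_list_segment)
      show "P e ! i \<in> verts K" if "i \<le> length (P e) - 1" for i
      proof -
        have "P e ! i \<in> set (P e)" using that len by (intro nth_mem) linarith
        then show ?thesis using K(1) e by blast
      qed
      show "adjacent K (P e ! i) (P e ! Suc i)" if "Suc i \<le> length (P e) - 1" for i
        using edge[OF e, of i] that len by (simp add: adjacent_def)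
    qed simp
    then show ?thesis using set_conv_nth_image[OF ne] by simp
  qed
  have connL: "conn (line_graph K) (path_edges (P e))" if e: "e \<in> edges H" for e
  proof -
    have len: "2 \<le> length (P e)" and d: "distinct (P e)" using P[OF e] by auto
    have "conn (line_graph K) ((\<lambda>i. {P e ! i, P e ! Suc i}) ` {0..length (P e) - 2})"
    proof (rule conn_list_segment)
      show "{P e ! i, P e ! Suc i} \<in> verts (line_graph K)" if "i \<le> length (P e) - 2" for i
        using edge[OF e, of i] that len by (simp add: line_graph_def)
      show "adjacent (line_graph K) {P e ! i, P e ! Suc i} {P e ! Suc i, P e ! Suc (Suc i)}"
        if i: "Suc i \<le> length (P e) - 2" for i
      proof -
        have "P e ! i \<noteq> P e ! Suc i" "P e ! i \<noteq> P e ! Suc (Suc i)"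
          using nth_eq_iff_index_eq[OF d] i len by auto
        then show ?thesis
          using edge[OF e, of i] edge[OF e, of "Suc i"] i len
          by (auto simp: adjacent_line_graph doubleton_eq_iff)
      qed
    qed simp
    moreover have "path_edges (P e) = (\<lambda>i. {P e ! i, P e ! Suc i}) ` {0..length (P e) - 2}"
    proof -
      have "{i. Suc i < length (P e)} = {0..length (P e) - 2}" using len by auto
      then show ?thesis unfolding path_edges_def by blast
    qed
    ultimately show ?thesis by simp
  qed
  have cover: "\<exists>E \<in> path_edges (P e). v \<in> E" if e: "e \<in> edges H" and v: "v \<in> set (P e)" for e v
  proof -
    obtain i where i: "i < length (P e)" "v = P e ! i" using v by (auto simp: in_set_conv_nth)
    show ?thesis
    proof (cases "Suc i < length (P e)")
      case True
      then show ?thesis using i by (auto simp: path_edges_def)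
    next
      case False
      then have "Suc (i - 1) = i" using i P[OF e] by auto
      then have "{P e ! (i - 1), P e ! i} \<in> path_edges (P e)"
        using i unfolding path_edges_def by (intro CollectI exI[of _ "i - 1"]) simp
      then show ?thesis using i by auto
    qed
  qed
  have sub_edges: "v \<in> set (P e)" if "E \<in> path_edges (P e)" "v \<in> E" for E e v
    using that by (auto simp: path_edges_def)
  have nonempty: "E \<noteq> {}" if "E \<in> path_edges (P e)" for E e
    using that by (auto simp: path_edges_def)
  have "edge_model K (verts K) H (\<lambda>e. set (P e))"
    unfolding edge_model_def
  proof (intro conjI ballI)
    fix e f assume e: "e \<in> edges H" and f: "f \<in> edges H"
    show "if e \<inter> f = {} then set (P e) \<inter> set (P f) = {} else conn K (set (P e) \<union> set (P f))"
      using disj[OF e f] meet[OF e f] connK[OF e] connK[OF f] conn_Un[of K "set (P e)" "set (P f)"]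
      by auto
  qed (use connK in \<open>auto simp: conn_def\<close>)
  moreover have "edge_model (line_graph K) (verts (line_graph K)) H (\<lambda>e. path_edges (P e))"
    unfolding edge_model_def
  proof (intro conjI ballI)
    fix e f assume e: "e \<in> edges H" and f: "f \<in> edges H"
    show "if e \<inter> f = {} then path_edges (P e) \<inter> path_edges (P f) = {}
      else conn (line_graph K) (path_edges (P e) \<union> path_edges (P f))"
    proof (cases "e \<inter> f = {}")
      case True
      then have "E \<notin> path_edges (P f)" if "E \<in> path_edges (P e)" for E
        using disj[OF e f] sub_edges nonempty[OF that] that by blast
      then show ?thesis using True by auto
    next
      case False
      then obtain v where v: "v \<in> set (P e)" "v \<in> set (P f)" using meet[OF e f] by blast
      obtain E F where "E \<in> path_edges (P e)" "v \<in> E" "F \<in> path_edges (P f)" "v \<in> F"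
        using cover[OF e v(1)] cover[OF f v(2)] by blast
      then show ?thesis using conn_edges_Un[OF connL[OF e] connL[OF f]] False by auto
    qed
  qed (use connL in \<open>auto simp: conn_def\<close>)
  ultimately show ?thesis by blast
qed

text \<open>A branch vertex meets one edge of each path that ends in it, and any other vertex lies on a single
  path, of which it meets at most two edges.\<close>

lemma subdivision_edges_at_vertex:
  assumes sub: "subdivision_of K H" and H: "\<And>e. e \<in> edges H \<Longrightarrow> e \<subseteq> verts H \<and> e \<noteq> {}"
    and deg: "\<And>x. finite {e \<in> edges H. x \<in> e} \<and> card {e \<in> edges H. x \<in> e} \<le> 4"
  shows "finite {E \<in> edges K. v \<in> E} \<and> card {E \<in> edges K. v \<in> E} \<le> 4"
proof (rule subdivision_ofE[OF sub H])
  fix b P assume inj: "inj_on b (verts H)"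
    and P: "\<And>e. e \<in> edges H \<Longrightarrow>
      distinct (P e) \<and> 2 \<le> length (P e) \<and> {hd (P e), last (P e)} = b ` e"
    and set: "\<And>e. e \<in> edges H \<Longrightarrow> set (P e) = b ` e \<union> interior (P e)"
    and int: "\<And>e. e \<in> edges H \<Longrightarrow> interior (P e) \<inter> b ` verts H = {}"
    and int2: "\<And>e f. e \<in> edges H \<Longrightarrow> f \<in> edges H \<Longrightarrow> e \<noteq> f \<Longrightarrow> interior (P e) \<inter> interior (P f) = {}"
    and K: "verts K = b ` verts H \<union> (\<Union>e \<in> edges H. set (P e))"
      "edges K = (\<Union>e \<in> edges H. path_edges (P e))"
  have on: "v \<in> set (P e)" if "E \<in> path_edges (P e)" "v \<in> E" for E e
    using that by (auto simp: path_edges_def)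
  note at = path_edges_at_vertex_le[OF conjunct1[OF P]]
  show ?thesis
  proof (cases "v \<in> b ` verts H")
    case True
    then obtain x where x: "x \<in> verts H" "v = b x" by blast
    define N where "N = {e \<in> edges H. x \<in> e}"
    have N: "finite N" "card N \<le> 4" using deg[of x] by (auto simp: N_def)
    have ends: "v = hd (P e) \<or> v = last (P e)" if "e \<in> N" for e
      using that P[of e] x by (auto simp: N_def)
    have "{E \<in> edges K. v \<in> E} \<subseteq> (\<Union>e \<in> N. {E \<in> path_edges (P e). v \<in> E})"
    proof
      fix E assume "E \<in> {E \<in> edges K. v \<in> E}"
      then obtain e where e: "e \<in> edges H" "E \<in> path_edges (P e)" "v \<in> E" using K(2) by auto
      then have "v \<in> b ` e" using on[OF e(2,3)] set[OF e(1)] int[OF e(1)] True by blast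
      then have "x \<in> e" using x inj_onD[OF inj, of x] H[OF e(1)] by auto
      then show "E \<in> (\<Union>e \<in> N. {E \<in> path_edges (P e). v \<in> E})" using e by (auto simp: N_def)
    qed
    moreover have fin: "finite (\<Union>e \<in> N. {E \<in> path_edges (P e). v \<in> E})"
      using N(1) at(1) by (auto simp: N_def)
    moreover have "card (\<Union>e \<in> N. {E \<in> path_edges (P e). v \<in> E}) \<le> 4"
    proof -
      have "card (\<Union>e \<in> N. {E \<in> path_edges (P e). v \<in> E}) \<le>
          (\<Sum>e \<in> N. card {E \<in> path_edges (P e). v \<in> E})"
        using N(1) by (rule card_UN_le)
      also have "\<dots> \<le> (\<Sum>e \<in> N. 1)"
        using at(3) ends by (intro sum_mono) (auto simp: N_def)
      finally show ?thesis using N(2) by simp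
    qed
    ultimately show ?thesis by (meson card_mono finite_subset le_trans)
  next
    case False
    show ?thesis
    proof (cases "{E \<in> edges K. v \<in> E} = {}")
      case True
      then show ?thesis by (simp only:) simp
    next
      case ne: False
      then obtain E e where e: "e \<in> edges H" "E \<in> path_edges (P e)" "v \<in> E" using K(2) by auto
      have inside: "v \<in> interior (P f)" if f: "f \<in> edges H" "F \<in> path_edges (P f)" "v \<in> F" for f F
        using on[OF f(2,3)] set[OF f(1)] H[OF f(1)] False by blast
      have "{E \<in> edges K. v \<in> E} \<subseteq> {E \<in> path_edges (P e). v \<in> E}"
      proof
        fix F assume "F \<in> {E \<in> edges K. v \<in> E}"
        then obtain f where f: "f \<in> edges H" "F \<in> path_edges (P f)" "v \<in> F" using K(2) by auto
        then have "f = e" using inside[OF f] inside[OF e] int2[OF f(1) e(1)] by blast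
        then show "F \<in> {E \<in> path_edges (P e). v \<in> E}" using f by simp
      qed
      from finite_subset[OF this at(1)[OF e(1)]] card_mono[OF at(1)[OF e(1)] this]
      show ?thesis using at(2)[OF e(1), of v] by linarith
    qed
  qed
qed

lemma subdivision_degrees:
  assumes sub: "subdivision_of K H" and H: "\<And>e. e \<in> edges H \<Longrightarrow> e \<subseteq> verts H \<and> e \<noteq> {}"
    and deg: "\<And>x. finite {e \<in> edges H. x \<in> e} \<and> card {e \<in> edges H. x \<in> e} \<le> 4"
  shows "finite {u. adjacent K v u} \<and> card {u. adjacent K v u} \<le> 8"
    "finite {F. adjacent (line_graph K) E F} \<and> card {F. adjacent (line_graph K) E F} \<le> 8"
proof -
  define N where "N = (\<lambda>v. {E \<in> edges K. v \<in> E})"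
  have N: "finite (N v)" "card (N v) \<le> 4" for v
    using subdivision_edges_at_vertex[OF sub H deg, of v] by (auto simp: N_def)
  have inj: "inj_on (\<lambda>u. {v, u}) {u. adjacent K v u}"
    by (rule inj_onI) (auto simp: doubleton_eq_iff)
  have im: "(\<lambda>u. {v, u}) ` {u. adjacent K v u} \<subseteq> N v" by (auto simp: N_def adjacent_def)
  have "finite {u. adjacent K v u}" using finite_subset[OF im N(1)] finite_imageD[OF _ inj] by blast
  moreover have "card {u. adjacent K v u} \<le> 4"
    using card_inj_on_le[OF inj im N(1)] N(2)[of v] by simp
  ultimately show "finite {u. adjacent K v u} \<and> card {u. adjacent K v u} \<le> 8" by simp
  show "finite {F. adjacent (line_graph K) E F} \<and> card {F. adjacent (line_graph K) E F} \<le> 8"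
  proof (cases "E \<in> edges K")
    case False
    then have "{F. adjacent (line_graph K) E F} = {}" by (auto simp: adjacent_line_graph)
    then show ?thesis by (simp only:) simp
  next
    case True
    have "\<exists>P. edges K = (\<Union>e \<in> edges H. path_edges (P e))"
      using sub unfolding subdivision_of_def by (elim exE conjE) (rule exI)
    then obtain x y where xy: "E = {x, y}" using True by (auto simp: path_edges_def)
    have "{F. adjacent (line_graph K) E F} \<subseteq> N x \<union> N y"
      by (auto simp: adjacent_line_graph N_def xy)
    moreover have "finite (N x \<union> N y)" using N by simp
    moreover have "card (N x \<union> N y) \<le> 8"
      using card_Un_le[of "N x" "N y"] N(2)[of x] N(2)[of y] by linarith
    ultimately show ?thesis by (meson card_mono finite_subset le_trans)
  qed
qed

lemma induced_edge_model:
  assumes C: "simple_graph C" and ind: "has_induced C K"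
    and M: "edge_model K (verts K) H \<Phi>"
    and deg: "\<And>v. finite {u. adjacent K v u} \<and> card {u. adjacent K v u} \<le> d"
  shows "\<exists>X \<Psi>. X \<subseteq> verts C \<and> edge_model C X H \<Psi> \<and> (\<forall>s \<in> X. card {x \<in> X. adjacent C s x} \<le> d)"
proof (rule has_induced_embedding[OF C ind])
  fix g assume g: "inj_on g (verts K)" "g ` verts K \<subseteq> verts C"
    and adj: "\<And>u v. u \<in> verts K \<Longrightarrow> v \<in> verts K \<Longrightarrow> adjacent C (g u) (g v) \<longleftrightarrow> adjacent K u v"
  have conn: "conn C (g ` A)" if "conn K A" for A
  proof (rule conn_image[OF that])
    have A: "A \<subseteq> verts K" using that by (simp add: conn_def)
    then show "g ` A \<subseteq> verts C" using g(2) by blast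
    show "adjacent C (g u) (g v)" if "u \<in> A" "v \<in> A" "adjacent K u v" for u v
      using adj[of u v] A that by blast
  qed
  have "edge_model C (g ` verts K) H (\<lambda>e. g ` \<Phi> e)"
    unfolding edge_model_def
  proof (intro conjI ballI)
    fix e f assume e: "e \<in> edges H" and f: "f \<in> edges H"
    have \<Phi>: "\<Phi> e \<subseteq> verts K" "\<Phi> f \<subseteq> verts K"
      "if e \<inter> f = {} then \<Phi> e \<inter> \<Phi> f = {} else conn K (\<Phi> e \<union> \<Phi> f)"
      using M e f unfolding edge_model_def by blast+
    then show "if e \<inter> f = {} then g ` \<Phi> e \<inter> g ` \<Phi> f = {} else conn C (g ` \<Phi> e \<union> g ` \<Phi> f)"
      using inj_on_image_Int[OF g(1) \<Phi>(1,2)] conn[of "\<Phi> e \<union> \<Phi> f"]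
      by (auto simp: image_Un split: if_splits)
  qed (use M conn in \<open>auto simp: edge_model_def\<close>)
  moreover have "card {x \<in> g ` verts K. adjacent C s x} \<le> d" if s: "s \<in> g ` verts K" for s
  proof -
    obtain v where v: "v \<in> verts K" "s = g v" using s by blast
    have "{x \<in> g ` verts K. adjacent C s x} \<subseteq> g ` {u. adjacent K v u}" using adj v by auto
    then have "card {x \<in> g ` verts K. adjacent C s x} \<le> card (g ` {u. adjacent K v u})"
      using deg[of v] by (intro card_mono) auto
    also have "\<dots> \<le> card {u. adjacent K v u}" using deg[of v] by (intro card_image_le) auto
    finally show ?thesis using deg[of v] by linarith
  qed
  ultimately show ?thesis
    using g(2) by (intro exI[of _ "g ` verts K"] exI[of _ "\<lambda>e. g ` \<Phi> e"]) blast
qed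

lemma binary_tree_edges_wf: "e \<in> edges (binary_tree r) \<Longrightarrow> e \<subseteq> verts (binary_tree r) \<and> e \<noteq> {}"
  by (auto simp: binary_tree_def)

lemma binary_tree_degree:
  "finite {e \<in> edges (binary_tree r). v \<in> e} \<and> card {e \<in> edges (binary_tree r). v \<in> e} \<le> 4"
proof -
  define Es where "Es = [{v, True # v}, {v, False # v}, {tl v, v}]"
  have sub: "{e \<in> edges (binary_tree r). v \<in> e} \<subseteq> set Es"
  proof
    fix e assume "e \<in> {e \<in> edges (binary_tree r). v \<in> e}"
    then obtain x xs where e: "e = {xs, x # xs}" "v = xs \<or> v = x # xs"
      by (auto simp: binary_tree_def)
    then show "e \<in> set Es" by (cases x) (auto simp: Es_def)
  qed
  have "length Es \<le> 4" by (simp add: Es_def)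
  then have "card (set Es) \<le> 4" using card_length le_trans by blast
  then show ?thesis
    by (intro conjI finite_subset[OF sub finite_set] le_trans[OF card_mono[OF finite_set sub]])
qed

lemma wall_edges_wf: "e \<in> edges (wall n) \<Longrightarrow> e \<subseteq> verts (wall n) \<and> e \<noteq> {}"
  by (auto simp: wall_def delete_verts_def induce_def brick_grid_def)

lemma wall_degree: "finite {e \<in> edges (wall n). v \<in> e} \<and> card {e \<in> edges (wall n). v \<in> e} \<le> 4"
proof -
  obtain i j where v: "v = (i, j)" by (cases v)
  define Es where "Es = [{(i, j), (i, j + 1)}, {(i, j - 1), (i, j)},
    {(i, j), (i + 1, j)}, {(i - 1, j), (i, j)}]"
  have sub: "{e \<in> edges (wall n). v \<in> e} \<subseteq> set Es"
  proof
    fix e assume "e \<in> {e \<in> edges (wall n). v \<in> e}"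
    then have ve: "v \<in> e" and "e \<in> edges (brick_grid n)"
      by (simp_all add: wall_def delete_verts_def induce_def)
    then have "(\<exists>a c. e = {(a, c), (a, c + 1)}) \<or> (\<exists>a c. e = {(a, c), (a + 1, c)})"
      unfolding brick_grid_def graph.sel
      by (elim UnE CollectE exE conjE)
        (rule disjI1, (rule exI)+, assumption, rule disjI2, (rule exI)+, assumption)
    then consider a c where "e = {(a, c), (a, c + 1)}" | a c where "e = {(a, c), (a + 1, c)}"
      by (elim disjE exE)
    then show "e \<in> set Es"
    proof cases
      case 1
      then have "i = a \<and> j = c \<or> i = a \<and> j = c + 1" using ve by (simp add: v)
      then show ?thesis using 1 by (elim disjE) (simp_all add: Es_def)
    next
      case 2
      then have "i = a \<and> j = c \<or> i = a + 1 \<and> j = c" using ve by (simp add: v)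
      then show ?thesis using 2 by (elim disjE) (simp_all add: Es_def)
    qed
  qed
  have "length Es \<le> 4" by (simp add: Es_def)
  then have "card (set Es) \<le> 4" using card_length le_trans by blast
  then show ?thesis
    by (intro conjI finite_subset[OF sub finite_set] le_trans[OF card_mono[OF finite_set sub]])
qed

section \<open>Excluded induced subgraphs of zigzagged constellations\<close>

lemma zigzagged_bags:
  assumes q: "q \<ge> 1" and C: "constellation C S" and zz: "zigzagged q C S"
    and ind: "has_induced C K" and M: "edge_model K (verts K) H \<Phi>"
    and deg: "\<And>v. finite {u. adjacent K v u} \<and> card {u. adjacent K v u} \<le> 8"
  obtains X \<Psi> bag N where "edge_model C X H \<Psi>" "linear_bags C X bag"
    "\<And>i. finite (bag i)" "\<And>i. card (bag i) \<le> 9 * q" "\<And>i. i > N \<Longrightarrow> bag i = {}"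
    "\<And>A. A \<subseteq> X \<Longrightarrow> A \<inter> S \<noteq> {} \<Longrightarrow> \<exists>i. bag i \<inter> A \<noteq> {}"
proof -
  have G: "simple_graph C" using C by (simp add: constellation_def)
  obtain X \<Psi> where X: "X \<subseteq> verts C" "edge_model C X H \<Psi>"
    "\<forall>s \<in> X. card {x \<in> X. adjacent C s x} \<le> 8"
    using induced_edge_model[OF G ind M deg] by (elim exE conjE)
  obtain \<rho> where \<rho>: "inj_on \<rho> S" "crossing q C S \<rho>" using zigzagged_crossing[OF q C zz] by blast
  have deg_X: "\<And>s. s \<in> S \<inter> X \<Longrightarrow> card {x \<in> X. adjacent C s x} \<le> 8" using X(3) by blast
  from window_bags[OF q C \<rho> X(1) deg_X]
  obtain bag N where bag: "linear_bags C X bag" "\<forall>i. finite (bag i) \<and> card (bag i) \<le> (8 + 1) * q"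
    "\<forall>A. A \<subseteq> X \<longrightarrow> A \<inter> S \<noteq> {} \<longrightarrow> (\<exists>i. bag i \<inter> A \<noteq> {})" "\<forall>i > N. bag i = {}"
    by auto
  show ?thesis by (rule that[OF X(2) bag(1), of N]) (use bag(2-4) in auto)
qed

lemma no_induced_tree_model:
  assumes q: "q \<ge> 1" and C: "constellation C S" and zz: "zigzagged q C S"
    and M: "edge_model K (verts K) (binary_tree (64 * q^2)) \<Phi>"
    and deg: "\<And>v. finite {u. adjacent K v u} \<and> card {u. adjacent K v u} \<le> 8"
  shows "\<not> has_induced C K"
proof
  assume ind: "has_induced C K"
  show False
  proof (rule zigzagged_bags[OF q C zz ind M deg])
    fix X \<Psi> bag and N :: nat
    assume B: "edge_model C X (binary_tree (64 * q^2)) \<Psi>" "linear_bags C X bag"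
      "\<And>i. finite (bag i)" "\<And>i. card (bag i) \<le> 9 * q"
      "\<And>A. A \<subseteq> X \<Longrightarrow> A \<inter> S \<noteq> {} \<Longrightarrow> \<exists>i. bag i \<inter> A \<noteq> {}"
    \<comment> \<open>A subtree of depth \<open>3 + 2 * (9 * q)\<close> already forces a bag with \<open>9 * q + 1\<close> elements.\<close>
    have "64 * q * 1 \<le> 64 * q * q" using q by (intro mult_le_mono2)
    moreover have "64 * q^2 = 64 * q * q" by (simp add: power2_eq_square)
    moreover have "length ([] :: bool list) = 0" by simp
    ultimately have "length ([] :: bool list) + (3 + 2 * (9 * q)) \<le> 64 * q^2"
      using q by linarith
    from subtree_large_bag[OF C B(1,2,3,5) this]
    obtain i where "9 * q + 1 \<le> card (bag i \<inter> support \<Psi> (subtree (3 + 2 * (9 * q)) []))"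
      by blast
    also have "\<dots> \<le> card (bag i)" using B(3) by (intro card_mono) auto
    finally show False using B(4)[of i] by linarith
  qed
qed

lemma no_induced_wall_model:
  assumes q: "q \<ge> 1" and C: "constellation C S" and zz: "zigzagged q C S"
    and M: "edge_model K (verts K) (wall (2 ^ (64 * q^2))) \<Phi>"
    and deg: "\<And>v. finite {u. adjacent K v u} \<and> card {u. adjacent K v u} \<le> 8"
  shows "\<not> has_induced C K"
proof
  assume ind: "has_induced C K"
  show False
  proof (rule zigzagged_bags[OF q C zz ind M deg])
    fix X \<Psi> bag and N :: nat
    assume B: "edge_model C X (wall (2 ^ (64 * q^2))) \<Psi>" "linear_bags C X bag"
      "\<And>i. finite (bag i)" "\<And>i. card (bag i) \<le> 9 * q" "\<And>i. i > N \<Longrightarrow> bag i = {}"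
      "\<And>A. A \<subseteq> X \<Longrightarrow> A \<inter> S \<noteq> {} \<Longrightarrow> \<exists>i. bag i \<inter> A \<noteq> {}"
    have "64 * q * 1 \<le> 64 * q * q" using q by (intro mult_le_mono2)
    moreover have "64 * q^2 = 64 * q * q" by (simp add: power2_eq_square)
    ultimately have "2 * (9 * q) + 4 \<le> 64 * q^2" using q by linarith
    also have "\<dots> \<le> 2 ^ (64 * q^2)" by (rule less_imp_le[OF less_exp])
    finally have large: "2 * (9 * q) + 4 \<le> (2 :: nat) ^ (64 * q^2)" .
    show False
      by (rule wall_bags_contradiction[OF C B(1-4)]) (fact B(5), fact B(6), fact large)
  qed
qed

theorem theorem4p4:
  fixes q :: nat and C :: "'a graph" and S :: "'a set"
  assumes "q \<ge> 1"
    and "constellation C S"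
    and "ample C S"
    and "zigzagged q C S"
  shows
    "(\<forall>l \<ge> 1. \<forall>(D :: 'b graph) T.
        sl_constellation (2 * q + 6) l D T \<and> ample D T \<and> interrupted D T \<longrightarrow> \<not> has_induced C D) \<and>
     (\<forall>K :: 'c graph. subdivision_of K (binary_tree (64 * q^2)) \<longrightarrow>
        \<not> has_induced C K \<and> \<not> has_induced C (line_graph K)) \<and>
     (\<forall>K :: 'd graph. subdivision_of K (wall (2 ^ (64 * q^2))) \<longrightarrow>
        \<not> has_induced C K \<and> \<not> has_induced C (line_graph K))"
proof (intro conjI allI impI)
  fix l and D :: "'b graph" and T
  assume "1 \<le> l" "sl_constellation (2 * q + 6) l D T \<and> ample D T \<and> interrupted D T"
  then show "\<not> has_induced C D"
    using no_induced_interrupted[OF assms, of l D T] by simp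
next
  fix K :: "'c graph"
  assume K: "subdivision_of K (binary_tree (64 * q^2))"
  note models = subdivision_edge_models[OF K binary_tree_edges_wf]
    and degs = subdivision_degrees[OF K binary_tree_edges_wf binary_tree_degree]
  show "\<not> has_induced C K" "\<not> has_induced C (line_graph K)"
    using models no_induced_tree_model[OF assms(1,2,4) _ degs(1)]
      no_induced_tree_model[OF assms(1,2,4) _ degs(2)] by blast+
next
  fix K :: "'d graph"
  assume K: "subdivision_of K (wall (2 ^ (64 * q^2)))"
  note models = subdivision_edge_models[OF K wall_edges_wf]
    and degs = subdivision_degrees[OF K wall_edges_wf wall_degree]
  show "\<not> has_induced C K" "\<not> has_induced C (line_graph K)"
    using models no_induced_wall_model[OF assms(1,2,4) _ degs(1)]
      no_induced_wall_model[OF assms(1,2,4) _ degs(2)] by blast+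
qed

end
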